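(* Let $n\ge 2$ and let $F$ be a field of characteristic zero or of characteristic larger than $2^{n}$. For every graph $G$ on the vertex set $[n]$, the algebraic matroid of the field extension $F\subset F(f_{i,j}\mid \{i,j\}\in E(G))$, where $f_{i,j}=x_iy_j-x_jy_i$ for $i<j$ (that is, the matroid on ground set $E(G)$ in which a set $X\subset E(G)$ is independent iff $\{f_{i,j}\mid \{i,j\}\in X\}$ is algebraically independent over $F$), is isomorphic to the 2-hyperconnectivity matroid $\mathcal{H}_2(G)$. In particular, $\ell(J_G)=\operatorname{rank}(\mathcal{H}_2(G))\le 2n-3$.
   Context: Graphs are finite and simple with no isolated vertices; $[n]=\{1,\dots,n\}$. Binomial edge ideal: for a graph $G$ on $[n]$, $J_G=(x_iy_j-x_jy_i\mid \{i,j\}\in E(G), i<j)\subset F[x_1,\dots,x_n,y_1,\dots,y_n]$. Analytic spread: for an ideal $I$ in a polynomial ring $S=F[t_1,\dots,t_r]$, $\ell(I)$ is the Krull dimension of the special fiber ring $\bigoplus_{k\ge0} I^k/(t_1,\dots,t_r)I^k$. 2-hyperconnectivity matroid: let $x_{p,i}$ ($1\le p\le 2$, $1\le i\le n$) be indeterminates over $F$. For $i<j$ with $\{i,j\}\in E(G)$ let $H_{i,j}$ be the row vector of length $2n$ with entry $x_{p,j}$ in position $2(i-1)+p$ and entry $-x_{p,i}$ in position $2(j-1)+p$ for $p=1,2$, and all other entries $0$. The matrix $\mathcal{H}_2(G)$ has rows $H_{i,j}$, $\{i,j\}\in E(G)$; the matroid $\mathcal{H}_2(G)$ is the linear matroid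 on $E(G)$ given by linear independence of these rows over the field $F(x_{p,i})$, and its rank is the rank of this matrix. (This matroid is known not to depend on the field $F$.) A matroid isomorphism is a bijection of ground sets preserving independent sets in both directions. *)

theory Defs
  imports
    "HOL-Algebra.Algebraic_Closure_Type"
    "HOL-Algebra.Ideal_Product"
    "HOL-Algebra.QuotRing"
    "HOL-Analysis.Cartesian_Space"
    "HOL-Computational_Algebra.Fraction_Field"
    "HOL-Library.Poly_Mapping"
    "HOL-Library.Extended_Nat"
begin

section \<open>Polynomials in several variables\<close>

text \<open>The polynomial ring over \<open>'f\<close> whose indeterminates are exactly the elements of \<open>'v\<close>.\<close>

type_synonym ('v, 'f) mpoly = "('v \<Rightarrow>\<^sub>0 nat) \<Rightarrow>\<^sub>0 'f"

definition mvar :: "'v \<Rightarrow> ('v, 'f::comm_ring_1) mpoly" where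
  "mvar v = Poly_Mapping.single (Poly_Mapping.single v 1) 1"

definition mconst :: "'f \<Rightarrow> ('v, 'f::comm_ring_1) mpoly" where
  "mconst a = Poly_Mapping.single 0 a"

text \<open>Evaluation at the point \<open>g\<close> of a ring whose base ring embedding is \<open>\<iota>\<close>.\<close>

definition mpoly_eval ::
    "('f \<Rightarrow> 'a) \<Rightarrow> ('v \<Rightarrow> 'a) \<Rightarrow> ('v, 'f::comm_ring_1) mpoly \<Rightarrow> 'a::comm_ring_1" where
  "mpoly_eval \<iota> g P =
    (\<Sum>m\<in>Poly_Mapping.keys P. \<iota> (Poly_Mapping.lookup P m) *
      (\<Prod>v\<in>Poly_Mapping.keys m. g v ^ Poly_Mapping.lookup m v))"

text \<open>The indeterminates of the polynomial relation are named by the elements of the set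
  itself, so a relation on \<open>A\<close> is a polynomial only involving indeterminates from \<open>A\<close>.\<close>

definition algebraically_independent :: "('f::comm_ring_1 \<Rightarrow> 'a::comm_ring_1) \<Rightarrow> 'a set \<Rightarrow> bool" where
  "algebraically_independent \<iota> A \<longleftrightarrow>
    (\<forall>P :: ('a, 'f) mpoly. (\<forall>m\<in>Poly_Mapping.keys P. Poly_Mapping.keys m \<subseteq> A) \<longrightarrow>
      mpoly_eval \<iota> (\<lambda>a. a) P = 0 \<longrightarrow> P = 0)"


section \<open>Krull dimension and analytic spread\<close>

definition krull_dim :: "('a, 'm) ring_scheme \<Rightarrow> enat" where
  "krull_dim R = Sup {enat k | k. \<exists>P :: nat \<Rightarrow> 'a set.
      (\<forall>i\<le>k. primeideal (P i) R) \<and> (\<forall>i<k. P i \<subset> P (Suc i))}"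

definition ideal_power :: "'a::comm_ring_1 set \<Rightarrow> nat \<Rightarrow> 'a set" where
  "ideal_power I k = I [^]\<^bsub>ideals_set (ring_of_type_algebra :: 'a ring)\<^esub> k"

text \<open>The graded ring \<open>\<Oplus>\<^sub>k I\<^sup>k\<close> is realised as the subring of the univariate polynomials over
  the ambient ring whose coefficient of degree \<open>k\<close> lies in \<open>I\<^sup>k\<close>.\<close>

definition rees_algebra :: "'a::comm_ring_1 set \<Rightarrow> 'a poly ring" where
  "rees_algebra I = ring_of_type_algebra
    \<lparr> carrier := {p. \<forall>k. poly.coeff p k \<in> ideal_power I k} \<rparr>"

definition irrelevant_ideal :: "('v, 'f::comm_ring_1) mpoly set" where
  "irrelevant_ideal = Idl\<^bsub>ring_of_type_algebra\<^esub> (range mvar)"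

text \<open>\<open>\<Oplus>\<^sub>k \<mm> I\<^sup>k\<close> inside \<open>\<Oplus>\<^sub>k I\<^sup>k\<close>; the quotient by it is \<open>\<Oplus>\<^sub>k I\<^sup>k / \<mm> I\<^sup>k\<close>.\<close>

definition irrelevant_extension :: "('v, 'f::comm_ring_1) mpoly set \<Rightarrow> ('v, 'f) mpoly poly set" where
  "irrelevant_extension I =
    {p. \<forall>k. poly.coeff p k \<in> irrelevant_ideal \<cdot>\<^bsub>ring_of_type_algebra\<^esub> ideal_power I k}"

definition special_fiber :: "('v, 'f::comm_ring_1) mpoly set \<Rightarrow> ('v, 'f) mpoly poly set ring" where
  "special_fiber I = rees_algebra I Quot irrelevant_extension I"

definition analytic_spread :: "('v::finite, 'f::field) mpoly set \<Rightarrow> enat" where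
  "analytic_spread I = krull_dim (special_fiber I)"


subsection \<open>Well-formedness\<close>

lemma ring_of_type_algebra_sel [simp]:
  "carrier ring_of_type_algebra = UNIV"
  "x \<otimes>\<^bsub>ring_of_type_algebra\<^esub> y = x * y"
  "x \<oplus>\<^bsub>ring_of_type_algebra\<^esub> y = x + y"
  "\<one>\<^bsub>ring_of_type_algebra\<^esub> = 1"
  "\<zero>\<^bsub>ring_of_type_algebra\<^esub> = 0"
  by (simp_all add: ring_of_type_algebra_def)

lemma ideal_type_algebra:
  fixes I :: "'a::comm_ring_1 set"
  assumes "ideal I ring_of_type_algebra"
  shows ideal_type_zero: "0 \<in> I"
    and ideal_type_add: "\<And>a b. a \<in> I \<Longrightarrow> b \<in> I \<Longrightarrow> a + b \<in> I"
    and ideal_type_mult: "\<And>a b. a \<in> I \<Longrightarrow> a * b \<in> I"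
    and ideal_type_uminus: "\<And>a. a \<in> I \<Longrightarrow> - a \<in> I"
proof -
  interpret ideal I ring_of_type_algebra by fact
  show "0 \<in> I" using additive_subgroup.zero_closed[OF is_additive_subgroup] by (simp only: ring_of_type_algebra_sel)
  show "a + b \<in> I" if "a \<in> I" "b \<in> I" for a b using additive_subgroup.a_closed[OF is_additive_subgroup that] by simp
  show m: "a * b \<in> I" if "a \<in> I" for a b using I_r_closed[OF that, of b] by simp
  show "- a \<in> I" if "a \<in> I" for a using m[OF that, of "-1"] by simp
qed

lemma ideal_power_0: "ideal_power I 0 = UNIV"
  by (simp add: ideal_power_def ideals_set_def)

lemma ideal_power_Suc:
  "ideal_power I (Suc k) = ideal_power I k \<cdot>\<^bsub>ring_of_type_algebra\<^esub> I"
  by (simp add: ideal_power_def ideals_set_def)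

lemma ideal_ideal_power:
  fixes I :: "'a::comm_ring_1 set"
  assumes "ideal I ring_of_type_algebra"
  shows "ideal (ideal_power I k) ring_of_type_algebra"
proof (induction k)
  case 0
  show ?case
    using ring.oneideal[OF ring_from_type_algebra] by (simp add: ideal_power_0)
next
  case (Suc k)
  then show ?case
    unfolding ideal_power_Suc
    using ring.ideal_prod_is_ideal[OF ring_from_type_algebra] assms by blast
qed

lemma ideal_power_mult:
  fixes I :: "'a::comm_ring_1 set"
  assumes "ideal I ring_of_type_algebra"
    and "a \<in> ideal_power I k" "b \<in> ideal_power I l"
  shows "a * b \<in> ideal_power I (k + l)"
  using assms(3)
proof (induction l arbitrary: b)
  case 0
  show ?case using ideal_type_mult[OF ideal_ideal_power[OF assms(1)] assms(2)] by simp
next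
  case (Suc l)
  from Suc.prems have "b \<in> ideal_power I l \<cdot>\<^bsub>ring_of_type_algebra\<^esub> I"
    by (simp add: ideal_power_Suc)
  then have "a * b \<in> ideal_power I (k + l) \<cdot>\<^bsub>ring_of_type_algebra\<^esub> I"
  proof (induction rule: ideal_prod.induct)
    case (prod i j)
    from ideal_prod.prod[OF Suc.IH[OF prod(1)] prod(2), of ring_of_type_algebra]
    show ?case by (simp add: mult.assoc)
  next
    case (sum s t)
    from ideal_prod.sum[OF sum.IH] show ?case by (simp add: distrib_left)
  qed
  then show ?case by (simp add: ideal_power_Suc)
qed

lemma rees_algebra_sel [simp]:
  "p \<in> carrier (rees_algebra I) \<longleftrightarrow> (\<forall>k. poly.coeff p k \<in> ideal_power I k)"
  "p \<otimes>\<^bsub>rees_algebra I\<^esub> q = p * q"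
  "p \<oplus>\<^bsub>rees_algebra I\<^esub> q = p + q"
  "\<one>\<^bsub>rees_algebra I\<^esub> = 1"
  "\<zero>\<^bsub>rees_algebra I\<^esub> = 0"
  by (simp_all add: rees_algebra_def ring_of_type_algebra_def)

lemma ideal_type_sum:
  fixes I :: "'a::comm_ring_1 set"
  assumes "ideal I ring_of_type_algebra" "\<And>i. i \<in> A \<Longrightarrow> f i \<in> I"
  shows "sum f A \<in> I"
  using assms(2) by (induction A rule: infinite_finite_induct)
    (auto simp: ideal_type_zero[OF assms(1)] ideal_type_add[OF assms(1)])

lemma cring_rees_algebra:
  fixes I :: "'a::comm_ring_1 set"
  assumes I: "ideal I ring_of_type_algebra"
  shows "cring (rees_algebra I)"
proof -
  note ip = ideal_ideal_power[OF I]
  note cl = ideal_type_zero[OF ip] ideal_type_add[OF ip] ideal_type_uminus[OF ip]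
  have m: "poly.coeff (p * q) k \<in> ideal_power I k"
    if "\<forall>k. poly.coeff p k \<in> ideal_power I k" "\<forall>k. poly.coeff q k \<in> ideal_power I k" for p q k
    unfolding coeff_mult
  proof (rule ideal_type_sum[OF ip])
    fix i assume "i \<in> {..k}"
    then show "poly.coeff p i * poly.coeff q (k - i) \<in> ideal_power I k"
      using ideal_power_mult[OF I, of "poly.coeff p i" i "poly.coeff q (k - i)" "k - i"] that by simp
  qed
  have one: "poly.coeff 1 k \<in> ideal_power I k" for k
    using cl(1)[of k] by (cases "k = 0") (simp_all add: ideal_power_0)
  show ?thesis
  proof (rule cringI)
    show "abelian_group (rees_algebra I)"
    proof (rule abelian_groupI)
      fix x assume "x \<in> carrier (rees_algebra I)"
      then show "\<exists>y\<in>carrier (rees_algebra I). y \<oplus>\<^bsub>rees_algebra I\<^esub> x = \<zero>\<^bsub>rees_algebra I\<^esub>"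
        by (intro bexI[of _ "- x"]) (auto simp: cl)
    qed (auto simp: cl)
    show "Group.comm_monoid (rees_algebra I)"
      by (rule Group.comm_monoidI) (simp_all add: m one ac_simps del: coeff_1)
  qed (auto simp: distrib_right)
qed

lemma ideal_irrelevant_ideal: "ideal irrelevant_ideal ring_of_type_algebra"
  unfolding irrelevant_ideal_def
  by (rule ring.genideal_ideal[OF ring_from_type_algebra]) simp

lemma ideal_irrelevant_extension:
  fixes I :: "('v, 'f::comm_ring_1) mpoly set"
  assumes I: "ideal I ring_of_type_algebra"
  shows "ideal (irrelevant_extension I) (rees_algebra I)"
proof -
  let ?S = "ring_of_type_algebra :: ('v, 'f) mpoly ring"
  let ?mI = "\<lambda>k. irrelevant_ideal \<cdot>\<^bsub>?S\<^esub> ideal_power I k"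
  interpret R: cring "rees_algebra I" by (rule cring_rees_algebra[OF I])
  note ip = ideal_ideal_power[OF I]
  have mi: "ideal (?mI k) ?S" for k
    by (rule ring.ideal_prod_is_ideal[OF ring_from_type_algebra ideal_irrelevant_ideal ip])
  note cl = ideal_type_zero[OF mi] ideal_type_add[OF mi] ideal_type_uminus[OF mi]
  have sub: "?mI k \<subseteq> ideal_power I k" for k
    using ring.ideal_prod_inter[OF ring_from_type_algebra ideal_irrelevant_ideal ip] by blast
  have mm: "a * b \<in> ?mI (k + l)" if "a \<in> ?mI k" "b \<in> ideal_power I l" for a b k l
    using that(1)
  proof (induction rule: ideal_prod.induct)
    case (prod i j)
    from ideal_prod.prod[OF prod(1) ideal_power_mult[OF I prod(2) that(2)], of ?S]
    show ?case by (simp add: mult.assoc)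
  next
    case (sum s t)
    from ideal_prod.sum[OF sum.IH] show ?case by (simp add: distrib_right)
  qed
  have m: "p * q \<in> irrelevant_extension I"
    if "p \<in> irrelevant_extension I" "q \<in> carrier (rees_algebra I)" for p q
    unfolding irrelevant_extension_def mem_Collect_eq coeff_mult
  proof (intro allI ideal_type_sum[OF mi])
    fix k i :: nat assume "i \<in> {..k}"
    then show "poly.coeff p i * poly.coeff q (k - i) \<in> ?mI k"
      using mm[of "poly.coeff p i" i "poly.coeff q (k - i)" "k - i"] that
      by (simp add: irrelevant_extension_def)
  qed
  have carr: "irrelevant_extension I \<subseteq> carrier (rees_algebra I)"
    unfolding irrelevant_extension_def using sub by fastforce
  show ?thesis
  proof (rule idealI[OF R.ring_axioms])
    show "subgroup (irrelevant_extension I) (add_monoid (rees_algebra I))"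
    proof (rule group.subgroupI[OF R.add.is_group])
      show "irrelevant_extension I \<subseteq> carrier (add_monoid (rees_algebra I))"
        using carr by simp
      show "irrelevant_extension I \<noteq> {}"
        using cl(1) by (auto simp: irrelevant_extension_def intro!: exI[of _ 0])
      show "inv\<^bsub>add_monoid (rees_algebra I)\<^esub> p \<in> irrelevant_extension I"
        if "p \<in> irrelevant_extension I" for p
      proof -
        have q: "- p \<in> irrelevant_extension I"
          using that cl(3) by (auto simp: irrelevant_extension_def)
        have "\<ominus>\<^bsub>rees_algebra I\<^esub> p = - p"
          by (rule R.minus_equality) (use that q carr in auto)
        then show ?thesis using q by (simp add: a_inv_def)
      qed
    qed (use cl(2) in \<open>auto simp: irrelevant_extension_def\<close>)
  qed (use m in \<open>auto simp: mult.commute\<close>)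
qed

lemma cring_special_fiber:
  fixes I :: "('v, 'f::comm_ring_1) mpoly set"
  assumes "ideal I ring_of_type_algebra"
  shows "cring (special_fiber I)"
  unfolding special_fiber_def
  using ideal.quotient_is_cring[OF ideal_irrelevant_extension cring_rees_algebra] assms by blast


section \<open>The binomial edge ideal\<close>

text \<open>The vertex set \<open>[n]\<close> is a finite linearly ordered type \<open>'n\<close> with \<open>n\<close> elements.  The type
  \<open>'n coord\<close> has the \<open>2n\<close> elements \<open>(p, i)\<close> with \<open>p = 1\<close> (\<open>CX i\<close>) or \<open>p = 2\<close> (\<open>CY i\<close>).
  It serves both as index set of the indeterminates \<open>x\<^sub>i = x\<^bsub>1,i\<^esub>\<close>, \<open>y\<^sub>i = x\<^bsub>2,i\<^esub>\<close>
  and as index set of the columns of the matrix.  Its linear order is only needed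
  for the integral domain instance of polynomials.\<close>

datatype 'n coord = CX 'n | CY 'n

instance coord :: (finite) finite
proof
  have "(UNIV :: 'a coord set) = range CX \<union> range CY"
  proof (rule UNIV_eq_I)
    fix c :: "'a coord"
    show "c \<in> range CX \<union> range CY" by (cases c) auto
  qed
  moreover have "finite (range CX \<union> range CY :: 'a coord set)"
    by simp
  ultimately show "finite (UNIV :: 'a coord set)"
    by (simp only:)
qed

instantiation coord :: (linorder) linorder
begin

fun less_eq_coord :: "'a coord \<Rightarrow> 'a coord \<Rightarrow> bool" where
  "less_eq_coord (CX i) (CX j) \<longleftrightarrow> i \<le> j"
| "less_eq_coord (CX i) (CY j) \<longleftrightarrow> True"
| "less_eq_coord (CY i) (CX j) \<longleftrightarrow> False"
| "less_eq_coord (CY i) (CY j) \<longleftrightarrow> i \<le> j"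

definition less_coord :: "'a coord \<Rightarrow> 'a coord \<Rightarrow> bool" where
  "less_coord a b \<longleftrightarrow> a \<le> b \<and> \<not> b \<le> a"

instance
proof
  fix a b c :: "'a coord"
  show "a < b \<longleftrightarrow> a \<le> b \<and> \<not> b \<le> a" by (rule less_coord_def)
  show "a \<le> a" by (cases a) auto
  show "a \<le> b \<or> b \<le> a" by (cases a; cases b) auto
  show "a = b" if "a \<le> b" "b \<le> a" using that by (cases a; cases b) auto
  show "a \<le> c" if "a \<le> b" "b \<le> c" using that by (cases a; cases b; cases c) auto
qed

end

definition simple_graph_edges :: "'n set set \<Rightarrow> bool" where
  "simple_graph_edges E \<longleftrightarrow> (\<forall>e\<in>E. card e = 2)"

definition no_isolated_vertices :: "'n set set \<Rightarrow> bool" where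
  "no_isolated_vertices E \<longleftrightarrow> (\<forall>v. \<exists>e\<in>E. v \<in> e)"

text \<open>An edge \<open>{i, j}\<close> with \<open>i < j\<close> has \<open>i = Min e\<close> and \<open>j = Max e\<close>.\<close>

definition edge_binomial :: "'n::linorder set \<Rightarrow> ('n coord, 'f::field) mpoly" where
  "edge_binomial e = (let i = Min e; j = Max e in
    mvar (CX i) * mvar (CY j) - mvar (CX j) * mvar (CY i))"

definition binomial_edge_ideal :: "'n::linorder set set \<Rightarrow> ('n coord, 'f::field) mpoly set" where
  "binomial_edge_ideal E = Idl\<^bsub>ring_of_type_algebra\<^esub> (edge_binomial ` E)"


section \<open>The two matroids\<close>

text \<open>A matroid on a ground set is given by its independence predicate.\<close>

definition matroid_isomorphism ::
    "('a \<Rightarrow> 'b) \<Rightarrow> 'a set \<Rightarrow> ('a set \<Rightarrow> bool) \<Rightarrow> 'b set \<Rightarrow> ('b set \<Rightarrow> bool) \<Rightarrow> bool" where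
  "matroid_isomorphism \<phi> E indep E' indep' \<longleftrightarrow>
    bij_betw \<phi> E E' \<and> (\<forall>A\<subseteq>E. indep A \<longleftrightarrow> indep' (\<phi> ` A))"

definition matroid_isomorphic ::
    "'a set \<Rightarrow> ('a set \<Rightarrow> bool) \<Rightarrow> 'b set \<Rightarrow> ('b set \<Rightarrow> bool) \<Rightarrow> bool" where
  "matroid_isomorphic E indep E' indep' \<longleftrightarrow> (\<exists>\<phi>. matroid_isomorphism \<phi> E indep E' indep')"

text \<open>Algebraic independence is tested in the polynomial ring itself, which embeds into its
  fraction field and hence has the same polynomial relations among the binomials as the
  extension field generated by them.\<close>

definition algebraic_indep :: "'f::field itself \<Rightarrow> 'n::linorder set set \<Rightarrow> bool" where
  "algebraic_indep _ A \<longleftrightarrow> algebraically_independent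
    (mconst :: 'f \<Rightarrow> ('n coord, 'f) mpoly) (edge_binomial ` A)"

definition generic_coord :: "'n coord \<Rightarrow> ('n::linorder coord, 'f::field) mpoly fract" where
  "generic_coord c = Fract (mvar c) 1"

definition hyperconn_row ::
    "'n::{finite,linorder} set \<Rightarrow> ('n coord, 'f::field) mpoly fract ^ 'n coord" where
  "hyperconn_row e = (let i = Min e; j = Max e in
    \<chi> c. case c of
      CX k \<Rightarrow> if k = i then generic_coord (CX j) else if k = j then - generic_coord (CX i) else 0
    | CY k \<Rightarrow> if k = i then generic_coord (CY j) else if k = j then - generic_coord (CY i) else 0)"

text \<open>Linear independence of the family of rows indexed by \<open>A\<close>: a set of edges with a
  repeated row would be dependent.\<close>

definition hyperconn_indep :: "'f::field itself \<Rightarrow> 'n::{finite,linorder} set set \<Rightarrow> bool" where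
  "hyperconn_indep _ A \<longleftrightarrow>
    inj_on (hyperconn_row :: 'n set \<Rightarrow> ('n coord, 'f) mpoly fract ^ 'n coord) A \<and>
    vec.independent ((hyperconn_row :: 'n set \<Rightarrow> ('n coord, 'f) mpoly fract ^ 'n coord) ` A)"

text \<open>The rank of the matrix is the dimension of its row space, as in the library's
  definition of \<^const>\<open>rank\<close>; the latter is not applicable because the rows are indexed
  by a set of edges, not by a type.\<close>

definition hyperconn_rank :: "'f::field itself \<Rightarrow> 'n::{finite,linorder} set set \<Rightarrow> nat" where
  "hyperconn_rank _ E =
    vec.dim ((hyperconn_row :: 'n set \<Rightarrow> ('n coord, 'f) mpoly fract ^ 'n coord) ` E)"

end

theory Submission
  imports Defs "HOL-Analysis.Determinants"
begin

text \<open>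
  Up to sign, and after exchanging the columns of \<open>x\<^sub>i\<close> and \<open>y\<^sub>i\<close>, the row of an edge in the
  hyperconnectivity matrix is the gradient of its binomial, so the identity of \<open>E\<close> is the required
  isomorphism as soon as the Jacobian criterion holds for the binomials.  Independent gradients give
  algebraically independent forms in every characteristic, because the forms have coefficients in
  the prime field.  Conversely, forms independent over \<open>F\<close> are independent over the integers,
  where the Jacobian criterion provides a nonvanishing minor of the gradients extended by unit
  vectors.  Expanding this minor along the two blocks of columns, every coefficient is a sum of
  determinants of incidence matrices, hence of signs, and counting the edge sets with a given
  degree sequence bounds it by \<open>2\<^sup>n\<close>.  So the minor does not vanish over \<open>F\<close>.

  The special fiber of an ideal generated by forms of the same degree is the algebra generated by
  these forms.  Its Krull dimension is its transcendence degree, by Noether normalization, going up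
  along finite extensions, and a dimension count.
\<close>

section \<open>Evaluation of polynomials\<close>

text \<open>In characteristic \<open>p\<close> algebraic independence does not in general force
  independent gradients: the gradient of \<open>x^p\<close> is zero. So the converse must pass
  through the integers, where a relation of minimal degree for a coordinate cannot have vanishing
  derivative in that coordinate. The price is a return to \<open>F\<close>: a minor that is nonzero
  over the integers has to survive reduction, and it does because one of its nonzero coefficients
  has absolute value at most \<open>2^n\<close>. The exponent is \<open>n\<close>, not the number
  \<open>2n\<close> of rows, because the rows that take their second block in a nonzero term all
  live in \<open>n\<close> columns. The unit vectors are the gradients of the coordinates that
  complete the forms to a maximal algebraically independent set; they make the matrix square. Since
  relations over the integers and over \<open>F\<close> occur side by side, transcendence degree is
  obtained by counting monomials with fraction-free linear algebra over a domain, not from the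
  theory of field extensions. The same count bounds prime chains from above and the size of a
  Noether normalization from below.\<close>

abbreviation "lookup \<equiv> Poly_Mapping.lookup"
abbreviation "keys \<equiv> Poly_Mapping.keys"
abbreviation "single \<equiv> Poly_Mapping.single"

lemma mpoly_eq_sum_single:
  "P = (\<Sum>m\<in>keys P. single m (lookup P m))"
  by (rule poly_mapping_eqI)
    (simp add: lookup_sum lookup_single when_def in_keys_iff if_distrib sum.delta cong: if_cong)

lemma poly_mapping_single_induct [case_names zero single add]:
  assumes "Q 0" "\<And>m c. c \<noteq> 0 \<Longrightarrow> Q (single m c)" "\<And>p q. Q p \<Longrightarrow> Q q \<Longrightarrow> Q (p + q)"
  shows "Q (P :: 'm \<Rightarrow>\<^sub>0 'c::comm_monoid_add)"
proof -
  have "Q (\<Sum>m\<in>K. single m (lookup P m))"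
    if "finite K" "K \<subseteq> keys P" for K
    using that by (induction K rule: finite_induct) (auto intro!: assms simp: in_keys_iff)
  from this[OF finite_keys order_refl] show ?thesis by (metis mpoly_eq_sum_single)
qed

definition monom_val :: "('v \<Rightarrow> 'a::comm_monoid_mult) \<Rightarrow> ('v \<Rightarrow>\<^sub>0 nat) \<Rightarrow> 'a" where
  "monom_val g m = (\<Prod>v\<in>keys m. g v ^ lookup m v)"

lemma monom_val_superset:
  assumes "finite S" "keys m \<subseteq> S"
  shows "monom_val g m = (\<Prod>v\<in>S. g v ^ lookup m v)"
  unfolding monom_val_def using assms
  by (intro prod.mono_neutral_left) (auto simp: in_keys_iff)

lemma monom_val_0 [simp]: "monom_val g 0 = 1"
  by (simp add: monom_val_def)

lemma monom_val_add: "monom_val g (m + m') = monom_val g m * monom_val g m'"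
proof -
  let ?S = "keys m \<union> keys m'"
  have "keys (m + m') \<subseteq> ?S" by (rule Poly_Mapping.keys_add)
  then show ?thesis
    by (simp add: monom_val_superset[of ?S] lookup_add power_add prod.distrib)
qed

lemma monom_val_single [simp]: "monom_val g (single v k) = g v ^ k"
  by (cases "k = 0") (simp_all add: monom_val_def)

lemma monom_val_cong:
  "(\<And>v. v \<in> keys m \<Longrightarrow> g v = h v) \<Longrightarrow> monom_val g m = monom_val h m"
  by (simp add: monom_val_def)

lemma mpoly_eval_monom_val:
  "mpoly_eval \<iota> g P = (\<Sum>m\<in>keys P. \<iota> (lookup P m) * monom_val g m)"
  by (simp add: mpoly_eval_def monom_val_def)

lemma mvar_power: "mvar v ^ k = single (single v k) (1::'f::comm_ring_1)"
  by (induction k) (simp_all add: mvar_def mult_single flip: single_add)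

lemma monom_val_mvar: "monom_val mvar m = single m (1::'f::comm_ring_1)"
proof (induction m rule: poly_mapping_single_induct)
  case (add p q)
  then show ?case by (simp add: monom_val_add mult_single)
qed (simp_all add: mvar_power)

lemma mconst_mult_single: "mconst c * single m b = single m (c * b)"
  by (simp add: mconst_def mult_single)

lemma mconst_add: "mconst (a + b) = mconst a + mconst b"
  and mconst_mult: "mconst (a * b) = mconst a * mconst b"
  and mconst_0 [simp]: "mconst 0 = 0"
  and mconst_1 [simp]: "mconst 1 = 1"
  and mconst_uminus: "mconst (- a) = - mconst a"
  by (simp_all add: mconst_def single_add mult_single single_uminus)

lemma mconst_eq_0_iff [simp]: "mconst a = 0 \<longleftrightarrow> a = 0"
  unfolding mconst_def using inj_single[of 0] by (metis injD single_zero)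

lemma mpoly_induct [case_names const var add mult]:
  assumes "\<And>c. Q (mconst c)" "\<And>v. Q (mvar v)" "\<And>p q. Q p \<Longrightarrow> Q q \<Longrightarrow> Q (p + q)"
    "\<And>p q. Q p \<Longrightarrow> Q q \<Longrightarrow> Q (p * q)"
  shows "Q (P :: ('v, 'f::comm_ring_1) mpoly)"
proof (induction P rule: poly_mapping_single_induct)
  case zero
  show ?case using assms(1)[of 0] by simp
next
  case (single m c)
  have pw: "Q (mvar v ^ k)" for v k
    by (induction k) (use assms(1)[of 1] assms(2,4) in simp_all)
  have "Q (\<Prod>v\<in>K. mvar v ^ lookup m v)" if "finite K" for K
    using that by (induction K rule: finite_induct) (use pw assms(1)[of 1] assms(4) in simp_all)
  from this[OF finite_keys] have "Q (monom_val mvar m)" by (simp add: monom_val_def)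
  from assms(4)[OF assms(1)[of c] this] show ?case
    by (simp add: monom_val_mvar mconst_mult_single)
next
  case (add p q)
  then show ?case using assms(3) by simp
qed

section \<open>Ring homomorphisms and evaluation\<close>

locale comm_ring_1_hom =
  fixes \<iota> :: "'f::comm_ring_1 \<Rightarrow> 'a::comm_ring_1"
  assumes hom_add: "\<iota> (x + y) = \<iota> x + \<iota> y"
    and hom_mult: "\<iota> (x * y) = \<iota> x * \<iota> y"
    and hom_1 [simp]: "\<iota> 1 = 1"
begin

lemma hom_0 [simp]: "\<iota> 0 = 0"
  using hom_add[of 0 0] by simp

lemma hom_uminus: "\<iota> (- x) = - \<iota> x"
  using hom_add[of x "- x"] by (simp add: eq_neg_iff_add_eq_0 add.commute)

lemma hom_diff: "\<iota> (x - y) = \<iota> x - \<iota> y"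
  using hom_add[of x "- y"] by (simp add: hom_uminus)

lemma hom_sum: "\<iota> (sum f A) = (\<Sum>a\<in>A. \<iota> (f a))"
  by (induction A rule: infinite_finite_induct) (simp_all add: hom_add)

lemma hom_prod: "\<iota> (prod f A) = (\<Prod>a\<in>A. \<iota> (f a))"
  by (induction A rule: infinite_finite_induct) (simp_all add: hom_mult)

lemma hom_power: "\<iota> (x ^ k) = \<iota> x ^ k"
  by (induction k) (simp_all add: hom_mult)

lemma hom_of_int: "\<iota> (of_int k) = of_int k"
proof -
  have n: "\<iota> (of_nat k) = of_nat k" for k
    by (induction k) (simp_all add: hom_add)
  show ?thesis
    by (cases k) (simp_all add: n hom_uminus hom_diff hom_add)
qed

lemma hom_monom_val: "\<iota> (monom_val g m) = monom_val (\<lambda>v. \<iota> (g v)) m"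
  by (simp add: monom_val_def hom_prod hom_power)

lemma mpoly_eval_superset:
  assumes "finite S" "keys P \<subseteq> S"
  shows "mpoly_eval \<iota> g P = (\<Sum>m\<in>S. \<iota> (lookup P m) * monom_val g m)"
  unfolding mpoly_eval_monom_val using assms
  by (intro sum.mono_neutral_left) (auto simp: in_keys_iff)

lemma mpoly_eval_0 [simp]: "mpoly_eval \<iota> g 0 = 0"
  by (simp add: mpoly_eval_def)

lemma mpoly_eval_add: "mpoly_eval \<iota> g (P + Q) = mpoly_eval \<iota> g P + mpoly_eval \<iota> g Q"
proof -
  let ?S = "keys P \<union> keys Q"
  have "keys (P + Q) \<subseteq> ?S" by (rule Poly_Mapping.keys_add)
  then show ?thesis
    by (simp add: mpoly_eval_superset[of ?S] lookup_add hom_add distrib_right sum.distrib)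
qed

lemma mpoly_eval_single: "mpoly_eval \<iota> g (single m c) = \<iota> c * monom_val g m"
  by (cases "c = 0") (simp_all add: mpoly_eval_monom_val)

lemma mpoly_eval_mconst [simp]: "mpoly_eval \<iota> g (mconst c) = \<iota> c"
  by (simp add: mconst_def mpoly_eval_single)

lemma mpoly_eval_mvar [simp]: "mpoly_eval \<iota> g (mvar v) = g v"
  by (simp add: mvar_def mpoly_eval_single)

lemma mpoly_eval_mult: "mpoly_eval \<iota> g (P * Q) = mpoly_eval \<iota> g P * mpoly_eval \<iota> g Q"
proof (induction P rule: poly_mapping_single_induct)
  case (single m c)
  show ?case
  proof (induction Q rule: poly_mapping_single_induct)
    case (single m' c')
    show ?case by (simp add: mult_single mpoly_eval_single monom_val_add hom_mult)
  qed (simp_all add: distrib_left mpoly_eval_add)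
qed (simp_all add: distrib_right mpoly_eval_add)

lemma mpoly_eval_hom: "comm_ring_1_hom (mpoly_eval \<iota> g)"
proof
  show "mpoly_eval \<iota> g 1 = 1"
    using mpoly_eval_mconst[of g 1] by (simp del: mpoly_eval_mconst)
qed (simp_all add: mpoly_eval_add mpoly_eval_mult)

lemma comp_hom: "comm_ring_1_hom h \<Longrightarrow> comm_ring_1_hom (\<lambda>x. h (\<iota> x))"
  by (simp add: comm_ring_1_hom_def hom_add hom_mult)

lemma hom_mpoly_eval:
  assumes "comm_ring_1_hom h"
  shows "h (mpoly_eval \<iota> g P) = mpoly_eval (\<lambda>c. h (\<iota> c)) (\<lambda>v. h (g v)) P"
proof -
  interpret h: comm_ring_1_hom h by fact
  show ?thesis
    by (simp add: mpoly_eval_monom_val h.hom_sum h.hom_mult h.hom_monom_val)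
qed

end

lemma mpoly_eval_cong:
  assumes "\<And>v. v \<in> (\<Union>m\<in>keys P. keys m) \<Longrightarrow> g v = h v"
  shows "mpoly_eval \<iota> g P = mpoly_eval \<iota> h P"
  unfolding mpoly_eval_monom_val by (intro sum.cong refl arg_cong2[where f = "(*)"] monom_val_cong assms) auto

lemma mconst_hom: "comm_ring_1_hom (mconst :: 'f::comm_ring_1 \<Rightarrow> ('v, 'f) mpoly)"
  by standard (simp_all add: mconst_add mconst_mult)

interpretation mconst: comm_ring_1_hom "mconst :: 'f::comm_ring_1 \<Rightarrow> ('v, 'f) mpoly"
  by (rule mconst_hom)

lemma mpoly_eval_mvar_id [simp]: "mpoly_eval mconst mvar P = P"
  by (simp add: mpoly_eval_monom_val monom_val_mvar mconst_mult_single mpoly_eq_sum_single[symmetric])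


section \<open>Subalgebras generated by a set\<close>

definition polys_in :: "'v set \<Rightarrow> ('v, 'f::comm_ring_1) mpoly set" where
  "polys_in A = {P. \<forall>m\<in>keys P. keys m \<subseteq> A}"

lemma algebraically_independent_iff:
  "algebraically_independent \<iota> A \<longleftrightarrow>
    (\<forall>P\<in>polys_in A. mpoly_eval \<iota> (\<lambda>a. a) P = 0 \<longrightarrow> P = 0)"
  by (auto simp: algebraically_independent_def polys_in_def)

lemma polys_in_mono: "A \<subseteq> B \<Longrightarrow> polys_in A \<subseteq> polys_in B"
  by (auto simp: polys_in_def)

lemma polys_in_single: "keys m \<subseteq> A \<Longrightarrow> single m c \<in> polys_in A"
  by (auto simp: polys_in_def)

lemma polys_in_mconst: "mconst c \<in> polys_in A"
  unfolding mconst_def by (rule polys_in_single) simp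

lemma polys_in_mvar: "v \<in> A \<Longrightarrow> mvar v \<in> polys_in A"
  unfolding mvar_def by (rule polys_in_single) simp

lemma polys_in_add: "P \<in> polys_in A \<Longrightarrow> Q \<in> polys_in A \<Longrightarrow> P + Q \<in> polys_in A"
  using Poly_Mapping.keys_add[of P Q] by (fastforce simp: polys_in_def)

lemma polys_in_mult:
  assumes "P \<in> polys_in A" "Q \<in> polys_in A"
  shows "P * Q \<in> polys_in A"
  unfolding polys_in_def mem_Collect_eq
proof
  fix m assume "m \<in> keys (P * Q)"
  then obtain a b where "m = a + b" "a \<in> keys P" "b \<in> keys Q"
    using Poly_Mapping.keys_mult[of P Q] by blast
  with assms show "keys m \<subseteq> A"
    using Poly_Mapping.keys_add[of a b] by (fastforce simp: polys_in_def)
qed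

lemma polys_in_0 [simp]: "0 \<in> polys_in A"
  by (simp add: polys_in_def)

lemma polys_in_uminus: "P \<in> polys_in A \<Longrightarrow> - P \<in> polys_in A"
  using polys_in_mult[OF polys_in_mconst[of "- 1"]] by (metis mconst_uminus mconst_1 mult_minus1)

lemma polys_in_diff: "P \<in> polys_in A \<Longrightarrow> Q \<in> polys_in A \<Longrightarrow> P - Q \<in> polys_in A"
  using polys_in_add[OF _ polys_in_uminus] by fastforce

lemma polys_in_sum: "(\<And>i. i \<in> I \<Longrightarrow> f i \<in> polys_in A) \<Longrightarrow> sum f I \<in> polys_in A"
  by (induction I rule: infinite_finite_induct) (auto intro: polys_in_add)

lemma polys_in_power: "P \<in> polys_in A \<Longrightarrow> P ^ k \<in> polys_in A"
  by (induction k) (use polys_in_mconst[of 1] in \<open>auto intro: polys_in_mult\<close>)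

lemma polys_in_empty: "P \<in> polys_in {} \<Longrightarrow> P = mconst (lookup P 0)"
  unfolding mconst_def polys_in_def
  by (intro poly_mapping_eqI) (auto simp: lookup_single when_def in_keys_iff)

text \<open>The closure form supplies an induction rule for subalgebra elements;
  \<open>adj_iff\<close> recovers the description as values of polynomials whose indeterminates lie
  in \<open>A\<close>.\<close>

inductive_set adj :: "('f::comm_ring_1 \<Rightarrow> 'a::comm_ring_1) \<Rightarrow> 'a set \<Rightarrow> 'a set"
  for \<iota> A where
  adj_scal: "\<iota> c \<in> adj \<iota> A"
| adj_gen: "a \<in> A \<Longrightarrow> a \<in> adj \<iota> A"
| adj_add: "x \<in> adj \<iota> A \<Longrightarrow> y \<in> adj \<iota> A \<Longrightarrow> x + y \<in> adj \<iota> A"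
| adj_mult: "x \<in> adj \<iota> A \<Longrightarrow> y \<in> adj \<iota> A \<Longrightarrow> x * y \<in> adj \<iota> A"

lemma adj_subset: "A \<subseteq> adj \<iota> B \<Longrightarrow> adj \<iota> A \<subseteq> adj \<iota> B"
proof
  fix x assume "A \<subseteq> adj \<iota> B" "x \<in> adj \<iota> A"
  from this(2,1) show "x \<in> adj \<iota> B"
    by (induction rule: adj.induct) (auto intro: adj.intros)
qed

context comm_ring_1_hom
begin

lemma adj_0 [simp]: "0 \<in> adj \<iota> A"
  using adj_scal[of \<iota> 0] by simp

lemma adj_1 [simp]: "1 \<in> adj \<iota> A"
  using adj_scal[of \<iota> 1] by simp

lemma adj_uminus: "x \<in> adj \<iota> A \<Longrightarrow> - x \<in> adj \<iota> A"
  using adj_mult[OF adj_scal[of \<iota> "- 1"]] by (fastforce simp: hom_uminus)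

lemma adj_diff: "x \<in> adj \<iota> A \<Longrightarrow> y \<in> adj \<iota> A \<Longrightarrow> x - y \<in> adj \<iota> A"
  using adj_add[OF _ adj_uminus] by fastforce

lemma adj_sum: "(\<And>i. i \<in> I \<Longrightarrow> f i \<in> adj \<iota> A) \<Longrightarrow> sum f I \<in> adj \<iota> A"
  by (induction I rule: infinite_finite_induct) (auto intro: adj_add)

lemma adj_prod: "(\<And>i. i \<in> I \<Longrightarrow> f i \<in> adj \<iota> A) \<Longrightarrow> prod f I \<in> adj \<iota> A"
  by (induction I rule: infinite_finite_induct) (auto intro: adj_mult)

lemma adj_power: "x \<in> adj \<iota> A \<Longrightarrow> x ^ k \<in> adj \<iota> A"
  by (induction k) (auto intro: adj_mult)

lemma mpoly_eval_in_adj: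
  assumes "P \<in> polys_in V" "\<And>v. v \<in> V \<Longrightarrow> g v \<in> adj \<iota> A"
  shows "mpoly_eval \<iota> g P \<in> adj \<iota> A"
  unfolding mpoly_eval_monom_val monom_val_def
  using assms by (intro adj_sum adj_mult adj_scal adj_prod adj_power) (auto simp: polys_in_def)

lemma adj_iff: "x \<in> adj \<iota> A \<longleftrightarrow> (\<exists>P\<in>polys_in A. x = mpoly_eval \<iota> (\<lambda>a. a) P)"
proof
  assume "x \<in> adj \<iota> A"
  then show "\<exists>P\<in>polys_in A. x = mpoly_eval \<iota> (\<lambda>a. a) P"
  proof induction
    case (adj_scal c)
    show ?case by (rule bexI[OF _ polys_in_mconst[of c]]) simp
  next
    case (adj_gen a)
    then show ?case by (intro bexI[OF _ polys_in_mvar[of a]]) simp_all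
  next
    case (adj_add x y)
    then show ?case by (metis polys_in_add mpoly_eval_add)
  next
    case (adj_mult x y)
    then show ?case by (metis polys_in_mult mpoly_eval_mult)
  qed
next
  assume "\<exists>P\<in>polys_in A. x = mpoly_eval \<iota> (\<lambda>a. a) P"
  then show "x \<in> adj \<iota> A" by (auto intro: mpoly_eval_in_adj adj_gen)
qed

end

text \<open>The coefficient set is a parameter so that one notion serves three purposes: linear
  spans over the base ring (\<open>range \<iota>\<close>), modules over a subalgebra, and ideals
  (\<open>UNIV\<close>).\<close>

inductive_set mspan :: "'a::comm_ring_1 set \<Rightarrow> 'a set \<Rightarrow> 'a set" for A W where
  mspan_0: "0 \<in> mspan A W"
| mspan_step: "a \<in> A \<Longrightarrow> w \<in> W \<Longrightarrow> s \<in> mspan A W \<Longrightarrow> a * w + s \<in> mspan A W"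

lemma mspan_single: "a \<in> A \<Longrightarrow> w \<in> W \<Longrightarrow> a * w \<in> mspan A W"
  using mspan_step[OF _ _ mspan_0, of a A w W] by simp

lemma mspan_add: "s \<in> mspan A W \<Longrightarrow> t \<in> mspan A W \<Longrightarrow> s + t \<in> mspan A W"
  by (induction rule: mspan.induct) (auto simp: add.assoc intro: mspan.intros)

lemma mspan_sum: "(\<And>i. i \<in> I \<Longrightarrow> f i \<in> mspan A W) \<Longrightarrow> sum f I \<in> mspan A W"
  by (induction I rule: infinite_finite_induct) (auto intro: mspan_0 mspan_add)

lemma mspan_mono: "A \<subseteq> B \<Longrightarrow> V \<subseteq> W \<Longrightarrow> mspan A V \<subseteq> mspan B W"
proof
  fix x assume "A \<subseteq> B" "V \<subseteq> W" "x \<in> mspan A V"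
  from this(3,1,2) show "x \<in> mspan B W"
    by (induction rule: mspan.induct) (auto intro: mspan.intros)
qed

text \<open>Multiplication by \<open>y\<close> is additive, so it suffices to look at generators;
  coefficients and generators of the target span may differ from those of the source.\<close>

lemma mspan_bilinear:
  assumes "s \<in> mspan A W" "\<And>a w. a \<in> A \<Longrightarrow> w \<in> W \<Longrightarrow> y * (a * w) \<in> mspan B V"
  shows "y * s \<in> mspan B V"
  using assms(1) by induction (auto simp: distrib_left intro: mspan_0 mspan_add assms(2))

lemma mspan_coeffs:
  assumes "s \<in> mspan A W" "finite W" "0 \<in> A" "\<And>x y. x \<in> A \<Longrightarrow> y \<in> A \<Longrightarrow> x + y \<in> A"
  shows "\<exists>c. (\<forall>w. c w \<in> A) \<and> s = (\<Sum>w\<in>W. c w * w)"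
  using assms(1)
proof induction
  case mspan_0
  show ?case by (rule exI[of _ "\<lambda>_. 0"]) (simp add: assms(3))
next
  case (mspan_step a w s)
  then obtain c where "\<forall>w. c w \<in> A" "s = (\<Sum>w\<in>W. c w * w)" by blast
  then have "a * w + s = (\<Sum>v\<in>W. c v * v + (if v = w then a * w else 0))"
    using mspan_step assms(2) by (simp add: sum.distrib)
  also have "\<dots> = (\<Sum>v\<in>W. (c(w := c w + a)) v * v)"
    by (intro sum.cong) (auto simp: algebra_simps)
  finally show ?case
    using \<open>\<forall>w. c w \<in> A\<close> mspan_step assms(4) by (intro exI[of _ "c(w := c w + a)"]) auto
qed

section \<open>Transcendence degree by counting\<close>

text \<open>Gaussian elimination without division: a pivot removes one unknown and one equation, and
  the remaining coefficients are 2x2 minors. Hence a domain is enough, in particular the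
  integers.\<close>

lemma ex_nontrivial_solution:
  fixes c :: "'i \<Rightarrow> 'j \<Rightarrow> 'f::idom"
  assumes "finite B" "finite A" "card B < card A"
  shows "\<exists>u. (\<exists>a\<in>A. u a \<noteq> 0) \<and> (\<forall>b\<in>B. (\<Sum>a\<in>A. u a * c a b) = 0)"
  using assms
proof (induction B arbitrary: A c rule: finite_induct)
  case empty
  then obtain a where "a \<in> A" by fastforce
  then show ?case by (intro exI[of _ "\<lambda>_. 1"]) auto
next
  case (insert b B)
  show ?case
  proof (cases "\<forall>a\<in>A. c a b = 0")
    case True
    from insert obtain u where "\<exists>a\<in>A. u a \<noteq> 0" "\<forall>b\<in>B. (\<Sum>a\<in>A. u a * c a b) = 0"
      using insert.IH[of A c] by force
    with True show ?thesis by (intro exI[of _ u]) simp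
  next
    case False
    then obtain a0 where a0: "a0 \<in> A" "c a0 b \<noteq> 0" by blast
    define A' where "A' = A - {a0}"
    have fA': "finite A'" and A: "A = insert a0 A'" "a0 \<notin> A'"
      using insert.prems a0 by (auto simp: A'_def)
    then have "card B < card A'" using insert by simp
    from insert.IH[OF fA' this, of "\<lambda>a b'. c a0 b * c a b' - c a b * c a0 b'"]
    obtain u where u: "\<exists>a\<in>A'. u a \<noteq> 0"
      "\<forall>b'\<in>B. (\<Sum>a\<in>A'. u a * (c a0 b * c a b' - c a b * c a0 b')) = 0" by blast
    \<comment> \<open>The old unknowns are scaled by the pivot \<open>c a0 b\<close>, and the value
      at \<open>a0\<close> is then forced by equation \<open>b\<close>. A nonzero \<open>u a\<close>
      stays nonzero because the pivot is nonzero.\<close>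
    define v where "v a = (if a = a0 then - (\<Sum>a\<in>A'. u a * c a b) else c a0 b * u a)" for a
    have sv: "(\<Sum>a\<in>A. v a * c a b') = (\<Sum>a\<in>A'. u a * (c a0 b * c a b' - c a b * c a0 b'))" for b'
    proof -
      have "(\<Sum>a\<in>A'. v a * c a b') = (\<Sum>a\<in>A'. c a0 b * u a * c a b')"
        using A(2) by (intro sum.cong) (auto simp: v_def)
      then have "(\<Sum>a\<in>A. v a * c a b') = v a0 * c a0 b' + (\<Sum>a\<in>A'. c a0 b * u a * c a b')"
        unfolding A(1) using fA' A(2) by simp
      then show ?thesis
        by (simp add: v_def sum_distrib_left sum_subtractf right_diff_distrib ac_simps)
    qed
    have "(\<Sum>a\<in>A'. u a * (c a0 b * c a b - c a b * c a0 b)) = 0" by (simp add: mult.commute)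
    with u(2) have "\<forall>b'\<in>insert b B. (\<Sum>a\<in>A. v a * c a b') = 0" unfolding sv by auto
    moreover have "\<exists>a\<in>A. v a \<noteq> 0" using u(1) A a0 by (auto simp: v_def)
    ultimately show ?thesis by blast
  qed
qed

text \<open>Monomials are grouped by their exponent of \<open>v\<close>. This turns a relation among
  several elements into a univariate equation for one of them over the others.\<close>

lemma mpoly_split_var:
  fixes P :: "('v, 'f::comm_ring_1) mpoly"
  assumes "P \<in> polys_in (insert v A)"
  obtains c N where "\<And>i. c i \<in> polys_in A" "\<And>i. i > N \<Longrightarrow> c i = 0" "P = (\<Sum>i\<le>N. c i * mvar v ^ i)"
proof -
  let ?K = "keys P"
  define r where "r m = m - single v (lookup m v)" for m :: "'v \<Rightarrow>\<^sub>0 nat"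
  define c where "c i = (\<Sum>m\<in>?K. if lookup m v = i
    then single (r m) (lookup P m) else 0)" for i
  define N where "N = Max (insert 0 ((\<lambda>m. lookup m v) ` ?K))"
  have N: "lookup m v \<le> N" if "m \<in> ?K" for m
    unfolding N_def using that by (intro Max_ge) auto
  have rm: "r m + single v (lookup m v) = m" for m
    by (rule poly_mapping_eqI) (auto simp: r_def lookup_add lookup_minus lookup_single when_def)
  have rk: "keys (r m) \<subseteq> keys m - {v}" for m
    by (auto simp: r_def in_keys_iff lookup_minus lookup_single when_def split: if_splits)
  show ?thesis
  proof
    show "c i \<in> polys_in A" for i
      unfolding c_def
    proof (rule polys_in_sum)
      fix m assume "m \<in> ?K"
      then have "keys m \<subseteq> insert v A" using assms by (auto simp: polys_in_def)
      with rk[of m] show "(if lookup m v = i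
          then single (r m) (lookup P m) else 0) \<in> polys_in A"
        by (auto intro!: polys_in_single)
    qed
    show "c i = 0" if "i > N" for i
      unfolding c_def using N that by (intro sum.neutral) force
    have "(\<Sum>i\<le>N. c i * mvar v ^ i) = (\<Sum>m\<in>?K. \<Sum>i\<le>N. if lookup m v = i
        then single (r m) (lookup P m) * mvar v ^ i else 0)"
      unfolding c_def sum_distrib_right
      by (subst sum.swap) (auto intro!: sum.cong)
    also have "\<dots> = (\<Sum>m\<in>?K. single m (lookup P m))"
      using N by (intro sum.cong refl) (simp add: mvar_power mult_single rm)
    finally show "P = (\<Sum>i\<le>N. c i * mvar v ^ i)" using mpoly_eq_sum_single[of P] by simp
  qed
qed

text \<open>A bound on each exponent instead of the total degree makes the number of monomials a
  pure power, while boxes still add under multiplication.\<close>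

definition exponent_box :: "'v set \<Rightarrow> nat \<Rightarrow> ('v \<Rightarrow>\<^sub>0 nat) set" where
  "exponent_box U D = {m. keys m \<subseteq> U \<and> (\<forall>x. lookup m x \<le> D)}"

lemma bij_betw_exponent_box:
  assumes "finite U"
  shows "bij_betw (\<lambda>m. restrict (lookup m) U) (exponent_box U D) (PiE U (\<lambda>_. {..D}))"
  unfolding bij_betw_def
proof
  show "inj_on (\<lambda>m. restrict (lookup m) U) (exponent_box U D)"
  proof (rule inj_onI, rule poly_mapping_eqI)
    fix m m' k
    assume *: "m \<in> exponent_box U D" "m' \<in> exponent_box U D"
      "restrict (lookup m) U = restrict (lookup m') U"
    show "lookup m k = lookup m' k"
    proof (cases "k \<in> U")
      case True
      then show ?thesis using fun_cong[OF *(3), of k] by simp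
    next
      case False
      with *(1,2) have "k \<notin> keys m" "k \<notin> keys m'"
        by (auto simp: exponent_box_def)
      then show ?thesis by (simp add: in_keys_iff)
    qed
  qed
  show "(\<lambda>m. restrict (lookup m) U) ` exponent_box U D = PiE U (\<lambda>_. {..D})" (is "?L = ?R")
  proof
    show "?L \<subseteq> ?R" by (auto simp: exponent_box_def)
    show "?R \<subseteq> ?L"
    proof
      fix f assume f: "f \<in> ?R"
      define m where "m = (\<Sum>x\<in>U. single x (f x))"
      have m: "lookup m x = (if x \<in> U then f x else 0)" for x
        using assms by (simp add: m_def lookup_sum lookup_single when_def)
      have "m \<in> exponent_box U D"
        using f by (auto simp: exponent_box_def in_keys_iff m PiE_def split: if_splits)
      moreover have "f = restrict (lookup m) U"
        using f by (intro ext) (auto simp: m PiE_def extensional_def)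
      ultimately show "f \<in> ?L" by blast
    qed
  qed
qed

lemma finite_exponent_box:
  assumes "finite U"
  shows "finite (exponent_box U D)"
  using bij_betw_finite[OF bij_betw_exponent_box[OF assms, of D]] assms by (simp add: finite_PiE)

lemma card_exponent_box:
  assumes "finite U"
  shows "card (exponent_box U D) = Suc D ^ card U"
  using bij_betw_same_card[OF bij_betw_exponent_box[OF assms, of D]] assms by (simp add: card_PiE)

lemma exponent_box_add:
  "m \<in> exponent_box U D \<Longrightarrow> m' \<in> exponent_box U D' \<Longrightarrow> m + m' \<in> exponent_box U (D + D')"
  using Poly_Mapping.keys_add[of m m'] by (auto simp: exponent_box_def lookup_add intro: add_mono)

text \<open>Domains on both sides, so that the base ring can be the integers as well as a
  field.\<close>

locale inj_idom_hom = comm_ring_1_hom \<iota> for \<iota> :: "'f::idom \<Rightarrow> 'a::idom" +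
  assumes inj_hom: "\<iota> x = 0 \<Longrightarrow> x = 0"
begin

lemma ex_linear_dependence:
  assumes "finite T" "finite I" "card T < card I" "\<And>i. i \<in> I \<Longrightarrow> v i \<in> mspan (range \<iota>) T"
  shows "\<exists>u. (\<exists>i\<in>I. u i \<noteq> 0) \<and> (\<Sum>i\<in>I. \<iota> (u i) * v i) = 0"
proof -
  have "\<exists>c. v i = (\<Sum>t\<in>T. \<iota> (c t) * t)" if "i \<in> I" for i
  proof -
    have "\<exists>c. (\<forall>t. c t \<in> range \<iota>) \<and> v i = (\<Sum>t\<in>T. c t * t)"
    proof (rule mspan_coeffs[OF assms(4)[OF that] assms(1)])
      show "0 \<in> range \<iota>" using rangeI[of \<iota> 0] by simp
      show "x + y \<in> range \<iota>" if "x \<in> range \<iota>" "y \<in> range \<iota>" for x y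
        using that by (auto simp flip: hom_add)
    qed
    then obtain c where c: "\<forall>t. c t \<in> range \<iota>" "v i = (\<Sum>t\<in>T. c t * t)" by blast
    from c(1) have "\<forall>t. \<exists>x. c t = \<iota> x" by blast
    from choice[OF this] obtain c' where "\<And>t. c t = \<iota> (c' t)" by blast
    with c(2) show ?thesis by auto
  qed
  then have "\<forall>i\<in>I. \<exists>c. v i = (\<Sum>t\<in>T. \<iota> (c t) * t)" ..
  from bchoice[OF this] obtain c where c: "\<And>i. i \<in> I \<Longrightarrow> v i = (\<Sum>t\<in>T. \<iota> (c i t) * t)" by blast
  obtain u where u: "\<exists>i\<in>I. u i \<noteq> 0" "\<forall>t\<in>T. (\<Sum>i\<in>I. u i * c i t) = 0"
    using ex_nontrivial_solution[OF assms(1-3)] by blast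
  have "(\<Sum>i\<in>I. \<iota> (u i) * v i) = (\<Sum>i\<in>I. \<Sum>t\<in>T. \<iota> (u i * c i t) * t)"
    by (intro sum.cong refl) (simp add: c sum_distrib_left hom_mult mult.assoc)
  also have "\<dots> = (\<Sum>t\<in>T. \<iota> (\<Sum>i\<in>I. u i * c i t) * t)"
    by (subst sum.swap) (simp add: hom_sum sum_distrib_right)
  also have "\<dots> = 0" using u(2) by simp
  finally show ?thesis using u(1) by blast
qed

text \<open>The monomials of degree at most \<open>L\<close> in each element of \<open>Z\<close> number
  \<open>(L + 1) ^ card Z\<close>, but after multiplication by a power of \<open>g\<close> they all lie in
  a space of dimension \<open>O(L ^ card U)\<close>.\<close>

lemma card_le_of_localized_finite:
  assumes "finite U" "finite Z" and indep: "algebraically_independent \<iota> Z"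
    and Z: "Z \<subseteq> adj \<iota> Y"
    and W: "finite W" "1 \<in> W" and g: "g \<in> adj \<iota> U" "g \<noteq> 0"
    and gY: "\<And>y w. y \<in> Y \<Longrightarrow> w \<in> W \<Longrightarrow> g * y * w \<in> mspan (adj \<iota> U) W"
  shows "card Z \<le> card U"
proof (rule ccontr)
  assume less: "\<not> card Z \<le> card U"
  define mon where "mon = monom_val (\<lambda>x::'a. x)"
  \<comment> \<open>\<open>sp D\<close> is a filtration by monomials of bounded exponents in
    \<open>U\<close> times the finite set \<open>W\<close>; \<open>bd y D\<close> says that
    multiplication by \<open>y\<close> raises the filtration degree by at most
    \<open>D\<close>.\<close>
  define T where "T D = (\<lambda>(m, w). mon m * w) ` (exponent_box U D \<times> W)" for D
  define sp where "sp D = mspan (range \<iota>) (T D)" for D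
  define bd where "bd y D \<longleftrightarrow> (\<forall>D'. \<forall>s\<in>sp D'. y * s \<in> sp (D' + D))" for y D
  have finT: "finite (T D)" for D
    by (simp add: T_def finite_exponent_box assms)
  have cardT: "card (T D) \<le> Suc D ^ card U * card W" for D
  proof -
    have "card (T D) \<le> card (exponent_box U D \<times> W)"
      unfolding T_def by (rule card_image_le) (simp add: finite_exponent_box assms)
    then show ?thesis by (simp add: card_cartesian_product card_exponent_box assms)
  qed
  have Tmono: "T D \<subseteq> T D'" if "D \<le> D'" for D D'
  proof -
    have "exponent_box U D \<subseteq> exponent_box U D'"
      using that by (auto simp: exponent_box_def intro: order_trans)
    then show ?thesis unfolding T_def by (intro image_mono Sigma_mono) auto
  qed
  have spmono: "sp D \<subseteq> sp D'" if "D \<le> D'" for D D'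
    unfolding sp_def using Tmono[OF that] by (intro mspan_mono) auto
  have sp_add: "s + t \<in> sp D" if "s \<in> sp D" "t \<in> sp D" for s t D
    using that unfolding sp_def by (rule mspan_add)
  have sp_T: "t \<in> sp D" if "t \<in> T D" for t D
    using mspan_single[of 1 "range \<iota>" t "T D"] that hom_1 unfolding sp_def by (metis mult_1 rangeI)
  have bdI: "bd y D" if "\<And>D' t. t \<in> T D' \<Longrightarrow> y * t \<in> sp (D' + D)" for y D
    unfolding bd_def
  proof (intro allI ballI)
    fix D' s assume "s \<in> sp D'"
    then show "y * s \<in> sp (D' + D)"
      unfolding sp_def
    proof (rule mspan_bilinear)
      fix a t assume "a \<in> range \<iota>" "t \<in> T D'"
      from this(1) obtain c where c: "a = \<iota> c" by blast
      from that[OF \<open>t \<in> T D'\<close>] have "\<iota> c * (y * t) \<in> mspan (range \<iota>) (T (D' + D))"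
        unfolding sp_def
        by (rule mspan_bilinear) (auto simp: mult.assoc[symmetric] simp flip: hom_mult intro: mspan_single)
      then show "y * (a * t) \<in> mspan (range \<iota>) (T (D' + D))" by (simp add: c ac_simps)
    qed
  qed
  have bd_mono: "bd y D'" if "bd y D" "D \<le> D'" for y D D'
    unfolding bd_def
  proof (intro allI ballI)
    fix E s assume "s \<in> sp E"
    with that(1) have "y * s \<in> sp (E + D)" by (simp add: bd_def)
    then show "y * s \<in> sp (E + D')" using spmono[of "E + D" "E + D'"] that(2) by auto
  qed
  have bd_add: "bd (y + y') D" if "bd y D" "bd y' D" for y y' D
    using that by (auto simp: bd_def distrib_right intro: sp_add)
  have bd_mult: "bd (y * y') (D + D')" if "bd y D" "bd y' D'" for y y' D D'
    unfolding bd_def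
  proof (intro allI ballI)
    fix E s assume "s \<in> sp E"
    with that(2) have "y' * s \<in> sp (E + D')" by (simp add: bd_def)
    with that(1) have "y * (y' * s) \<in> sp (E + D' + D)" by (simp add: bd_def)
    then show "y * y' * s \<in> sp (E + (D + D'))" by (simp add: ac_simps)
  qed
  have bd_scal: "bd (\<iota> c) 0" for c
  proof (rule bdI)
    fix D' t assume "t \<in> T D'"
    then show "\<iota> c * t \<in> sp (D' + 0)" unfolding sp_def by (auto intro: mspan_single)
  qed
  have bd_X: "bd x 1" if "x \<in> U" for x
  proof (rule bdI)
    fix D' t assume "t \<in> T D'"
    then obtain m w where m: "m \<in> exponent_box U D'" "w \<in> W" "t = mon m * w" by (auto simp: T_def)
    have "single x 1 \<in> exponent_box U 1"
      using that by (auto simp: exponent_box_def lookup_single when_def)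
    from exponent_box_add[OF m(1) this] m(2)
    have "mon (m + single x 1) * w \<in> T (D' + 1)" by (auto simp: T_def)
    then show "x * t \<in> sp (D' + 1)"
      by (intro sp_T) (simp add: m(3) mon_def monom_val_add ac_simps)
  qed
  have bd_adj: "\<exists>D. bd a D" if "a \<in> adj \<iota> U" for a
    using that
  proof induction
    case (adj_add x y)
    then obtain D D' where "bd x D" "bd y D'" by blast
    then have "bd (x + y) (max D D')"
      by (intro bd_add bd_mono[OF _ max.cobounded1] bd_mono[OF _ max.cobounded2])
    then show ?case ..
  qed (blast intro: bd_scal bd_X bd_mult)+
  have bd_W: "\<exists>D. \<forall>D'. \<forall>m\<in>exponent_box U D'. s * mon m \<in> sp (D' + D)" if "s \<in> mspan (adj \<iota> U) W" for s
    using that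
  proof induction
    case mspan_0
    show ?case using mspan.mspan_0[of "range \<iota>"] by (auto simp: sp_def)
  next
    case (mspan_step a w s)
    then obtain D D1 where D: "bd a D" "\<forall>D'. \<forall>m\<in>exponent_box U D'. s * mon m \<in> sp (D' + D1)"
      using bd_adj by blast
    have "(a * w + s) * mon m \<in> sp (D' + max D D1)" if m: "m \<in> exponent_box U D'" for D' m
    proof -
      have "mon m * w \<in> sp D'" using m mspan_step by (intro sp_T) (auto simp: T_def)
      then have "a * (mon m * w) \<in> sp (D' + D)" using D(1) by (simp add: bd_def)
      then have "a * (mon m * w) \<in> sp (D' + max D D1)" using spmono[of "D' + D" "D' + max D D1"] by auto
      moreover have "s * mon m \<in> sp (D' + max D D1)"
        using D(2) m spmono[of "D' + D1" "D' + max D D1"] by auto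
      ultimately show ?thesis using sp_add by (fastforce simp: algebra_simps)
    qed
    then show ?case by blast
  qed
  have bd_Y: "\<exists>D. bd (g * y) D" if y: "y \<in> Y" for y
  proof -
    have "\<forall>w\<in>W. \<exists>D. \<forall>D'. \<forall>m\<in>exponent_box U D'. g * y * w * mon m \<in> sp (D' + D)"
      using bd_W gY[OF y] by blast
    then obtain D where D: "\<And>w D' m. w \<in> W \<Longrightarrow> m \<in> exponent_box U D' \<Longrightarrow> g * y * w * mon m \<in> sp (D' + D w)"
      by metis
    have "bd (g * y) (Max (D ` W))"
    proof (rule bdI)
      fix D' t assume "t \<in> T D'"
      then obtain m w where m: "m \<in> exponent_box U D'" "w \<in> W" "t = mon m * w" by (auto simp: T_def)
      have "D w \<le> Max (D ` W)" using W m by simp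
      then show "g * y * t \<in> sp (D' + Max (D ` W))"
        using D[OF m(2,1)] spmono[of "D' + D w" "D' + Max (D ` W)"] by (auto simp: m(3) ac_simps)
    qed
    then show ?thesis ..
  qed
  have bd_pow: "\<exists>D. bd (g ^ n) D" for n
    using bd_adj adj_power[OF g(1)] by blast
  \<comment> \<open>Every factor from \<open>Y\<close> costs one factor \<open>g\<close>, so an
    element of the generated algebra becomes bounded after multiplication by a suitable power of
    \<open>g\<close>. In a sum both terms are brought to the same power.\<close>
  have bd_adjY: "\<exists>n D. bd (g ^ n * z) D" if "z \<in> adj \<iota> Y" for z
    using that
  proof induction
    case (adj_scal c)
    show ?case using bd_scal[of c] by (intro exI[of _ 0]) auto
  next
    case (adj_gen a)
    then obtain D where "bd (g ^ 1 * a) D" using bd_Y[of a] by auto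
    then show ?case by blast
  next
    case (adj_add x y)
    then obtain n D n' D' where *: "bd (g ^ n * x) D" "bd (g ^ n' * y) D'" by blast
    obtain E E' where "bd (g ^ n) E" "bd (g ^ n') E'" using bd_pow by meson
    from bd_mult[OF this(2) *(1)] bd_mult[OF this(1) *(2)]
    have "bd (g ^ n' * (g ^ n * x)) (max (E' + D) (E + D'))" "bd (g ^ n * (g ^ n' * y)) (max (E' + D) (E + D'))"
      by (simp_all only: bd_mono[OF _ max.cobounded1] bd_mono[OF _ max.cobounded2])
    from bd_add[OF this] have "bd (g ^ (n + n') * (x + y)) (max (E' + D) (E + D'))"
      by (simp add: power_add algebra_simps)
    then show ?case by blast
  next
    case (adj_mult x y)
    then obtain n D n' D' where *: "bd (g ^ n * x) D" "bd (g ^ n' * y) D'" by blast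
    from bd_mult[OF this] have "bd (g ^ (n + n') * (x * y)) (D + D')"
      by (simp add: power_add algebra_simps)
    then show ?case by blast
  qed
  have "\<exists>n D. \<forall>z\<in>S. bd (g ^ n * z) D" if "finite S" "S \<subseteq> Z" for S
    using that
  proof (induction S rule: finite_induct)
    case (insert z S)
    then obtain n D n' D' where *: "\<forall>z\<in>S. bd (g ^ n * z) D" "bd (g ^ n' * z) D'"
      using bd_adjY[of z] Z by blast
    obtain E E' where "bd (g ^ n) E" "bd (g ^ n') E'" using bd_pow by meson
    then have "bd (g ^ n' * (g ^ n * z')) (E' + D)" if "z' \<in> S" for z'
      using * that bd_mult by blast
    then have "bd (g ^ (n + n') * z') (E' + D)" if "z' \<in> S" for z'
      using that by (simp add: power_add ac_simps)
    then have "bd (g ^ (n + n') * z') (max (E' + D) (E + D'))" if "z' \<in> S" for z'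
      using that bd_mono max.cobounded1 by blast
    moreover have "bd (g ^ (n + n') * z) (E + D')"
      using bd_mult[OF \<open>bd (g ^ n) E\<close> *(2)] by (simp add: power_add ac_simps)
    then have "bd (g ^ (n + n') * z) (max (E' + D) (E + D'))" using bd_mono max.cobounded2 by blast
    ultimately show ?case by blast
  qed simp
  from this[OF assms(2) order_refl] obtain n D1 where D1: "\<And>z. z \<in> Z \<Longrightarrow> bd (g ^ n * z) D1" by blast
  obtain D2 where D2: "bd (g ^ n) D2" using bd_pow by blast
  define D where "D = max D1 D2"
  have Dz: "bd (g ^ n * z) D" if "z \<in> Z" for z using D1[OF that] bd_mono by (simp add: D_def)
  have D0: "bd (g ^ n) D" using D2 bd_mono by (simp add: D_def)
  have bd_1: "bd 1 0" using bd_scal[of 1] by simp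
  have bd_power: "bd (y ^ k) (k * E)" if "bd y E" for y k E
    using that by (induction k) (auto simp: bd_1 intro: bd_mult)
  have bd_prod: "bd (\<Prod>z\<in>S. f z) (card S * E)" if "finite S" "\<And>z. z \<in> S \<Longrightarrow> bd (f z) E" for S f E
    using that by (induction S rule: finite_induct) (auto simp: bd_1 intro: bd_mult)
  define k where "k = card Z"
  \<comment> \<open>Each factor \<open>z ^ l\<close> is padded with
    \<open>(g ^ n) ^ (L - l)\<close>. Thus all monomials in the box carry the same power of
    \<open>g\<close>, which can be cancelled from a linear relation between them.\<close>
  have bd_mon: "bd (g ^ (n * L * k) * mon m) (k * (L * D))" if m: "m \<in> exponent_box Z L" for m L
  proof -
    let ?l = "lookup m"
    have l: "?l z \<le> L" for z using m by (auto simp: exponent_box_def)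
    have "bd ((g ^ n * z) ^ ?l z * (g ^ n) ^ (L - ?l z)) (L * D)" if "z \<in> Z" for z
      using bd_mult[OF bd_power[OF Dz[OF that], of "?l z"] bd_power[OF D0, of "L - ?l z"]] l[of z]
      by (simp flip: distrib_right)
    from bd_prod[OF assms(2) this]
    have "bd (\<Prod>z\<in>Z. (g ^ n * z) ^ ?l z * (g ^ n) ^ (L - ?l z)) (k * (L * D))" by (simp add: k_def)
    also have "(\<Prod>z\<in>Z. (g ^ n * z) ^ ?l z * (g ^ n) ^ (L - ?l z)) = (\<Prod>z\<in>Z. g ^ (n * L) * z ^ ?l z)"
    proof (intro prod.cong refl)
      fix z
      have "g ^ (n * L) = (g ^ n) ^ (?l z + (L - ?l z))" using l[of z] by (simp add: power_mult)
      then show "(g ^ n * z) ^ ?l z * (g ^ n) ^ (L - ?l z) = g ^ (n * L) * z ^ ?l z"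
        by (simp only: power_add power_mult_distrib ac_simps)
    qed
    also have "\<dots> = g ^ (n * L * k) * (\<Prod>z\<in>Z. z ^ ?l z)"
      by (simp add: prod.distrib k_def power_mult)
    also have "(\<Prod>z\<in>Z. z ^ ?l z) = mon m"
      using m assms(2) by (simp add: mon_def monom_val_superset exponent_box_def)
    finally show ?thesis .
  qed
  \<comment> \<open>With \<open>u = card U\<close>, the spanning set has at most
    \<open>(k L D + 1)^u card W \<le> e (L + 1)^u\<close> elements. This is less than
    \<open>(L + 1)^(u + 1)\<close> as soon as \<open>L \<ge> e\<close>, while there are
    \<open>(L + 1)^(card Z)\<close> monomials.\<close>
  define e where "e = (k * D + 1) ^ card U * card W"
  define L where "L = e"
  have "card (T (k * (L * D))) \<le> Suc (k * (L * D)) ^ card U * card W" by (rule cardT)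
  also have "\<dots> \<le> ((k * D + 1) * Suc L) ^ card U * card W"
    by (intro mult_right_mono power_mono) auto
  also have "\<dots> = e * Suc L ^ card U" by (simp only: e_def power_mult_distrib ac_simps)
  also have "\<dots> < Suc L * Suc L ^ card U" unfolding L_def by (intro mult_strict_right_mono) auto
  also have "\<dots> \<le> Suc L ^ card Z" unfolding power_Suc[symmetric] using less by (intro power_increasing) auto
  also have "\<dots> = card (exponent_box Z L)" by (simp add: card_exponent_box assms)
  finally have c: "card (T (k * (L * D))) < card (exponent_box Z L)" .
  \<comment> \<open>Applying the bounded multiplications to \<open>1\<close> turns statements about
    operators into statements about elements.\<close>
  have one: "1 \<in> sp 0"
  proof (rule sp_T)
    have "(0, 1) \<in> exponent_box U 0 \<times> W" using W by (simp add: exponent_box_def)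
    then have "mon 0 * 1 \<in> T 0" unfolding T_def by force
    then show "1 \<in> T 0" by (simp add: mon_def)
  qed
  have "\<exists>u. (\<exists>m\<in>exponent_box Z L. u m \<noteq> 0) \<and>
      (\<Sum>m\<in>exponent_box Z L. \<iota> (u m) * (g ^ (n * L * k) * mon m)) = 0"
  proof (rule ex_linear_dependence[OF finT _ c])
    show "finite (exponent_box Z L)" by (simp add: finite_exponent_box assms)
    fix m assume "m \<in> exponent_box Z L"
    from bd_mon[OF this] one have "g ^ (n * L * k) * mon m * 1 \<in> sp (0 + k * (L * D))"
      unfolding bd_def by blast
    then show "g ^ (n * L * k) * mon m \<in> mspan (range \<iota>) (T (k * (L * D)))" by (simp add: sp_def)
  qed
  then obtain u where u: "\<exists>m\<in>exponent_box Z L. u m \<noteq> 0"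
    "(\<Sum>m\<in>exponent_box Z L. \<iota> (u m) * (g ^ (n * L * k) * mon m)) = 0" by blast
  define P where "P = (\<Sum>m\<in>exponent_box Z L. single m (u m))"
  have "g ^ (n * L * k) * (\<Sum>m\<in>exponent_box Z L. \<iota> (u m) * mon m) = 0"
    using u(2) by (simp add: sum_distrib_left ac_simps)
  with g(2) have "(\<Sum>m\<in>exponent_box Z L. \<iota> (u m) * mon m) = 0" by simp
  then have "mpoly_eval \<iota> (\<lambda>a. a) P = 0"
    unfolding P_def comm_ring_1_hom.hom_sum[OF mpoly_eval_hom] by (simp add: mpoly_eval_single mon_def)
  moreover have "P \<in> polys_in Z"
    unfolding P_def by (intro polys_in_sum polys_in_single) (auto simp: exponent_box_def)
  ultimately have "P = 0" using indep by (auto simp: algebraically_independent_iff)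
  obtain m where m: "m \<in> exponent_box Z L" "u m \<noteq> 0" using u(1) by blast
  then have "lookup P m = u m"
    by (simp add: P_def lookup_sum lookup_single when_def finite_exponent_box assms)
  with m \<open>P = 0\<close> show False by simp
qed

text \<open>The leading coefficient in \<open>y\<close> of a relation is a nonzero polynomial in
  \<open>U\<close>, and its value is nonzero because \<open>U\<close> is independent.\<close>

lemma ex_algebraic_relation:
  assumes U: "algebraically_independent \<iota> U" and dep: "\<not> algebraically_independent \<iota> (insert y U)"
  obtains c n where "\<And>i. c i \<in> adj \<iota> U" "c n \<noteq> 0" "(\<Sum>i\<le>n. c i * y ^ i) = 0"
proof -
  from dep obtain P where P: "P \<in> polys_in (insert y U)" "mpoly_eval \<iota> (\<lambda>a. a) P = 0" "P \<noteq> 0"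
    by (auto simp: algebraically_independent_iff)
  obtain c N where c: "\<And>i. c i \<in> polys_in U" "\<And>i. i > N \<Longrightarrow> c i = 0" "P = (\<Sum>i\<le>N. c i * mvar y ^ i)"
    using mpoly_split_var[OF P(1)] by blast
  from P(3) c(3) obtain i0 where "c i0 \<noteq> 0" by fastforce
  define n where "n = Max {i. c i \<noteq> 0}"
  have fin: "finite {i. c i \<noteq> 0}" using c(2) by (metis (mono_tags, lifting) finite_nat_set_iff_bounded_le mem_Collect_eq not_le)
  have n: "c n \<noteq> 0" using Max_in[OF fin] \<open>c i0 \<noteq> 0\<close> by (auto simp: n_def)
  have "n \<le> N" using n c(2) by (meson not_le)
  have z: "c i = 0" if "i > n" for i using Max_ge[OF fin, of i] that by (auto simp: n_def)
  interpret e: comm_ring_1_hom "mpoly_eval \<iota> (\<lambda>a. a)" by (rule mpoly_eval_hom)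
  let ?c = "\<lambda>i. mpoly_eval \<iota> (\<lambda>a. a) (c i)"
  have "P = (\<Sum>i\<le>n. c i * mvar y ^ i)"
    unfolding c(3) using \<open>n \<le> N\<close> z by (intro sum.mono_neutral_right) auto
  with P(2) have "(\<Sum>i\<le>n. ?c i * y ^ i) = 0" by (simp add: e.hom_sum e.hom_mult e.hom_power)
  moreover have "?c i \<in> adj \<iota> U" for i by (rule mpoly_eval_in_adj[OF c(1)]) (rule adj_gen)
  moreover have "?c n \<noteq> 0" using U n c(1) by (auto simp: algebraically_independent_iff)
  ultimately show ?thesis using that[of ?c n] by simp
qed

text \<open>After inverting the leading coefficients of finitely many algebraic equations, the
  elements become integral; \<open>g\<close> is the product of these coefficients. The products of
  generators with \<open>y ^ j\<close> for \<open>j < n\<close> then span.\<close>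

lemma ex_localized_finite:
  assumes "finite Y"
    and alg: "\<And>y. y \<in> Y \<Longrightarrow> \<exists>c n. (\<forall>i. c i \<in> adj \<iota> U) \<and> c n \<noteq> 0 \<and> (\<Sum>i\<le>n. c i * y ^ i) = 0"
  shows "\<exists>W g. finite W \<and> 1 \<in> W \<and> g \<in> adj \<iota> U \<and> g \<noteq> 0 \<and>
    (\<forall>y\<in>Y. \<forall>w\<in>W. g * y * w \<in> mspan (adj \<iota> U) W)"
  using assms
proof (induction Y rule: finite_induct)
  case empty
  show ?case by (rule exI[of _ "{1}"]) (auto intro: exI[of _ 1])
next
  case (insert y Y)
  then obtain W g where W: "finite W" "1 \<in> W" "g \<in> adj \<iota> U" "g \<noteq> 0"
    "\<And>y w. y \<in> Y \<Longrightarrow> w \<in> W \<Longrightarrow> g * y * w \<in> mspan (adj \<iota> U) W" by blast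
  obtain c n where c: "\<And>i. c i \<in> adj \<iota> U" "c n \<noteq> 0" "(\<Sum>i\<le>n. c i * y ^ i) = 0"
    using insert.prems[of y] by blast
  have n: "n > 0" using c(2,3) by (cases n) auto
  define W' where "W' = (\<lambda>(w, j). w * y ^ j) ` (W \<times> {..<n})"
  have W'I: "w * y ^ j \<in> W'" if "w \<in> W" "j < n" for w j using that by (auto simp: W'_def)
  let ?g = "g * c n"
  have 1: "?g * y' * w' \<in> mspan (adj \<iota> U) W'" if y': "y' \<in> Y" and w': "w' \<in> W'" for y' w'
  proof -
    obtain w j where wj: "w \<in> W" "j < n" "w' = w * y ^ j" using w' by (auto simp: W'_def)
    have "(c n * y ^ j) * (g * y' * w) \<in> mspan (adj \<iota> U) W'"
    proof (rule mspan_bilinear[OF W(5)[OF y' wj(1)]])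
      fix a v assume "a \<in> adj \<iota> U" "v \<in> W"
      then have "(c n * a) * (v * y ^ j) \<in> mspan (adj \<iota> U) W'"
        using wj by (intro mspan_single adj_mult c W'I)
      then show "c n * y ^ j * (a * v) \<in> mspan (adj \<iota> U) W'" by (simp add: ac_simps)
    qed
    then show ?thesis by (simp add: wj ac_simps)
  qed
  have 2: "?g * y * w' \<in> mspan (adj \<iota> U) W'" if w': "w' \<in> W'" for w'
  proof -
    obtain w j where wj: "w \<in> W" "j < n" "w' = w * y ^ j" using w' by (auto simp: W'_def)
    show ?thesis
    proof (cases "Suc j = n")
      case False
      then have "?g * (w * y ^ Suc j) \<in> mspan (adj \<iota> U) W'"
        using wj W c by (intro mspan_single adj_mult W'I) auto
      then show ?thesis by (simp add: wj ac_simps)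
    next
      case True
      \<comment> \<open>Only here does the exponent leave the range below \<open>n\<close>; the
        factor \<open>c n\<close> of \<open>?g\<close> allows the equation of \<open>y\<close> to
        lower it.\<close>
      have "(\<Sum>i\<le>n. c i * y ^ i) = (\<Sum>i<n. c i * y ^ i) + c n * y ^ n"
        by (simp flip: lessThan_Suc_atMost)
      with c(3) have eq: "c n * y ^ n = - (\<Sum>i<n. c i * y ^ i)"
        by (metis add.commute eq_neg_iff_add_eq_0)
      have "?g * y * w' = g * w * (c n * y ^ n)"
        unfolding wj(3) True[symmetric] power_Suc by (simp only: ac_simps)
      also note eq
      also have "g * w * - (\<Sum>i<n. c i * y ^ i) = (\<Sum>i<n. (g * - c i) * (w * y ^ i))" by (simp add: sum_distrib_left sum_negf ac_simps)
      also have "\<dots> \<in> mspan (adj \<iota> U) W'"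
        using wj W c by (intro mspan_sum mspan_single adj_mult adj_uminus W'I) auto
      finally show ?thesis .
    qed
  qed
  have "finite W'" using W by (simp add: W'_def)
  moreover have "1 \<in> W'" using W'I[OF W(2) n] by simp
  moreover have "?g \<in> adj \<iota> U" "?g \<noteq> 0" using W c by (auto intro: adj_mult)
  ultimately show ?case using 1 2 by (intro exI[of _ W'] exI[of _ ?g] conjI ballI) blast+
qed

text \<open>Maximality makes every element of \<open>Y\<close> algebraic over \<open>U\<close>, so
  the generated algebra is finite over that of \<open>U\<close> up to denominators and the count
  applies.\<close>

lemma card_le_of_maximal_independent:
  assumes "finite Y" "U \<subseteq> Y" and U: "algebraically_independent \<iota> U"
    and max: "\<And>y. y \<in> Y - U \<Longrightarrow> \<not> algebraically_independent \<iota> (insert y U)"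
    and Z: "finite Z" "algebraically_independent \<iota> Z" "Z \<subseteq> adj \<iota> Y"
  shows "card Z \<le> card U"
proof -
  have alg: "\<exists>c n. (\<forall>i. c i \<in> adj \<iota> U) \<and> c n \<noteq> 0 \<and> (\<Sum>i\<le>n. c i * y ^ i) = 0" if "y \<in> Y" for y
  proof (cases "y \<in> U")
    case True
    \<comment> \<open>An element of \<open>U\<close> satisfies the equation
      \<open>- y + 1 * y = 0\<close> of degree 1 over the algebra of \<open>U\<close>.\<close>
    let ?c = "\<lambda>i::nat. if i = 0 then - y else 1"
    have "(\<Sum>i\<le>1. ?c i * y ^ i) = 0" by simp
    moreover have "?c i \<in> adj \<iota> U" for i using True by (auto intro: adj_uminus adj_gen)
    ultimately show ?thesis by (intro exI[of _ ?c] exI[of _ 1]) auto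
  next
    case False
    with that have "\<not> algebraically_independent \<iota> (insert y U)" using max by blast
    from ex_algebraic_relation[OF U this] show ?thesis by metis
  qed
  from ex_localized_finite[OF assms(1) alg]
  obtain W g where "finite W" "1 \<in> W" "g \<in> adj \<iota> U" "g \<noteq> 0"
    "\<And>y w. y \<in> Y \<Longrightarrow> w \<in> W \<Longrightarrow> g * y * w \<in> mspan (adj \<iota> U) W" by metis
  then show ?thesis
    using card_le_of_localized_finite[OF _ Z(1,2,3)] finite_subset[OF assms(2,1)] by blast
qed

lemma algebraically_independent_empty: "algebraically_independent \<iota> {}"
  unfolding algebraically_independent_iff
proof (intro ballI impI)
  fix P :: "('a, 'f) mpoly" assume P: "P \<in> polys_in {}" "mpoly_eval \<iota> (\<lambda>a. a) P = 0"
  note Pc = polys_in_empty[OF P(1)]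
  with P(2) have "lookup P 0 = 0" using inj_hom by (metis mpoly_eval_mconst)
  with Pc show "P = 0" by simp
qed

end

section \<open>Noether normalization\<close>

text \<open>Positional notation with a new base at each step: the remainder modulo \<open>K\<close>
  is the weighted sum built so far, and the quotient is the exponent of the new variable.\<close>

lemma ex_injective_weights:
  assumes "finite V" "t \<notin> V"
  shows "\<exists>w. (\<forall>v. w v > 0) \<and>
    inj_on (\<lambda>m. lookup m t + (\<Sum>v\<in>V. w v * lookup m v))
      (exponent_box (insert t V) D)"
  using assms
proof (induction V rule: finite_induct)
  case empty
  have "inj_on (\<lambda>m. lookup m t) (exponent_box {t} D)"
  proof (rule inj_onI, rule poly_mapping_eqI)
    fix m m' k
    assume "m \<in> exponent_box {t} D" "m' \<in> exponent_box {t} D"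
      and eq: "lookup m t = lookup m' t"
    then have "k \<noteq> t \<Longrightarrow> k \<notin> keys m" "k \<noteq> t \<Longrightarrow> k \<notin> keys m'"
      by (auto simp: exponent_box_def)
    with eq show "lookup m k = lookup m' k"
      by (cases "k = t") (auto simp: in_keys_iff)
  qed
  then show ?case by (intro exI[of _ "\<lambda>_. 1"]) simp
next
  case (insert v V)
  let ?f = "\<lambda>w V m. lookup m t + (\<Sum>u\<in>V. w u * lookup m u)"
  from insert obtain w where w: "\<And>u. w u > 0" "inj_on (?f w V) (exponent_box (insert t V) D)"
    by auto
  \<comment> \<open>One more than the largest value that the previous weighted sum can take on the
    box.\<close>
  define K where "K = Suc (D + (\<Sum>u\<in>V. w u * D))"
  define w' where "w' = w(v := K)"
  have f: "?f w' (insert v V) m = ?f w V m + K * lookup m v" for m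
  proof -
    have "(\<Sum>u\<in>V. w' u * lookup m u) = (\<Sum>u\<in>V. w u * lookup m u)"
      using insert by (intro sum.cong) (auto simp: w'_def)
    then show ?thesis using insert by (simp add: w'_def)
  qed
  have less: "?f w V m < K" if "m \<in> exponent_box S D" for m S
    using that unfolding K_def exponent_box_def by (auto intro!: add_mono sum_mono le_imp_less_Suc)
  have "inj_on (?f w' (insert v V)) (exponent_box (insert t (insert v V)) D)"
  proof (rule inj_onI)
    fix m m'
    assume m: "m \<in> exponent_box (insert t (insert v V)) D" "m' \<in> exponent_box (insert t (insert v V)) D"
      and eq: "?f w' (insert v V) m = ?f w' (insert v V) m'"
    have eq': "?f w V m + K * lookup m v = ?f w V m' + K * lookup m' v"
      using eq unfolding f .
    have "(?f w V m + K * lookup m v) mod K = ?f w V m"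
      "(?f w V m' + K * lookup m' v) mod K = ?f w V m'"
      using less[OF m(1)] less[OF m(2)] by simp_all
    with eq' have e1: "?f w V m = ?f w V m'" by simp
    with eq' have "K * lookup m v = K * lookup m' v" by simp
    then have e2: "lookup m v = lookup m' v"
      using mult_cancel1[of K] by (simp only: K_def nat.simps) simp
    define r where "r m = m - single v (lookup m v)" for m :: "'a \<Rightarrow>\<^sub>0 nat"
    have lr: "lookup (r m) u = (if u = v then 0 else lookup m u)" for m u
      by (simp add: r_def lookup_minus lookup_single when_def)
    have rb: "r m \<in> exponent_box (insert t V) D" if "m \<in> exponent_box (insert t (insert v V)) D" for m
    proof -
      have "keys (r m) \<subseteq> keys m - {v}"
        by (auto simp: in_keys_iff lr split: if_splits)
      then show ?thesis using that by (auto simp: exponent_box_def lr)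
    qed
    have fr: "?f w V (r m) = ?f w V m" for m
      using insert by (auto simp: lr intro!: sum.cong)
    have "r m = r m'" using w(2) rb m e1 by (auto simp: inj_on_def fr)
    then show "m = m'" using e2 by (metis lr poly_mapping_eqI)
  qed
  then show ?case using w(1) by (intro exI[of _ w']) (auto simp: w'_def K_def)
qed

locale inj_field_hom = inj_idom_hom \<iota> for \<iota> :: "'f::field \<Rightarrow> 'a::idom"
begin

text \<open>Nagata's substitution \<open>v = v' + t ^ w v\<close>: the weights make the powers of \<open>t\<close> in the
  leading terms of the monomials of a relation pairwise distinct, so that \<open>t\<close> becomes
  integral over the new elements \<open>v'\<close>.\<close>

lemma noether_normalization:
  assumes "finite Y"
  shows "\<exists>B W. finite B \<and> algebraically_independent \<iota> B \<and> B \<subseteq> adj \<iota> Y \<and>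
    finite W \<and> 1 \<in> W \<and> W \<subseteq> adj \<iota> Y \<and> adj \<iota> Y \<subseteq> mspan (adj \<iota> B) W"
  using assms
proof (induction "card Y" arbitrary: Y rule: less_induct)
  case less
  show ?case
  proof (cases "algebraically_independent \<iota> Y")
    case True
    have "adj \<iota> Y \<subseteq> mspan (adj \<iota> Y) {1}"
      using mspan_single[of _ "adj \<iota> Y" 1 "{1}"] by auto
    then show ?thesis using True less.prems adj_gen by (intro exI[of _ Y] exI[of _ "{1}"]) auto
  next
    case False
    then obtain P where P: "P \<in> polys_in Y" "mpoly_eval \<iota> (\<lambda>a. a) P = 0" "P \<noteq> 0"
      by (auto simp: algebraically_independent_iff)
    from False obtain t where t: "t \<in> Y" using algebraically_independent_empty by fastforce
    define V where "V = Y - {t}"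
    have Y: "Y = insert t V" "t \<notin> V" "finite V" using t less.prems by (auto simp: V_def)
    let ?K = "keys P"
    define D where "D = Max ((\<lambda>(m, v). lookup m v) ` (?K \<times> Y))"
    have box: "?K \<subseteq> exponent_box (insert t V) D"
    proof
      fix m assume m: "m \<in> ?K"
      then have km: "keys m \<subseteq> Y" using P(1) by (auto simp: polys_in_def)
      have "lookup m v \<le> D" for v
      proof (cases "v \<in> Y")
        case True
        with m have "lookup m v \<in> (\<lambda>(m, v). lookup m v) ` (?K \<times> Y)" by force
        then show ?thesis unfolding D_def using less.prems by (intro Max_ge) auto
      next
        case False
        with km have "v \<notin> keys m" by auto
        then show ?thesis by (simp add: in_keys_iff)
      qed
      with km show "m \<in> exponent_box (insert t V) D" by (auto simp: exponent_box_def Y)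
    qed
    obtain w where w: "\<And>v. w v > 0"
      "inj_on (\<lambda>m. lookup m t + (\<Sum>v\<in>V. w v * lookup m v))
        (exponent_box (insert t V) D)"
      using ex_injective_weights[OF Y(3,2)] by blast
    define s where "s m = lookup m t + (\<Sum>v\<in>V. w v * lookup m v)" for m
    have s_inj: "inj_on s ?K" using inj_on_subset[OF w(2) box] by (simp add: s_def[abs_def])
    define Y' where "Y' = (\<lambda>v. v - t ^ w v) ` V"
    define R where "R = adj \<iota> Y'"
    \<comment> \<open>The polynomials in \<open>t\<close> over \<open>R\<close> of degree less than
      \<open>d\<close>, as elements of the ambient ring. Representations need not be unique, so
      degrees are only upper bounds.\<close>
    define Lo where "Lo d = mspan R ((\<lambda>j. t ^ j) ` {..<d})" for d
    have LoI: "a * t ^ j \<in> Lo d" if "a \<in> R" "j < d" for a j d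
      unfolding Lo_def using that by (intro mspan_single) auto
    have Lo_add: "x + y \<in> Lo d" if "x \<in> Lo d" "y \<in> Lo d" for x y d
      using that unfolding Lo_def by (rule mspan_add)
    have Lo_mult: "x * l \<in> Lo (d + e)" if x: "x \<in> Lo (Suc d)" and l: "l \<in> Lo e" for x l d e
      using l unfolding Lo_def
    proof (rule mspan_bilinear)
      fix a u assume au: "a \<in> R" "u \<in> (\<lambda>j. t ^ j) ` {..<e}"
      have "(a * u) * x \<in> mspan R ((\<lambda>j. t ^ j) ` {..<d + e})"
        using x unfolding Lo_def
      proof (rule mspan_bilinear)
        fix a' u' assume au': "a' \<in> R" "u' \<in> (\<lambda>j. t ^ j) ` {..<Suc d}"
        from au au' obtain i j where ij: "u = t ^ i" "i < e" "u' = t ^ j" "j < Suc d" by blast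
        have "(a * a') * t ^ (i + j) \<in> Lo (d + e)"
          using au(1) au'(1) ij by (intro LoI) (auto simp: R_def intro: adj_mult)
        then show "a * u * (a' * u') \<in> mspan R ((\<lambda>j. t ^ j) ` {..<d + e})"
          by (simp add: Lo_def ij power_add ac_simps)
      qed
      then show "x * (a * u) \<in> mspan R ((\<lambda>j. t ^ j) ` {..<d + e})" by (simp add: ac_simps)
    qed
    have Lo_mono: "Lo d \<subseteq> Lo e" if "d \<le> e" for d e
      unfolding Lo_def using that by (intro mspan_mono) auto
    have one_R: "1 \<in> R" by (simp add: R_def)
    have t_Lo: "t ^ j \<in> Lo d" if "j < d" for j d
      using LoI[OF one_R that] by simp
    have R_Lo: "a \<in> Lo d" if "a \<in> R" "d > 0" for a d
      using LoI[OF that] by simp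
    \<comment> \<open>\<open>x\<close> is represented by a monic polynomial in \<open>t\<close> of
      degree \<open>d\<close>. This property is multiplicative, which yields the leading term of
      each monomial.\<close>
    define mo where "mo x d \<longleftrightarrow> x - t ^ d \<in> Lo d" for x d
    have mo_mult: "mo (x * y) (d + e)" if "mo x d" "mo y e" for x y d e
    proof -
      let ?x = "x - t ^ d" and ?y = "y - t ^ e"
      have "t ^ d * ?y \<in> Lo (d + e)" "t ^ e * ?x \<in> Lo (e + d)" "?x * ?y \<in> Lo (d + e)"
        using that t_Lo[of d "Suc d"] t_Lo[of e "Suc e"] Lo_mono[of d "Suc d"]
        by (auto simp: mo_def intro!: Lo_mult)
      then have "t ^ d * ?y + (t ^ e * ?x + ?x * ?y) \<in> Lo (d + e)"
        by (intro Lo_add) (simp_all add: add.commute)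
      moreover have "t ^ d * ?y + (t ^ e * ?x + ?x * ?y) = x * y - t ^ (d + e)"
        by (simp add: algebra_simps power_add)
      ultimately show ?thesis by (simp add: mo_def)
    qed
    have mo_1: "mo 1 0" by (simp add: mo_def Lo_def mspan_0)
    have mo_t: "mo t 1" by (simp add: mo_def Lo_def mspan_0)
    \<comment> \<open>The difference \<open>v - t ^ w v\<close> is one of the new generators, hence
      constant in \<open>t\<close>; positivity of the weight makes it a term of lower
      degree.\<close>
    have mo_V: "mo v (w v)" if "v \<in> V" for v
      unfolding mo_def using that w(1) by (intro R_Lo) (auto simp: R_def Y'_def intro: adj_gen)
    have mo_power: "mo (x ^ k) (d * k)" if "mo x d" for x d k
      using that mo_1 by (induction k) (auto intro: mo_mult)
    have mo_prod: "mo (\<Prod>v\<in>S. f v) (\<Sum>v\<in>S. d v)" if "finite S" "\<And>v. v \<in> S \<Longrightarrow> mo (f v) (d v)" for S f d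
      using that by (induction S rule: finite_induct) (auto simp: mo_1 intro: mo_mult)
    have mo_mon: "mo (monom_val (\<lambda>a. a) m) (s m)" if "m \<in> ?K" for m
    proof -
      have "monom_val (\<lambda>a. a) m = (\<Prod>v\<in>insert t V. v ^ lookup m v)"
        using that box Y by (intro monom_val_superset) (auto simp: exponent_box_def)
      also have "\<dots> = t ^ lookup m t * (\<Prod>v\<in>V. v ^ lookup m v)"
        using Y by simp
      finally show ?thesis
        using mo_mult[OF mo_power[OF mo_t, of "lookup m t"]
            mo_prod[OF Y(3) mo_power[OF mo_V], of "\<lambda>v. v" "lookup m"]]
        by (simp add: s_def)
    qed
    have K: "finite ?K" "?K \<noteq> {}" using P(3) by auto
    define d where "d = Max (s ` ?K)"
    have "d \<in> s ` ?K" unfolding d_def using K by (intro Max_in) auto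
    then obtain m0 where m0: "m0 \<in> ?K" "s m0 = d" by blast
    have sd: "s m < d" if "m \<in> ?K" "m \<noteq> m0" for m
    proof -
      have "s m \<le> d" unfolding d_def using K that by (intro Max_ge) auto
      moreover have "s m \<noteq> d" using s_inj that m0 by (metis inj_onD)
      ultimately show ?thesis by simp
    qed
    let ?c = "\<lambda>m. \<iota> (lookup P m)" and ?mon = "monom_val (\<lambda>a. a)"
    have cR: "\<iota> c \<in> R" for c by (simp add: R_def adj_scal)
    have R_mult_Lo: "a * l \<in> Lo e" if "a \<in> R" "l \<in> Lo e" for a l e
      using Lo_mult[of a 0 l e] R_Lo[of a 1] that by simp
    have rest: "?c m * ?mon m \<in> Lo d" if "m \<in> ?K - {m0}" for m
    proof -
      have "?mon m - t ^ s m \<in> Lo d" "t ^ s m \<in> Lo d"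
        using mo_mon[of m] sd[of m] that Lo_mono[of "s m" d] by (auto simp: mo_def intro: t_Lo)
      from Lo_add[OF this] show ?thesis using cR by (intro R_mult_Lo) simp_all
    qed
    \<comment> \<open>The monomial \<open>m0\<close> alone attains the top degree. Solving the
      relation for its leading term and dividing by its coefficient, a unit of the field, gives an
      integral equation of \<open>t\<close> over \<open>R\<close>.\<close>
    have "?c m0 * ?mon m0 + (\<Sum>m\<in>?K - {m0}. ?c m * ?mon m) = 0"
      using P(2) K m0 by (simp add: mpoly_eval_monom_val sum.remove)
    then have "?c m0 * t ^ d = - (?c m0 * (?mon m0 - t ^ d)) - (\<Sum>m\<in>?K - {m0}. ?c m * ?mon m)"
      by (simp add: algebra_simps eq_neg_iff_add_eq_0)
    also have "\<dots> = \<iota> (- 1) * (?c m0 * (?mon m0 - t ^ d) + (\<Sum>m\<in>?K - {m0}. ?c m * ?mon m))"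
      by (simp add: hom_uminus)
    also have "\<dots> \<in> Lo d"
      using rest mo_mon[OF m0(1)] m0(2) cR
      by (intro R_mult_Lo Lo_add) (auto simp: mo_def Lo_def intro: mspan_sum)
    finally have "\<iota> (inverse (lookup P m0)) * (?c m0 * t ^ d) \<in> Lo d"
      by (rule R_mult_Lo[OF cR])
    moreover have "lookup P m0 \<noteq> 0" using m0(1) by (simp add: in_keys_iff)
    then have "\<iota> (inverse (lookup P m0)) * ?c m0 = 1" by (simp flip: hom_mult)
    ultimately have td: "t ^ d \<in> Lo d" by (metis mult.assoc mult_1)
    have d: "d > 0"
    proof (rule ccontr)
      assume "\<not> d > 0"
      moreover have "Lo 0 = {0}" by (auto simp: Lo_def intro: mspan_0 elim: mspan.cases)
      ultimately show False using td by simp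
    qed
    have t_mult: "t * l \<in> Lo d" if "l \<in> Lo d" for l
      using that unfolding Lo_def
    proof (rule mspan_bilinear)
      fix a u assume "a \<in> R" "u \<in> (\<lambda>j. t ^ j) ` {..<d}"
      then obtain j where j: "a \<in> R" "u = t ^ j" "j < d" by blast
      have "a * t ^ Suc j \<in> Lo d"
        by (cases "Suc j = d") (use j td in \<open>auto intro: R_mult_Lo LoI simp del: power_Suc\<close>)
      then show "t * (a * u) \<in> mspan R ((\<lambda>j. t ^ j) ` {..<d})" by (simp add: j Lo_def ac_simps)
    qed
    have tk_mult: "t ^ k * l \<in> Lo d" if "l \<in> Lo d" for k l
      using that by (induction k) (auto simp: mult.assoc intro: t_mult)
    have Y_mult: "x * l \<in> Lo d" if "x \<in> adj \<iota> Y" "l \<in> Lo d" for x l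
      using that
    proof (induction arbitrary: l)
      case (adj_scal c)
      then show ?case using cR by (auto intro: R_mult_Lo)
    next
      case (adj_gen v)
      show ?case
      proof (cases "v = t")
        case True
        then show ?thesis using adj_gen t_mult by simp
      next
        case False
        with adj_gen have "v \<in> V" by (simp add: V_def)
        then have "v - t ^ w v \<in> R" by (auto simp: R_def Y'_def intro: adj.adj_gen)
        with adj_gen have "(v - t ^ w v) * l + t ^ w v * l \<in> Lo d"
          by (intro Lo_add R_mult_Lo tk_mult) auto
        then show ?thesis by (simp add: algebra_simps)
      qed
    next
      case (adj_add x y)
      then show ?case by (auto simp: distrib_right intro: Lo_add)
    next
      case (adj_mult x y)
      then show ?case by (auto simp: mult.assoc)
    qed
    have Y_Lo: "adj \<iota> Y \<subseteq> Lo d" using Y_mult[OF _ R_Lo[OF one_R d]] by auto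
    have "card Y' \<le> card V" unfolding Y'_def by (rule card_image_le[OF Y(3)])
    also have "\<dots> < card Y" using Y by simp
    finally have cY': "card Y' < card Y" .
    have finY': "finite Y'" using Y by (simp add: Y'_def)
    \<comment> \<open>The induction hypothesis applies to the new generators, one per element of
      \<open>V\<close>, which omits \<open>t\<close>; finiteness over their algebra is then composed
      with finiteness of \<open>t\<close>.\<close>
    obtain B W where BW: "finite B" "algebraically_independent \<iota> B" "B \<subseteq> adj \<iota> Y'"
      "finite W" "1 \<in> W" "W \<subseteq> adj \<iota> Y'" "adj \<iota> Y' \<subseteq> mspan (adj \<iota> B) W"
      using less.hyps[OF cY' finY'] by blast
    have RY: "adj \<iota> Y' \<subseteq> adj \<iota> Y"
    proof (rule adj_subset, rule subsetI)
      fix x assume "x \<in> Y'"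
      then obtain v where "v \<in> V" "x = v - t ^ w v" by (auto simp: Y'_def)
      then show "x \<in> adj \<iota> Y" using Y(1) by (auto intro: adj_diff adj_power adj_gen)
    qed
    define W' where "W' = (\<lambda>(w, j). w * t ^ j) ` (W \<times> {..<d})"
    have W'I: "v * t ^ j \<in> W'" if "v \<in> W" "j < d" for v j using that by (auto simp: W'_def)
    have "1 * x \<in> mspan (adj \<iota> B) W'" if "x \<in> Lo d" for x
      using that unfolding Lo_def
    proof (rule mspan_bilinear)
      fix a u assume "a \<in> R" "u \<in> (\<lambda>j. t ^ j) ` {..<d}"
      then obtain j where j: "a \<in> R" "u = t ^ j" "j < d" by blast
      from j(1) BW(7) have "a \<in> mspan (adj \<iota> B) W" by (auto simp: R_def)
      then have "t ^ j * a \<in> mspan (adj \<iota> B) W'"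
      proof (rule mspan_bilinear)
        fix a v assume "a \<in> adj \<iota> B" "v \<in> W"
        then have "a * (v * t ^ j) \<in> mspan (adj \<iota> B) W'" using j by (intro mspan_single W'I)
        then show "t ^ j * (a * v) \<in> mspan (adj \<iota> B) W'" by (simp add: ac_simps)
      qed
      then show "1 * (a * u) \<in> mspan (adj \<iota> B) W'" by (simp add: j ac_simps)
    qed
    then have "adj \<iota> Y \<subseteq> mspan (adj \<iota> B) W'" using Y_Lo by auto
    moreover have "finite W'" using BW by (simp add: W'_def)
    moreover have "1 \<in> W'" using W'I[OF BW(5) d] by simp
    moreover have "W' \<subseteq> adj \<iota> Y"
      using BW(6) RY t by (auto simp: W'_def intro: adj_mult adj_power adj_gen)
    ultimately show ?thesis using BW RY by blast
  qed
qed

end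

section \<open>Krull dimension of a finitely generated domain\<close>

definition ideal_in :: "'a::comm_ring_1 set \<Rightarrow> 'a set \<Rightarrow> bool" where
  "ideal_in R Q \<longleftrightarrow> Q \<subseteq> R \<and> 0 \<in> Q \<and> (\<forall>x\<in>Q. \<forall>y\<in>Q. x + y \<in> Q) \<and> (\<forall>r\<in>R. \<forall>x\<in>Q. r * x \<in> Q)"

definition prime_in :: "'a::comm_ring_1 set \<Rightarrow> 'a set \<Rightarrow> bool" where
  "prime_in R Q \<longleftrightarrow> ideal_in R Q \<and> 1 \<notin> Q \<and> (\<forall>x\<in>R. \<forall>y\<in>R. x * y \<in> Q \<longrightarrow> x \<in> Q \<or> y \<in> Q)"

lemma ideal_inD:
  assumes "ideal_in R Q"
  shows "Q \<subseteq> R" "0 \<in> Q" "x \<in> Q \<Longrightarrow> y \<in> Q \<Longrightarrow> x + y \<in> Q" "r \<in> R \<Longrightarrow> x \<in> Q \<Longrightarrow> r * x \<in> Q"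
  using assms by (auto simp: ideal_in_def)

text \<open>An ideal that is maximal among the ideals containing \<open>J\<close> and disjoint from
  the multiplicative set \<open>T\<close> is prime; Zorn's lemma supplies one.\<close>

lemma ex_prime_avoiding:
  assumes R_add: "\<And>x y. x \<in> R \<Longrightarrow> y \<in> R \<Longrightarrow> x + y \<in> R"
    and R_mult: "\<And>x y. x \<in> R \<Longrightarrow> y \<in> R \<Longrightarrow> x * y \<in> R" and R0: "0 \<in> R" and R1: "1 \<in> R"
    and J: "ideal_in R J" and T: "1 \<in> T" "\<And>x y. x \<in> T \<Longrightarrow> y \<in> T \<Longrightarrow> x * y \<in> T"
    and disj: "J \<inter> T = {}"
  obtains Q where "prime_in R Q" "J \<subseteq> Q" "Q \<inter> T = {}"
proof -
  define \<A> where "\<A> = {Q. ideal_in R Q \<and> J \<subseteq> Q \<and> Q \<inter> T = {}}"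
  have "\<exists>M\<in>\<A>. \<forall>K\<in>\<A>. M \<subseteq> K \<longrightarrow> K = M"
  proof (rule subset_Zorn_nonempty)
    show "\<A> \<noteq> {}" using J disj by (auto simp: \<A>_def)
    fix \<C> assume C: "\<C> \<noteq> {}" "subset.chain \<A> \<C>"
    then have sub: "\<C> \<subseteq> \<A>" and ch: "\<And>K L. K \<in> \<C> \<Longrightarrow> L \<in> \<C> \<Longrightarrow> K \<subseteq> L \<or> L \<subseteq> K"
      by (auto simp: subset.chain_def)
    have idl: "ideal_in R K" if "K \<in> \<C>" for K using that sub by (auto simp: \<A>_def)
    have "ideal_in R (\<Union>\<C>)"
      unfolding ideal_in_def
    proof (intro conjI ballI)
      show "\<Union>\<C> \<subseteq> R" using idl ideal_inD(1) by blast
      show "0 \<in> \<Union>\<C>" using C(1) idl ideal_inD(2) by blast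
    next
      fix x y assume "x \<in> \<Union>\<C>" "y \<in> \<Union>\<C>"
      then obtain K L where KL: "x \<in> K" "K \<in> \<C>" "y \<in> L" "L \<in> \<C>" by blast
      obtain M where M: "M \<in> \<C>" "x \<in> M" "y \<in> M" using ch[of K L] KL by blast
      then show "x + y \<in> \<Union>\<C>" using idl[OF M(1)] ideal_inD(3) by blast
    next
      fix r x assume "r \<in> R" "x \<in> \<Union>\<C>"
      then show "r * x \<in> \<Union>\<C>" using idl ideal_inD(4) by blast
    qed
    then show "\<Union>\<C> \<in> \<A>" using C(1) sub by (auto simp: \<A>_def)
  qed
  then obtain M where M: "ideal_in R M" "J \<subseteq> M" "M \<inter> T = {}"
    and max: "\<And>K. ideal_in R K \<Longrightarrow> M \<subseteq> K \<Longrightarrow> K \<inter> T = {} \<Longrightarrow> K = M"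
    by (auto simp: \<A>_def)
  note Md = ideal_inD[OF M(1)]
  \<comment> \<open>Adjoining an element outside \<open>M\<close> gives a strictly larger ideal,
    which must meet \<open>T\<close>. Two such elements with product in \<open>M\<close> would give
    a product of elements of \<open>T\<close> lying in \<open>M\<close>.\<close>
  have meets: "\<exists>m\<in>M. \<exists>r\<in>R. m + r * x \<in> T" if x: "x \<in> R" "x \<notin> M" for x
  proof -
    let ?K = "{m + r * x | m r. m \<in> M \<and> r \<in> R}"
    have K: "ideal_in R ?K"
      unfolding ideal_in_def
    proof (intro conjI ballI)
      show "?K \<subseteq> R" using Md(1) x R_add R_mult by auto
      show "0 \<in> ?K" using Md(2) R0 by (auto intro!: exI[of _ 0])
    next
      fix a b assume "a \<in> ?K" "b \<in> ?K"
      then obtain m r m' r' where *: "m \<in> M" "r \<in> R" "m' \<in> M" "r' \<in> R" "a = m + r * x" "b = m' + r' * x"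
        by blast
      then have "a + b = (m + m') + (r + r') * x" by (simp add: algebra_simps)
      then show "a + b \<in> ?K" using * Md(3) R_add by blast
    next
      fix s a assume s: "s \<in> R" and "a \<in> ?K"
      then obtain m r where *: "m \<in> M" "r \<in> R" "a = m + r * x" by blast
      then have "s * a = s * m + (s * r) * x" by (simp add: algebra_simps)
      then show "s * a \<in> ?K" using * s Md(4) R_mult by blast
    qed
    have sub: "M \<subseteq> ?K"
    proof
      fix m assume "m \<in> M"
      then show "m \<in> ?K" using R0 by (intro CollectI exI[of _ m] exI[of _ 0]) simp
    qed
    have "x \<in> ?K" using Md(2) R1 by (intro CollectI exI[of _ 0] exI[of _ 1]) simp
    with max[OF K sub] x have "?K \<inter> T \<noteq> {}" by blast
    then show ?thesis by blast
  qed
  have "x \<in> M \<or> y \<in> M" if xy: "x \<in> R" "y \<in> R" "x * y \<in> M" for x y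
  proof (rule ccontr)
    assume "\<not> (x \<in> M \<or> y \<in> M)"
    then obtain m r m' r' where *: "m \<in> M" "r \<in> R" "m + r * x \<in> T" "m' \<in> M" "r' \<in> R" "m' + r' * y \<in> T"
      using meets[of x] meets[of y] xy by blast
    have "(m + r * x) * (m' + r' * y) = ((m' + r' * y) * m + (r * x) * m') + (r * r') * (x * y)"
      by (simp add: algebra_simps)
    moreover have "(m' + r' * y) * m \<in> M" "(r * x) * m' \<in> M" "(r * r') * (x * y) \<in> M"
      using * xy Md(1) by (auto intro!: Md(4) R_add R_mult)
    then have "((m' + r' * y) * m + (r * x) * m') + (r * r') * (x * y) \<in> M" by (intro Md(3))
    ultimately have "(m + r * x) * (m' + r' * y) \<in> M" by (simp only:)
    then have "(m + r * x) * (m' + r' * y) \<in> M \<inter> T" using T(2)[OF *(3,6)] by (rule IntI)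
    with M(3) show False by simp
  qed
  then have "prime_in R M" using M T(1) by (auto simp: prime_in_def)
  then show ?thesis using M that by blast
qed

lemma mspan_insert:
  assumes "s \<in> mspan A (insert w V)" "0 \<in> A" "\<And>x y. x \<in> A \<Longrightarrow> y \<in> A \<Longrightarrow> x + y \<in> A"
  shows "\<exists>a\<in>A. \<exists>u\<in>mspan A V. s = a * w + u"
  using assms(1)
proof induction
  case mspan_0
  show ?case using assms(2) mspan.mspan_0[of A V] by (intro bexI[of _ 0]) auto
next
  case (mspan_step a v s)
  then obtain a' u where a': "a' \<in> A" "u \<in> mspan A V" "s = a' * w + u" by blast
  show ?case
  proof (cases "v = w")
    case True
    have "a * v + s = (a + a') * w + u" by (simp add: a' True algebra_simps)
    then show ?thesis using a' mspan_step assms(3) by blast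
  next
    case False
    then have "a * v + u \<in> mspan A V" using mspan_step a' by (intro mspan.mspan_step) auto
    moreover have "a * v + s = a' * w + (a * v + u)" by (simp add: a')
    ultimately show ?thesis using a' by blast
  qed
qed

section \<open>Going up along finite extensions\<close>

context inj_idom_hom
begin

text \<open>Going up along a finite extension: the module generators are eliminated one at a time,
  as in the proof of Nakayama's lemma.\<close>

lemma going_up:
  fixes A R :: "'a set"
  assumes A_def: "A = adj \<iota> B" and R_def: "R = adj \<iota> Y"
    and W: "finite W" "W \<subseteq> R" "R \<subseteq> mspan A W" and AR: "A \<subseteq> R"
    and Q: "prime_in R Q" "Q \<inter> A \<subseteq> P'" and P': "prime_in A P'" and b: "b \<in> P'"
  obtains Q' where "prime_in R Q'" "Q \<subseteq> Q'" "b \<in> Q'" "Q' \<inter> A \<subseteq> P'"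
proof -
  note Qd = ideal_inD[OF conjunct1[OF Q(1)[unfolded prime_in_def]]]
  note Pd = ideal_inD[OF conjunct1[OF P'[unfolded prime_in_def]]]
  define T where "T = A - P'"
  have bA: "b \<in> A" using b Pd(1) by auto
  have T1: "1 \<in> T" using P' by (simp add: T_def prime_in_def A_def)
  have Tm: "x * y \<in> T" if "x \<in> T" "y \<in> T" for x y
    using P' that by (auto simp: T_def prime_in_def A_def intro: adj_mult)
  \<comment> \<open>No element of \<open>T\<close> carries all of \<open>R\<close> into
    \<open>Q\<close> plus \<open>b\<close> times the module spanned by \<open>V\<close>. For empty
    \<open>V\<close> such an \<open>s\<close> would lie in \<open>Q\<close> and in \<open>A\<close>,
    hence in \<open>P'\<close>; for \<open>V = W\<close> the claim will show that
    \<open>Q + b R\<close> avoids \<open>T\<close>.\<close>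
  have "\<not> (\<exists>s\<in>T. \<forall>r\<in>R. \<exists>q\<in>Q. \<exists>u\<in>mspan A V. s * r = q + b * u)"
    if "finite V" "V \<subseteq> R" for V
    using that
  proof (induction V rule: finite_induct)
    case empty
    show ?case
    proof
      assume "\<exists>s\<in>T. \<forall>r\<in>R. \<exists>q\<in>Q. \<exists>u\<in>mspan A {}. s * r = q + b * u"
      then obtain s where s: "s \<in> T" "\<forall>r\<in>R. \<exists>q\<in>Q. \<exists>u\<in>mspan A {}. s * r = q + b * u" by blast
      moreover have "1 \<in> R" by (simp add: R_def)
      ultimately obtain q u where "q \<in> Q" "u \<in> mspan A {}" "s * 1 = q + b * u" by blast
      moreover from this(2) have "u = 0" by (auto elim: mspan.cases)
      ultimately have "s \<in> Q" by simp
      then show False using s(1) Q(2) by (auto simp: T_def)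
    qed
  next
    case (insert w V)
    show ?case
    proof
      assume "\<exists>s\<in>T. \<forall>r\<in>R. \<exists>q\<in>Q. \<exists>u\<in>mspan A (insert w V). s * r = q + b * u"
      then obtain s where s: "s \<in> T"
        "\<And>r. r \<in> R \<Longrightarrow> \<exists>q\<in>Q. \<exists>u\<in>mspan A (insert w V). s * r = q + b * u" by blast
      have s': "\<exists>q\<in>Q. \<exists>a\<in>A. \<exists>u\<in>mspan A V. s * r = q + b * (a * w + u)" if r: "r \<in> R" for r
      proof -
        obtain q v where q: "q \<in> Q" "v \<in> mspan A (insert w V)" "s * r = q + b * v" using s(2)[OF r] by blast
        have "\<exists>a\<in>A. \<exists>u\<in>mspan A V. v = a * w + u"
          using q(2) by (rule mspan_insert) (auto simp: A_def intro: adj_add)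
        with q show ?thesis by blast
      qed
      have msA: "a * u \<in> mspan A V" if "a \<in> A" "u \<in> mspan A V" for a u
        using that(2)
      proof (rule mspan_bilinear)
        fix a' w assume "a' \<in> A" "w \<in> V"
        then have "(a * a') * w \<in> mspan A V" using that(1) by (intro mspan_single) (auto simp: A_def intro: adj_mult)
        then show "a * (a' * w) \<in> mspan A V" by (simp add: ac_simps)
      qed
      from s'[of w] insert.prems obtain q a u where q: "q \<in> Q" "a \<in> A" "u \<in> mspan A V"
        "s * w = q + b * (a * w + u)" by auto
      \<comment> \<open>Moving the \<open>w\<close>-term to the left gives
        \<open>s1 * w = q + b * u\<close>, so multiplication by \<open>s1\<close> removes the
        generator \<open>w\<close>. Since \<open>a * b\<close> lies in \<open>P'\<close> and
        \<open>s\<close> does not, \<open>s1\<close> stays in \<open>T\<close>.\<close>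
      define s1 where "s1 = s - a * b"
      have s1w: "s1 * w = q + b * u" using q(4) by (simp add: s1_def algebra_simps)
      have s1A: "s1 \<in> A" using s(1) q(2) bA by (auto simp: s1_def T_def A_def intro: adj_diff adj_mult)
      have s1: "s1 \<in> T"
      proof (rule ccontr)
        assume "s1 \<notin> T"
        then have "s1 + a * b \<in> P'" using s1A Pd(3,4) q(2) b by (auto simp: T_def)
        with s(1) show False by (simp add: s1_def T_def)
      qed
      have "\<exists>q\<in>Q. \<exists>u\<in>mspan A V. (s1 * s) * r = q + b * u" if r: "r \<in> R" for r
      proof -
        obtain q2 a2 u2 where 2: "q2 \<in> Q" "a2 \<in> A" "u2 \<in> mspan A V" "s * r = q2 + b * (a2 * w + u2)"
          using s'[OF r] by blast
        have "(s1 * s) * r = s1 * q2 + b * (a2 * (s1 * w) + s1 * u2)"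
          by (simp add: mult.assoc 2) (simp add: algebra_simps)
        also have "\<dots> = (s1 * q2 + (b * a2) * q) + b * (a2 * (b * u) + s1 * u2)"
          unfolding s1w by (simp add: algebra_simps)
        finally have "(s1 * s) * r = (s1 * q2 + (b * a2) * q) + b * (a2 * (b * u) + s1 * u2)" .
        moreover have "b * a2 \<in> R" using bA 2(2) AR by (auto simp: A_def intro: adj_mult)
        then have "s1 * q2 + (b * a2) * q \<in> Q" using s1A AR 2 q by (intro Qd(3,4)) auto
        moreover have "a2 * (b * u) + s1 * u2 \<in> mspan A V"
          using 2 q bA s1A by (intro mspan_add msA)
        ultimately show ?thesis by blast
      qed
      with insert.IH insert.prems Tm[OF s1 s(1)] show False by blast
    qed
  qed
  from this[OF W(1,2)] have no: "\<And>s. s \<in> T \<Longrightarrow> \<not> (\<forall>r\<in>R. \<exists>q\<in>Q. \<exists>u\<in>mspan A W. s * r = q + b * u)"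
    by blast
  define J where "J = {q + b * r | q r. q \<in> Q \<and> r \<in> R}"
  have JI: "q + b * r \<in> J" if "q \<in> Q" "r \<in> R" for q r using that by (auto simp: J_def)
  have bR: "b \<in> R" using bA AR by auto
  have J: "ideal_in R J"
    unfolding ideal_in_def
  proof (intro conjI ballI)
    show "J \<subseteq> R" using Qd(1) bR by (auto simp: J_def R_def intro!: adj_add adj_mult)
    show "0 \<in> J" using JI[of 0 0] Qd(2) by (simp add: R_def)
  next
    fix x y assume "x \<in> J" "y \<in> J"
    then obtain q r q' r' where *: "q \<in> Q" "r \<in> R" "q' \<in> Q" "r' \<in> R" "x = q + b * r" "y = q' + b * r'"
      by (auto simp: J_def)
    then have "(q + q') + b * (r + r') \<in> J" by (intro JI Qd(3)) (auto simp: R_def intro: adj_add)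
    then show "x + y \<in> J" by (simp add: * algebra_simps)
  next
    fix s x assume s: "s \<in> R" and "x \<in> J"
    then obtain q r where *: "q \<in> Q" "r \<in> R" "x = q + b * r" by (auto simp: J_def)
    then have "s * q + b * (s * r) \<in> J" using s by (intro JI Qd(4)) (auto simp: R_def intro: adj_mult)
    then show "s * x \<in> J" by (simp add: * algebra_simps)
  qed
  \<comment> \<open>An element \<open>q + b * r\<close> of \<open>T\<close> would multiply
    \<open>R\<close> into \<open>Q\<close> plus \<open>b\<close> times the span of \<open>W\<close>,
    which has just been excluded.\<close>
  have disj: "J \<inter> T = {}"
  proof (rule ccontr)
    assume "J \<inter> T \<noteq> {}"
    then obtain q r where qr: "q \<in> Q" "r \<in> R" "q + b * r \<in> T" by (auto simp: J_def)
    have "\<exists>q'\<in>Q. \<exists>u\<in>mspan A W. (q + b * r) * r' = q' + b * u" if "r' \<in> R" for r'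
    proof -
      have "(q + b * r) * r' = r' * q + b * (r * r')" by (simp add: algebra_simps)
      moreover have "r * r' \<in> mspan A W" using W(3) qr that by (auto simp: R_def intro: adj_mult)
      ultimately show ?thesis using Qd(4)[OF that qr(1)] by blast
    qed
    with no[OF qr(3)] show False by blast
  qed
  obtain Q' where Q': "prime_in R Q'" "J \<subseteq> Q'" "Q' \<inter> T = {}"
  proof (rule ex_prime_avoiding[of R J T])
    show "J \<inter> T = {}" by (rule disj)
  qed (use J T1 Tm in \<open>auto simp: R_def intro: adj_add adj_mult\<close>)
  have "Q \<subseteq> J"
  proof
    fix q assume "q \<in> Q" then show "q \<in> J" using JI[of q 0] by (simp add: R_def)
  qed
  moreover have "b \<in> J" using JI[of 0 1] Qd(2) by (simp add: R_def)
  moreover have "Q' \<inter> A \<subseteq> P'" using Q'(3) by (auto simp: T_def)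
  ultimately show ?thesis using Q' that by blast
qed

text \<open>For independent \<open>B\<close> this is the prime generated by the variables in
  \<open>S\<close> of the polynomial ring \<open>adj \<iota> B\<close>. Written as the kernel of the
  substitution \<open>S = 0\<close> into a domain, it is prime without work on generators.\<close>

definition coord_prime :: "'a set \<Rightarrow> 'a set \<Rightarrow> 'a set" where
  "coord_prime B S = {mpoly_eval \<iota> (\<lambda>a. a) P | P.
    P \<in> polys_in B \<and> mpoly_eval \<iota> (\<lambda>a. if a \<in> S then 0 else a) P = 0}"

text \<open>Independence of \<open>B\<close> makes the polynomial representing an element unique, so
  the substitution may be tested on any representative.\<close>

lemma coord_prime_iff:
  assumes "algebraically_independent \<iota> B" "P \<in> polys_in B"
  shows "mpoly_eval \<iota> (\<lambda>a. a) P \<in> coord_prime B S \<longleftrightarrow> mpoly_eval \<iota> (\<lambda>a. if a \<in> S then 0 else a) P = 0"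
proof -
  interpret e: comm_ring_1_hom "mpoly_eval \<iota> (\<lambda>a. a)" by (rule mpoly_eval_hom)
  have "P = P'" if "P' \<in> polys_in B" "mpoly_eval \<iota> (\<lambda>a. a) P = mpoly_eval \<iota> (\<lambda>a. a) P'" for P'
  proof -
    have "mpoly_eval \<iota> (\<lambda>a. a) (P - P') = 0" using that(2) by (simp add: e.hom_diff)
    then show ?thesis using assms that(1) by (auto simp: algebraically_independent_iff dest: polys_in_diff)
  qed
  then show ?thesis using assms(2) by (auto simp: coord_prime_def)
qed

lemma prime_in_coord_prime:
  assumes "algebraically_independent \<iota> B"
  shows "prime_in (adj \<iota> B) (coord_prime B S)"
proof -
  let ?s = "mpoly_eval \<iota> (\<lambda>a. if a \<in> S then 0 else a)"
  interpret e: comm_ring_1_hom "mpoly_eval \<iota> (\<lambda>a. a)" by (rule mpoly_eval_hom)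
  interpret s: comm_ring_1_hom ?s by (rule mpoly_eval_hom)
  note iff = coord_prime_iff[OF assms, of _ S]
  have one: "1 \<in> polys_in B" using polys_in_mconst[of 1 B] by simp
  show ?thesis
    unfolding prime_in_def ideal_in_def
  proof (intro conjI ballI impI)
    show "coord_prime B S \<subseteq> adj \<iota> B" by (auto simp: coord_prime_def adj_iff)
    show "0 \<in> coord_prime B S" using iff[of 0] by simp
    show "1 \<notin> coord_prime B S" using iff[OF one] by simp
  next
    fix x y assume "x \<in> coord_prime B S" "y \<in> coord_prime B S"
    then obtain P P' where "P \<in> polys_in B" "P' \<in> polys_in B" "?s P = 0" "?s P' = 0"
      "x = mpoly_eval \<iota> (\<lambda>a. a) P" "y = mpoly_eval \<iota> (\<lambda>a. a) P'" by (auto simp: coord_prime_def)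
    then show "x + y \<in> coord_prime B S" using iff[of "P + P'"] by (simp add: polys_in_add e.hom_add s.hom_add)
  next
    fix r x assume "r \<in> adj \<iota> B" "x \<in> coord_prime B S"
    then obtain P P' where "P \<in> polys_in B" "P' \<in> polys_in B" "?s P' = 0"
      "r = mpoly_eval \<iota> (\<lambda>a. a) P" "x = mpoly_eval \<iota> (\<lambda>a. a) P'" by (auto simp: coord_prime_def adj_iff)
    then show "r * x \<in> coord_prime B S" using iff[of "P * P'"] by (simp add: polys_in_mult e.hom_mult s.hom_mult)
  next
    fix x y assume "x \<in> adj \<iota> B" "y \<in> adj \<iota> B" "x * y \<in> coord_prime B S"
    moreover from this obtain P P' where "P \<in> polys_in B" "P' \<in> polys_in B"
      "x = mpoly_eval \<iota> (\<lambda>a. a) P" "y = mpoly_eval \<iota> (\<lambda>a. a) P'" by (auto simp: adj_iff)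
    ultimately show "x \<in> coord_prime B S \<or> y \<in> coord_prime B S"
      using iff[of "P * P'"] iff[of P] iff[of P'] by (simp add: polys_in_mult e.hom_mult s.hom_mult)
  qed
qed

text \<open>Independence upgrades the vanishing of a value to the vanishing of the polynomial with
  \<open>S\<close> set to zero, into which the remaining variables of \<open>S'\<close> can then be
  substituted.\<close>

lemma coord_prime_mono:
  assumes B: "algebraically_independent \<iota> B" and "S \<subseteq> S'"
  shows "coord_prime B S \<subseteq> coord_prime B S'"
proof
  fix x assume "x \<in> coord_prime B S"
  then obtain P where P: "P \<in> polys_in B" "mpoly_eval \<iota> (\<lambda>a. if a \<in> S then 0 else a) P = 0"
    and x: "x = mpoly_eval \<iota> (\<lambda>a. a) P" by (auto simp: coord_prime_def)
  define P' where "P' = mpoly_eval mconst (\<lambda>a. if a \<in> S then 0 else mvar a) P"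
  have P': "mpoly_eval \<iota> g P' = mpoly_eval \<iota> (\<lambda>a. if a \<in> S then 0 else g a) P" for g
    unfolding P'_def
    by (subst mconst.hom_mpoly_eval[OF mpoly_eval_hom]) (simp add: if_distrib[of "mpoly_eval \<iota> g"] cong: if_cong)
  have "P' \<in> polys_in B"
    unfolding P'_def mpoly_eval_monom_val monom_val_def
  proof (intro polys_in_sum polys_in_mult polys_in_mconst)
    fix m assume "m \<in> keys P"
    then have m: "keys m \<subseteq> B" using P(1) by (auto simp: polys_in_def)
    have "(\<Prod>v\<in>K. (if v \<in> S then 0 else mvar v) ^ lookup m v) \<in> polys_in B"
      if "finite K" "K \<subseteq> B" for K
      using that
    proof (induction K rule: finite_induct)
      case empty
      show ?case using polys_in_mconst[of 1 B] by simp
    next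
      case (insert v K)
      then show ?case by (auto intro!: polys_in_mult polys_in_power polys_in_mvar)
    qed
    from this[OF finite_keys m]
    show "(\<Prod>v\<in>keys m. (if v \<in> S then 0 else mvar v) ^ lookup m v) \<in> polys_in B" .
  qed
  then have "P' = 0" using B P(2) P'[of "\<lambda>a. a"] by (auto simp: algebraically_independent_iff)
  then have "mpoly_eval \<iota> (\<lambda>a. if a \<in> S then 0 else if a \<in> S' then 0 else a) P = 0"
    using P'[of "\<lambda>a. if a \<in> S' then 0 else a"] by simp
  moreover have "(\<lambda>a. if a \<in> S then 0 else if a \<in> S' then 0 else a) = (\<lambda>a::'a. if a \<in> S' then 0 else a)"
    by (rule ext) (use assms(2) in auto)
  ultimately show "x \<in> coord_prime B S'" unfolding x coord_prime_iff[OF B P(1)] by simp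
qed

text \<open>The coordinate primes of the polynomial ring \<open>adj \<iota> B\<close> are lifted one
  by one. The inclusion \<open>Q i \<inter> ?A \<subseteq> P i\<close> suffices for strictness: it
  keeps the next variable out of \<open>Q i\<close>, while going up places it in the next
  prime.\<close>

lemma ex_prime_chain:
  assumes B: "algebraically_independent \<iota> B" "finite B" "B \<subseteq> adj \<iota> Y"
    and W: "finite W" "W \<subseteq> adj \<iota> Y" "adj \<iota> Y \<subseteq> mspan (adj \<iota> B) W"
  shows "\<exists>Q. (\<forall>i\<le>card B. prime_in (adj \<iota> Y) (Q i)) \<and> (\<forall>i<card B. Q i \<subset> Q (Suc i))"
proof -
  let ?R = "adj \<iota> Y" and ?A = "adj \<iota> B"
  obtain f where f: "bij_betw f {..<card B} B"
    using ex_bij_betw_nat_finite[OF B(2)] by (auto simp: atLeast0LessThan)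
  define P where "P i = coord_prime B (f ` {..<i})" for i
  have AR: "?A \<subseteq> ?R" by (rule adj_subset[OF B(3)])
  have "\<exists>Q. (\<forall>j\<le>i. prime_in ?R (Q j)) \<and> (\<forall>j<i. Q j \<subset> Q (Suc j)) \<and> Q i \<inter> ?A \<subseteq> P i" if "i \<le> card B" for i
    using that
  proof (induction i)
    case 0
    have "prime_in ?R {0}" by (auto simp: prime_in_def ideal_in_def)
    moreover have "0 \<in> P 0" using coord_prime_iff[OF B(1), of 0] by (simp add: P_def)
    ultimately show ?case by (intro exI[of _ "\<lambda>_. {0}"]) auto
  next
    case (Suc i)
    then obtain Q where Q: "\<And>j. j \<le> i \<Longrightarrow> prime_in ?R (Q j)" "\<And>j. j < i \<Longrightarrow> Q j \<subset> Q (Suc j)"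
      "Q i \<inter> ?A \<subseteq> P i" by auto
    have fi: "f i \<in> B" using f Suc.prems by (auto simp: bij_betw_def)
    note iff = coord_prime_iff[OF B(1) polys_in_mvar[OF fi]]
    have b: "f i \<in> P (Suc i)" using iff[of "f ` {..<Suc i}"] by (simp add: P_def)
    have nz: "f i \<noteq> 0"
    proof
      assume "f i = 0"
      then have "mvar (f i) = (0 :: ('a, 'f) mpoly)"
        using B(1) polys_in_mvar[OF fi] by (auto simp: algebraically_independent_iff)
      then show False by (simp add: mvar_def) (metis lookup_single_eq lookup_zero zero_neq_one)
    qed
    have "f i \<notin> f ` {..<i}"
      using inj_on_image_mem_iff[OF bij_betw_imp_inj_on[OF f], of i "{..<i}"] Suc.prems by auto
    then have nb: "f i \<notin> P i" using iff[of "f ` {..<i}"] nz by (simp add: P_def)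
    have "P i \<subseteq> P (Suc i)" unfolding P_def by (intro coord_prime_mono[OF B(1)]) auto
    with Q(3) have sub: "Q i \<inter> ?A \<subseteq> P (Suc i)" by blast
    have pP: "prime_in ?A (P (Suc i))" unfolding P_def by (rule prime_in_coord_prime[OF B(1)])
    obtain Q' where Q': "prime_in ?R Q'" "Q i \<subseteq> Q'" "f i \<in> Q'" "Q' \<inter> ?A \<subseteq> P (Suc i)"
      using going_up[OF refl refl W AR Q(1)[OF order_refl] sub pP b] by blast
    have "f i \<notin> Q i" using nb Q(3) adj_gen[OF fi, of \<iota>] by blast
    then have lt: "Q i \<subset> Q'" using Q' by blast
    define Q2 where "Q2 = Q(Suc i := Q')"
    have "\<forall>j\<le>Suc i. prime_in ?R (Q2 j)" using Q(1) Q'(1) by (auto simp: Q2_def le_Suc_eq)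
    moreover have "\<forall>j<Suc i. Q2 j \<subset> Q2 (Suc j)" using Q(2) lt by (auto simp: Q2_def less_Suc_eq)
    moreover have "Q2 (Suc i) \<inter> ?A \<subseteq> P (Suc i)" using Q'(4) by (simp add: Q2_def)
    ultimately show ?case by blast
  qed
  from this[OF order_refl] show ?thesis by blast
qed

end

section \<open>Prime chains, independent elements and Krull dimension\<close>

context inj_field_hom
begin

text \<open>One element is chosen in each step of the chain. A relation modulo \<open>Q i\<close>,
  divided by the lowest power of \<open>z i\<close> occurring in it, has its constant term in
  \<open>Q (Suc i)\<close>, and this is a relation among the later elements.\<close>

lemma prime_chain_independent:
  assumes Q: "\<And>i. i \<le> k \<Longrightarrow> prime_in (adj \<iota> Y) (Q i)" "\<And>i. i < k \<Longrightarrow> Q i \<subset> Q (Suc i)"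
  shows "\<exists>Z. finite Z \<and> card Z = k \<and> Z \<subseteq> adj \<iota> Y \<and> algebraically_independent \<iota> Z"
proof -
  let ?R = "adj \<iota> Y"
  have "\<forall>i\<in>{..<k}. \<exists>z. z \<in> Q (Suc i) - Q i" using Q(2) by blast
  from bchoice[OF this] obtain z where z: "\<And>i. i < k \<Longrightarrow> z i \<in> Q (Suc i)" "\<And>i. i < k \<Longrightarrow> z i \<notin> Q i" by blast
  note Qd = ideal_inD[OF conjunct1[OF Q(1)[unfolded prime_in_def]]]
  have mono: "Q i \<subseteq> Q j" if "i \<le> j" "j \<le> k" for i j
    using that by (induction j rule: dec_induct) (use Q(2) in \<open>auto simp: less_eq_Suc_le\<close>)
  have zR: "z i \<in> ?R" if "i < k" for i using z(1)[OF that] Qd(1)[of "Suc i"] that by auto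
  have inj: "inj_on z {..<k}"
  proof (rule linorder_inj_onI)
    fix i j assume "i < j" "i \<in> {..<k}" "j \<in> {..<k}"
    then show "z i \<noteq> z j" using z(1)[of i] z(2)[of j] mono[of "Suc i" j] by auto
  qed auto
  \<comment> \<open>Independence is strengthened to independence modulo \<open>Q i\<close> of the
    elements from \<open>z i\<close> on, so that induction can descend from \<open>k\<close>;
    \<open>i = 0\<close> contains the desired case because \<open>0 \<in> Q 0\<close>.\<close>
  have claim: "\<forall>P\<in>polys_in (z ` {i..<k}). mpoly_eval \<iota> (\<lambda>a. a) P \<in> Q i \<longrightarrow> P = 0" if "i \<le> k" for i
    using that
  proof (induction i rule: inc_induct)
    case base
    show ?case
    proof (intro ballI impI)
      fix P :: "('a, 'f) mpoly" assume P: "P \<in> polys_in (z ` {k..<k})" "mpoly_eval \<iota> (\<lambda>a. a) P \<in> Q k"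
      define c where "c = lookup P 0"
      have Pc: "P = mconst c" using polys_in_empty[of P] P(1) by (simp add: c_def)
      then have "\<iota> c \<in> Q k" using P(2) by simp
      \<comment> \<open>A nonzero constant of the field would be a unit inside the proper ideal
        \<open>Q k\<close>.\<close>
      then have "\<iota> (inverse c) * \<iota> c \<in> Q k" by (intro Qd(4)) (auto intro: adj_scal)
      moreover have "1 \<notin> Q k" using Q(1)[of k] by (simp add: prime_in_def)
      ultimately have "\<iota> (inverse c * c) \<noteq> 1" by (auto simp: hom_mult)
      then have "c = 0" using left_inverse[of c] hom_1 by metis
      then show "P = 0" using Pc by simp
    qed
  next
    case (step i)
    show ?case
    proof (intro ballI impI, rule ccontr)
      fix P :: "('a, 'f) mpoly"
      assume P: "P \<in> polys_in (z ` {i..<k})" "mpoly_eval \<iota> (\<lambda>a. a) P \<in> Q i" "P \<noteq> 0"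
      have "{i..<k} = insert i {Suc i..<k}" using step by auto
      then have "P \<in> polys_in (insert (z i) (z ` {Suc i..<k}))" using P(1) by simp
      then obtain c N where c: "\<And>j. c j \<in> polys_in (z ` {Suc i..<k})" "P = (\<Sum>j\<le>N. c j * mvar (z i) ^ j)"
        using mpoly_split_var by metis
      have ex: "\<exists>j\<le>N. c j \<noteq> 0" using P(3) c(2) by (auto intro: ccontr)
      \<comment> \<open>The lowest occurring power of \<open>z i\<close> can be cancelled because
        \<open>Q i\<close> is prime and omits \<open>z i\<close>; the remaining higher terms lie in
        \<open>Q (Suc i)\<close>.\<close>
      define l where "l = (LEAST j. j \<le> N \<and> c j \<noteq> 0)"
      have l: "l \<le> N" "c l \<noteq> 0" using LeastI_ex[OF ex] by (auto simp: l_def)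
      have lo: "c j = 0" if "j < l" for j
        using not_less_Least[of j "\<lambda>j. j \<le> N \<and> c j \<noteq> 0"] that l by (auto simp: l_def)
      interpret e: comm_ring_1_hom "mpoly_eval \<iota> (\<lambda>a. a)" by (rule mpoly_eval_hom)
      let ?e = "mpoly_eval \<iota> (\<lambda>a. a)"
      have eR: "?e (c j) \<in> ?R" for j
        by (rule mpoly_eval_in_adj[OF c(1)]) (use zR in auto)
      define r where "r = (\<Sum>j\<in>{Suc l..N}. ?e (c j) * z i ^ (j - Suc l))"
      have ziR: "z i \<in> ?R" using zR step by simp
      have rR: "r \<in> ?R" unfolding r_def by (intro adj_sum adj_mult adj_power eR ziR)
      have "?e P = (\<Sum>j\<le>N. ?e (c j) * z i ^ j)" unfolding c(2) by (simp add: e.hom_sum e.hom_mult e.hom_power)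
      also have "\<dots> = (\<Sum>j\<in>{l..N}. ?e (c j) * z i ^ j)"
        using lo by (intro sum.mono_neutral_right) (auto simp: not_le)
      also have "\<dots> = ?e (c l) * z i ^ l + (\<Sum>j\<in>{Suc l..N}. ?e (c j) * z i ^ j)"
        using l(1) by (simp add: sum.atLeast_Suc_atMost)
      also have "(\<Sum>j\<in>{Suc l..N}. ?e (c j) * z i ^ j) = z i ^ Suc l * r"
        unfolding r_def sum_distrib_left
      proof (rule sum.cong[OF refl])
        fix j assume "j \<in> {Suc l..N}"
        then have "z i ^ j = z i ^ Suc l * z i ^ (j - Suc l)" by (simp flip: power_add del: power_Suc)
        then show "?e (c j) * z i ^ j = z i ^ Suc l * (?e (c j) * z i ^ (j - Suc l))" by (simp only: ac_simps)
      qed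
      also have "?e (c l) * z i ^ l + z i ^ Suc l * r = z i ^ l * (?e (c l) + z i * r)"
        by (simp add: algebra_simps)
      finally have prod: "z i ^ l * (?e (c l) + z i * r) \<in> Q i" using P(2) by simp
      have ik: "i \<le> k" "Suc i \<le> k" using step by auto
      have inR: "?e (c l) + z i * r \<in> ?R" by (intro adj_add adj_mult eR ziR rR)
      have "x \<in> Q i" if "x \<in> ?R" "z i ^ n * x \<in> Q i" for x n
        using that(2)
      proof (induction n)
        case (Suc n)
        have "z i * (z i ^ n * x) \<in> Q i" using Suc.prems by (simp add: mult.assoc)
        moreover have "z i ^ n * x \<in> ?R" by (intro adj_mult adj_power ziR that(1))
        ultimately have "z i ^ n * x \<in> Q i"
          using Q(1)[OF ik(1)] z(2)[of i] ziR step by (auto simp: prime_in_def)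
        then show ?case by (rule Suc.IH)
      qed simp
      from this[OF inR prod] have "?e (c l) + z i * r \<in> Q i" .
      then have 1: "?e (c l) + z i * r \<in> Q (Suc i)" using mono[of i "Suc i"] ik by auto
      have "(\<iota> (- 1) * r) * z i \<in> Q (Suc i)"
        using z(1)[of i] step by (intro Qd(4)[OF ik(2)] adj_mult rR) (auto intro: adj_scal)
      from Qd(3)[OF ik(2) 1 this] have "?e (c l) \<in> Q (Suc i)" by (simp add: hom_uminus algebra_simps)
      with step.IH c(1) l(2) show False by blast
    qed
  qed
  have "algebraically_independent \<iota> (z ` {..<k})"
    using claim[of 0] Qd(2)[of 0] by (auto simp: algebraically_independent_iff atLeast0LessThan)
  moreover have "card (z ` {..<k}) = k" using inj by (simp add: card_image)
  ultimately show ?thesis using zR by (intro exI[of _ "z ` {..<k}"]) auto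
qed

abbreviation adj_ring :: "'a set \<Rightarrow> 'a ring" where
  "adj_ring Y \<equiv> ring_of_type_algebra \<lparr> carrier := adj \<iota> Y \<rparr>"

lemma cring_adj_ring: "cring (adj_ring Y)"
proof (rule cringI)
  show "abelian_group (adj_ring Y)"
  proof (rule abelian_groupI)
    fix x assume "x \<in> carrier (adj_ring Y)"
    then show "\<exists>y\<in>carrier (adj_ring Y). y \<oplus>\<^bsub>adj_ring Y\<^esub> x = \<zero>\<^bsub>adj_ring Y\<^esub>"
      by (intro bexI[of _ "- x"]) (auto simp: ring_of_type_algebra_def intro: adj_uminus)
  qed (auto simp: ring_of_type_algebra_def intro: adj_add)
  show "Group.comm_monoid (adj_ring Y)"
    by (rule Group.comm_monoidI) (auto simp: ring_of_type_algebra_def ac_simps intro: adj_mult)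
qed (auto simp: ring_of_type_algebra_def distrib_right)

lemma primeideal_adj_ring_iff: "primeideal Q (adj_ring Y) \<longleftrightarrow> prime_in (adj \<iota> Y) Q"
proof
  assume "primeideal Q (adj_ring Y)"
  then interpret primeideal Q "adj_ring Y" .
  have Qs: "Q \<subseteq> adj \<iota> Y" using a_subset by simp
  show "prime_in (adj \<iota> Y) Q"
    unfolding prime_in_def ideal_in_def
  proof (intro conjI ballI impI Qs)
    show "0 \<in> Q" using additive_subgroup.zero_closed[OF is_additive_subgroup] by (simp add: ring_of_type_algebra_def)
    show "x + y \<in> Q" if "x \<in> Q" "y \<in> Q" for x y
      using additive_subgroup.a_closed[OF is_additive_subgroup that] by (simp add: ring_of_type_algebra_def)
    show mul: "r * x \<in> Q" if "r \<in> adj \<iota> Y" "x \<in> Q" for r x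
      using I_l_closed[OF that(2)] that(1) by (simp add: ring_of_type_algebra_def)
    show "x \<in> Q \<or> y \<in> Q" if "x \<in> adj \<iota> Y" "y \<in> adj \<iota> Y" "x * y \<in> Q" for x y
      using I_prime[of x y] that by (simp add: ring_of_type_algebra_def)
    show "1 \<notin> Q"
    proof
      assume "1 \<in> Q"
      then have "adj \<iota> Y \<subseteq> Q" using mul[of _ 1] by auto
      then show False using I_notcarr Qs by auto
    qed
  qed
next
  assume p: "prime_in (adj \<iota> Y) Q"
  note Qd = ideal_inD[OF conjunct1[OF p[unfolded prime_in_def]]]
  interpret cring "adj_ring Y" by (rule cring_adj_ring)
  have neg: "\<ominus>\<^bsub>adj_ring Y\<^esub> x = - x" if "x \<in> adj \<iota> Y" for x
    by (rule minus_equality) (use that in \<open>auto simp: ring_of_type_algebra_def intro: adj_uminus\<close>)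
  show "primeideal Q (adj_ring Y)"
  proof (rule primeidealI)
    show "ideal Q (adj_ring Y)"
    proof (rule idealI[OF ring_axioms])
      show "subgroup Q (add_monoid (adj_ring Y))"
      proof (rule group.subgroupI[OF add.is_group])
        show "Q \<subseteq> carrier (add_monoid (adj_ring Y))" using Qd(1) by simp
        show "Q \<noteq> {}" using Qd(2) by auto
        show "inv\<^bsub>add_monoid (adj_ring Y)\<^esub> x \<in> Q" if "x \<in> Q" for x
        proof -
          have "\<iota> (- 1) * x \<in> Q" using that by (intro Qd(4)) (rule adj_scal)
          then have "- x \<in> Q" by (simp add: hom_uminus)
          then show ?thesis using neg[of x] that Qd(1) by (auto simp: a_inv_def)
        qed
        show "x \<otimes>\<^bsub>add_monoid (adj_ring Y)\<^esub> y \<in> Q" if "x \<in> Q" "y \<in> Q" for x y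
          using Qd(3)[OF that] by (simp add: ring_of_type_algebra_def)
      qed
      show "x \<otimes>\<^bsub>adj_ring Y\<^esub> a \<in> Q" "a \<otimes>\<^bsub>adj_ring Y\<^esub> x \<in> Q"
        if "a \<in> Q" "x \<in> carrier (adj_ring Y)" for a x
        using Qd(4)[of x a] that by (simp_all add: ring_of_type_algebra_def mult.commute[of a x])
    qed
    show "carrier (adj_ring Y) \<noteq> Q" using p by (auto simp: prime_in_def)
  qed (use p cring_adj_ring in \<open>auto simp: prime_in_def ring_of_type_algebra_def\<close>)
qed

text \<open>A chain gives as many independent elements as it has steps, and the count bounds them by
  \<open>card Z\<close>. Conversely a Noether normalization has at least \<open>card Z\<close>
  variables, by the same count with \<open>g = 1\<close>, and its coordinate chain lifts.\<close>

theorem krull_dim_adj_ring: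
  assumes Y: "finite Y" and Z: "Z \<subseteq> Y" "algebraically_independent \<iota> Z"
    and max: "\<And>y. y \<in> Y - Z \<Longrightarrow> \<not> algebraically_independent \<iota> (insert y Z)"
  shows "krull_dim (adj_ring Y) = enat (card Z)"
proof (rule antisym)
  show "krull_dim (adj_ring Y) \<le> enat (card Z)"
    unfolding krull_dim_def
  proof (rule Sup_least)
    fix e assume "e \<in> {enat k | k. \<exists>P. (\<forall>i\<le>k. primeideal (P i) (adj_ring Y)) \<and> (\<forall>i<k. P i \<subset> P (Suc i))}"
    then obtain k P where e: "e = enat k" and P: "\<And>i. i \<le> k \<Longrightarrow> prime_in (adj \<iota> Y) (P i)"
      "\<And>i. i < k \<Longrightarrow> P i \<subset> P (Suc i)" by (auto simp: primeideal_adj_ring_iff)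
    obtain U where "finite U" "card U = k" "U \<subseteq> adj \<iota> Y" "algebraically_independent \<iota> U"
      using prime_chain_independent[of k Y P, OF P] by blast
    with card_le_of_maximal_independent[OF Y Z max] show "e \<le> enat (card Z)" by (auto simp: e)
  qed
next
  obtain B W where BW: "finite B" "algebraically_independent \<iota> B" "B \<subseteq> adj \<iota> Y"
    "finite W" "1 \<in> W" "W \<subseteq> adj \<iota> Y" "adj \<iota> Y \<subseteq> mspan (adj \<iota> B) W"
    using noether_normalization[OF Y] by blast
  have "card Z \<le> card B"
  proof (rule card_le_of_localized_finite[OF BW(1) finite_subset[OF Z(1) Y] Z(2) _ BW(4,5), where g = 1 and Y = Y])
    show "Z \<subseteq> adj \<iota> Y" using Z(1) adj_gen by blast
    show "1 * y * w \<in> mspan (adj \<iota> B) W" if "y \<in> Y" "w \<in> W" for y w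
      using that BW(6,7) by (auto intro!: subsetD[OF BW(7)] adj_mult intro: adj_gen)
  qed auto
  also obtain Q where Q: "\<forall>i\<le>card B. prime_in (adj \<iota> Y) (Q i)" "\<forall>i<card B. Q i \<subset> Q (Suc i)"
    using ex_prime_chain[OF BW(2,1,3,4,6,7)] by blast
  then have "enat (card B) \<le> krull_dim (adj_ring Y)"
    unfolding krull_dim_def by (intro Sup_upper) (auto simp: primeideal_adj_ring_iff)
  finally show "enat (card Z) \<le> krull_dim (adj_ring Y)" by simp
qed

end

section \<open>The special fiber of an ideal generated by forms of the same degree\<close>

definition mdeg :: "('v \<Rightarrow>\<^sub>0 nat) \<Rightarrow> nat" where
  "mdeg m = (\<Sum>v\<in>keys m. lookup m v)"

lemma mdeg_superset:
  "finite S \<Longrightarrow> keys m \<subseteq> S \<Longrightarrow> mdeg m = (\<Sum>v\<in>S. lookup m v)"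
  unfolding mdeg_def by (intro sum.mono_neutral_left) (auto simp: in_keys_iff)

lemma mdeg_add: "mdeg (m + m') = mdeg m + mdeg m'"
proof -
  let ?S = "keys m \<union> keys m'"
  have "keys (m + m') \<subseteq> ?S" by (rule Poly_Mapping.keys_add)
  then show ?thesis by (simp add: mdeg_superset[of ?S] lookup_add sum.distrib)
qed

lemma mdeg_0 [simp]: "mdeg 0 = 0"
  by (simp add: mdeg_def)

lemma mdeg_single [simp]: "mdeg (single v k) = k"
  by (cases "k = 0") (simp_all add: mdeg_def)

lemma mdeg_eq_0_iff: "mdeg m = 0 \<longleftrightarrow> m = 0"
proof
  assume "mdeg m = 0"
  then have "\<forall>k\<in>keys m. lookup m k = 0" by (simp add: mdeg_def)
  then show "m = 0" by (intro poly_mapping_eqI) (metis in_keys_iff lookup_zero)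
qed simp

definition homog :: "nat \<Rightarrow> ('v, 'f::comm_ring_1) mpoly \<Rightarrow> bool" where
  "homog d p \<longleftrightarrow> (\<forall>m\<in>keys p. mdeg m = d)"

definition order_ge :: "nat \<Rightarrow> ('v, 'f::comm_ring_1) mpoly \<Rightarrow> bool" where
  "order_ge d p \<longleftrightarrow> (\<forall>m\<in>keys p. d \<le> mdeg m)"

definition hcomp :: "nat \<Rightarrow> ('v, 'f::comm_ring_1) mpoly \<Rightarrow> ('v, 'f) mpoly" where
  "hcomp d p = (\<Sum>m\<in>{m\<in>keys p. mdeg m = d}. single m (lookup p m))"

lemma lookup_hcomp:
  "lookup (hcomp d p) m = (if mdeg m = d then lookup p m else 0)"
  by (simp add: hcomp_def lookup_sum lookup_single when_def in_keys_iff)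

lemma hcomp_add: "hcomp d (p + q) = hcomp d p + hcomp d q"
  by (rule poly_mapping_eqI) (simp add: lookup_hcomp lookup_add)

lemma hcomp_0 [simp]: "hcomp d 0 = 0"
  by (rule poly_mapping_eqI) (simp add: lookup_hcomp)

lemma hcomp_sum: "hcomp d (sum f A) = (\<Sum>a\<in>A. hcomp d (f a))"
  by (induction A rule: infinite_finite_induct) (simp_all add: hcomp_add)

lemma hcomp_homog: "homog d p \<Longrightarrow> hcomp e p = (if d = e then p else 0)"
  by (rule poly_mapping_eqI) (auto simp: lookup_hcomp homog_def in_keys_iff)

lemma homog_hcomp: "homog d (hcomp d p)"
  by (auto simp: homog_def in_keys_iff lookup_hcomp split: if_splits)

lemma order_ge_0 [simp]: "order_ge 0 p"
  by (simp add: order_ge_def)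

lemma homog_imp_order_ge: "homog d p \<Longrightarrow> order_ge d p"
  by (simp add: order_ge_def homog_def)

lemma order_ge_add: "order_ge d p \<Longrightarrow> order_ge d q \<Longrightarrow> order_ge d (p + q)"
  using Poly_Mapping.keys_add[of p q] by (auto simp: order_ge_def)

lemma order_ge_mult: "order_ge d p \<Longrightarrow> order_ge e q \<Longrightarrow> order_ge (d + e) (p * q)"
  using Poly_Mapping.keys_mult[of p q] unfolding order_ge_def
  by (fastforce simp: mdeg_add intro: add_mono)

lemma homog_mult: "homog d p \<Longrightarrow> homog e q \<Longrightarrow> homog (d + e) (p * q)"
  using Poly_Mapping.keys_mult[of p q] unfolding homog_def
  by (auto simp: mdeg_add dest!: subsetD)

lemma order_ge_tail: "order_ge d p \<Longrightarrow> order_ge (Suc d) (p - hcomp d p)"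
  unfolding order_ge_def
proof
  fix m assume *: "\<forall>m\<in>keys p. d \<le> mdeg m" "m \<in> keys (p - hcomp d p)"
  then have "mdeg m \<noteq> d" "m \<in> keys p"
    by (auto simp: in_keys_iff lookup_minus lookup_hcomp split: if_splits)
  then show "Suc d \<le> mdeg m" using *(1) by (fastforce simp: Suc_le_eq)
qed

lemma hcomp_order_ge: "order_ge (Suc d) p \<Longrightarrow> hcomp d p = 0"
proof (rule poly_mapping_eqI)
  fix m assume "order_ge (Suc d) p"
  then have "mdeg m = d \<Longrightarrow> m \<notin> keys p" by (auto simp: order_ge_def)
  then show "lookup (hcomp d p) m = lookup 0 m"
    by (simp add: lookup_hcomp in_keys_iff)
qed

text \<open>All other products have degree above \<open>d + e\<close>. This is what makes passing to
  lowest forms multiplicative.\<close>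

lemma hcomp_mult:
  assumes "order_ge d p" "order_ge e q"
  shows "hcomp (d + e) (p * q) = hcomp d p * hcomp e q"
proof -
  let ?p = "p - hcomp d p" and ?q = "q - hcomp e q"
  have "p * q = hcomp d p * hcomp e q + (hcomp d p * ?q + ?p * q)"
    by (simp add: algebra_simps)
  moreover have "order_ge (Suc (d + e)) (hcomp d p * ?q)"
    using order_ge_mult[OF homog_imp_order_ge[OF homog_hcomp] order_ge_tail[OF assms(2)]] by simp
  moreover have "order_ge (Suc (d + e)) (?p * q)"
    using order_ge_mult[OF order_ge_tail[OF assms(1)] assms(2)] by simp
  ultimately have "hcomp (d + e) (p * q) = hcomp (d + e) (hcomp d p * hcomp e q)"
    by (simp add: hcomp_add hcomp_order_ge order_ge_add)
  then show ?thesis by (simp add: hcomp_homog[OF homog_mult[OF homog_hcomp homog_hcomp]])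
qed

lemma hcomp_zero_eq: "hcomp 0 p = mconst (lookup p 0)"
  by (rule poly_mapping_eqI) (simp add: lookup_hcomp mconst_def lookup_single when_def mdeg_eq_0_iff)

lemma homog_mvar: "homog 1 (mvar v)"
  by (simp add: homog_def mvar_def)

lemma homog_mconst: "homog 0 (mconst c)"
  by (simp add: homog_def mconst_def)

interpretation mdom: inj_idom_hom "mconst :: 'f::idom \<Rightarrow> ('v::linorder, 'f) mpoly"
  by standard simp

interpretation mfield: inj_field_hom "mconst :: 'f::field \<Rightarrow> ('v::linorder, 'f) mpoly"
  by standard

text \<open>Primes are pulled back along \<open>h\<close>; surjectivity keeps the inclusions of the
  pulled back chain strict.\<close>

lemma krull_dim_surj:
  assumes "cring R" "ring_hom_ring R S h" "h ` carrier R = carrier S"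
  shows "krull_dim S \<le> krull_dim R"
  unfolding krull_dim_def
proof (rule Sup_mono)
  fix e assume "e \<in> {enat k | k. \<exists>P. (\<forall>i\<le>k. primeideal (P i) S) \<and> (\<forall>i<k. P i \<subset> P (Suc i))}"
  then obtain k P where e: "e = enat k" and P: "\<And>i. i \<le> k \<Longrightarrow> primeideal (P i) S"
    "\<And>i. i < k \<Longrightarrow> P i \<subset> P (Suc i)" by auto
  define Q where "Q i = {r \<in> carrier R. h r \<in> P i}" for i
  have "primeideal (Q i) R" if "i \<le> k" for i
    unfolding Q_def by (rule ring_hom_ring.primeideal_vimage[OF assms(2,1) P(1)[OF that]])
  moreover have "Q i \<subset> Q (Suc i)" if i: "i < k" for i
  proof -
    obtain s where s: "s \<in> P (Suc i)" "s \<notin> P i" using P(2)[OF i] by blast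
    have "P (Suc i) \<subseteq> carrier S"
      using primeideal.axioms(1)[OF P(1)[of "Suc i"]] i ideal.Icarr by fastforce
    then have "s \<in> h ` carrier R" using s(1) assms(3) by blast
    then obtain r where "r \<in> carrier R" "s = h r" by blast
    then show ?thesis using s P(2)[OF i] by (auto simp: Q_def)
  qed
  ultimately show "\<exists>b\<in>{enat k | k. \<exists>P. (\<forall>i\<le>k. primeideal (P i) R) \<and> (\<forall>i<k. P i \<subset> P (Suc i))}. e \<le> b"
    using e by (intro bexI[of _ "enat k"]) auto
qed

lemma krull_dim_ring_iso:
  assumes "cring R" "cring S" "f \<in> ring_iso R S"
  shows "krull_dim R = krull_dim S"
proof (rule antisym)
  interpret R: cring R by fact
  interpret S: cring S by fact
  have inv: "inv_into (carrier R) f \<in> ring_iso S R"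
    by (rule ring_iso_set_sym[OF R.ring_axioms assms(3)])
  have hom: "ring_hom_ring A B g" if "ring A" "ring B" "g \<in> ring_iso A B" for A B g
    using that by (intro ring_hom_ringI2) (auto simp: ring_iso_def)
  show "krull_dim R \<le> krull_dim S"
    by (rule krull_dim_surj[OF assms(2) hom[OF S.ring_axioms R.ring_axioms inv]])
      (use inv in \<open>simp add: ring_iso_def bij_betw_def\<close>)
  show "krull_dim S \<le> krull_dim R"
    by (rule krull_dim_surj[OF assms(1) hom[OF R.ring_axioms S.ring_axioms assms(3)]])
      (use assms(3) in \<open>simp add: ring_iso_def bij_betw_def\<close>)
qed

section \<open>Generators of the powers of an ideal\<close>

primrec power_products :: "'a::comm_ring_1 set \<Rightarrow> nat \<Rightarrow> 'a set" where
  "power_products F 0 = {1}"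
| "power_products F (Suc k) = {x * f | x f. x \<in> power_products F k \<and> f \<in> F}"

lemma ideal_mspan_UNIV: "ideal (mspan UNIV W) (ring_of_type_algebra :: 'a::comm_ring_1 ring)"
proof -
  interpret ring "ring_of_type_algebra :: 'a ring" by (rule ring_from_type_algebra)
  have mult: "y * s \<in> mspan UNIV W" if "s \<in> mspan UNIV W" for y s :: 'a
    using that
  proof (rule mspan_bilinear)
    fix a w :: 'a assume "w \<in> W"
    then have "(y * a) * w \<in> mspan UNIV W" by (intro mspan_single) auto
    then show "y * (a * w) \<in> mspan UNIV W" by (simp add: mult.assoc)
  qed
  show ?thesis
  proof (rule idealI[OF ring_axioms])
    show "subgroup (mspan UNIV W) (add_monoid ring_of_type_algebra)"
    proof (rule group.subgroupI[OF add.is_group])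
      show "mspan UNIV W \<noteq> {}" using mspan_0 by blast
      show "inv\<^bsub>add_monoid ring_of_type_algebra\<^esub> x \<in> mspan UNIV W" if "x \<in> mspan UNIV W" for x :: 'a
      proof -
        have "\<ominus>\<^bsub>ring_of_type_algebra\<^esub> x = - x" by (rule minus_equality) auto
        then show ?thesis using mult[OF that, of "- 1"] by (simp add: a_inv_def)
      qed
    qed (auto intro: mspan_add)
    show "x \<otimes>\<^bsub>ring_of_type_algebra\<^esub> a \<in> mspan UNIV W" "a \<otimes>\<^bsub>ring_of_type_algebra\<^esub> x \<in> mspan UNIV W"
      if "a \<in> mspan UNIV W" for a x :: 'a
      using mult[OF that, of x] by (simp_all add: mult.commute[of a x])
  qed
qed

lemma genideal_subset_mspan: "Idl\<^bsub>ring_of_type_algebra\<^esub> F \<subseteq> mspan UNIV (F :: 'a::comm_ring_1 set)"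
  using mspan_single[of 1 UNIV _ F]
  by (intro ring.genideal_minimal[OF ring_from_type_algebra] ideal_mspan_UNIV) auto

lemma ideal_genideal_type: "ideal (Idl\<^bsub>ring_of_type_algebra\<^esub> F) (ring_of_type_algebra :: 'a::comm_ring_1 ring)"
  by (rule ring.genideal_ideal[OF ring_from_type_algebra]) simp

lemma genideal_type_self: "F \<subseteq> Idl\<^bsub>ring_of_type_algebra\<^esub> (F :: 'a::comm_ring_1 set)"
  by (rule ring.genideal_self[OF ring_from_type_algebra]) simp

lemma ideal_power_subset_mspan:
  "ideal_power (Idl\<^bsub>ring_of_type_algebra\<^esub> F) k \<subseteq> mspan UNIV (power_products (F :: 'a::comm_ring_1 set) k)"
proof (induction k)
  case 0
  show ?case using mspan_single[of _ UNIV 1 "{1}"] by (auto simp: ideal_power_0)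
next
  case (Suc k)
  let ?I = "Idl\<^bsub>ring_of_type_algebra\<^esub> F"
  show ?case
  proof
    fix a assume "a \<in> ideal_power ?I (Suc k)"
    then have "a \<in> ideal_power ?I k \<cdot>\<^bsub>ring_of_type_algebra\<^esub> ?I" by (simp add: ideal_power_Suc)
    then show "a \<in> mspan UNIV (power_products F (Suc k))"
    proof (induction rule: ideal_prod.induct)
      case (prod i j)
      have j: "j \<in> mspan UNIV F" using prod(2) genideal_subset_mspan by blast
      have i: "i \<in> mspan UNIV (power_products F k)" using prod(1) Suc.IH by blast
      from j have "i * j \<in> mspan UNIV (power_products F (Suc k))"
      proof (rule mspan_bilinear)
        fix c f assume f: "f \<in> F"
        from i have "(c * f) * i \<in> mspan UNIV (power_products F (Suc k))"
        proof (rule mspan_bilinear)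
          fix b x assume "x \<in> power_products F k"
          then have "(b * c) * (x * f) \<in> mspan UNIV (power_products F (Suc k))"
            using f by (intro mspan_single) auto
          then show "(c * f) * (b * x) \<in> mspan UNIV (power_products F (Suc k))" by (simp only: ac_simps)
        qed
        then show "i * (c * f) \<in> mspan UNIV (power_products F (Suc k))" by (simp only: ac_simps)
      qed
      then show ?case by simp
    next
      case (sum s t)
      then show ?case by (simp add: mspan_add)
    qed
  qed
qed

lemma power_products_subset_ideal_power:
  "power_products (F :: 'a::comm_ring_1 set) k \<subseteq> ideal_power (Idl\<^bsub>ring_of_type_algebra\<^esub> F) k"
proof (induction k)
  case 0
  show ?case by (simp add: ideal_power_0)
next
  case (Suc k)
  let ?I = "Idl\<^bsub>ring_of_type_algebra\<^esub> F"
  have "x * f \<in> ideal_power ?I k \<cdot>\<^bsub>ring_of_type_algebra\<^esub> ?I"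
    if "x \<in> power_products F k" "f \<in> F" for x f
    using ideal_prod.prod[of x "ideal_power ?I k" f ?I ring_of_type_algebra]
      that Suc genideal_type_self[of F] by auto
  then show ?case by (auto simp: ideal_power_Suc)
qed

lemma power_products_adj: "x \<in> power_products F k \<Longrightarrow> x \<in> adj mconst F"
  by (induction k arbitrary: x) (auto intro: adj_mult adj_gen)

lemma homog_power_products:
  assumes "\<And>f. f \<in> F \<Longrightarrow> homog \<delta> f"
  shows "x \<in> power_products F k \<Longrightarrow> homog (\<delta> * k) x"
proof (induction k arbitrary: x)
  case 0
  then show ?case using homog_mconst[of 1] by simp
next
  case (Suc k)
  then obtain y f where "y \<in> power_products F k" "f \<in> F" "x = y * f" by auto
  with Suc.IH assms show ?case using homog_mult[of "\<delta> * k" y \<delta> f] by (simp add: add.commute)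
qed

lemma mvar_irrelevant: "mvar v \<in> irrelevant_ideal"
  unfolding irrelevant_ideal_def by (rule subsetD[OF genideal_type_self]) simp

lemmas irrelevant_closed = ideal_type_zero[OF ideal_irrelevant_ideal]
  ideal_type_add[OF ideal_irrelevant_ideal] ideal_type_mult[OF ideal_irrelevant_ideal]

text \<open>Modulo the variables every polynomial is its constant term; for products this follows
  from telescoping.\<close>

lemma diff_const_irrelevant: "p - hcomp 0 p \<in> irrelevant_ideal"
proof (induction p rule: mpoly_induct)
  case (const c)
  show ?case using irrelevant_closed(1) by (simp add: hcomp_homog[OF homog_mconst])
next
  case (var v)
  show ?case using mvar_irrelevant by (simp add: hcomp_homog[OF homog_mvar])
next
  case (add p q)
  have "(p + q) - hcomp 0 (p + q) = (p - hcomp 0 p) + (q - hcomp 0 q)" by (simp add: hcomp_add)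
  then show ?case using irrelevant_closed(2)[OF add] by (simp only:)
next
  case (mult p q)
  have "p * q - hcomp 0 (p * q) = (p - hcomp 0 p) * q + (q - hcomp 0 q) * hcomp 0 p"
    using hcomp_mult[of 0 p 0 q] by (simp add: algebra_simps)
  then show ?case using irrelevant_closed(2)[OF irrelevant_closed(3)[OF mult(1)] irrelevant_closed(3)[OF mult(2)]] by (simp only:)
qed

lemma irrelevant_order_ge: "p \<in> irrelevant_ideal \<Longrightarrow> order_ge 1 p"
proof -
  assume "p \<in> irrelevant_ideal"
  then have "p \<in> mspan UNIV (range mvar)"
    using genideal_subset_mspan by (auto simp: irrelevant_ideal_def)
  then show ?thesis
  proof induction
    case (mspan_step a w s)
    then show ?case
      using order_ge_mult[of 0 a 1 w] homog_imp_order_ge[OF homog_mvar] by (force intro: order_ge_add)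
  qed (simp add: order_ge_def)
qed

section \<open>The special fiber as the algebra generated by the forms\<close>

context
  fixes F :: "('v::linorder, 'f::field) mpoly set" and \<delta> :: nat
  assumes homog: "\<And>f. f \<in> F \<Longrightarrow> homog \<delta> f" and \<delta>: "\<delta> > 0"
begin

abbreviation (input) gen_ideal :: "('v, 'f) mpoly set" where
  "gen_ideal \<equiv> Idl\<^bsub>ring_of_type_algebra\<^esub> F"

text \<open>An element of the \<open>k\<close>-th power is a sum of terms \<open>c * w\<close> with
  \<open>w\<close> a form of degree \<open>\<delta> * k\<close>. Its lowest component collects the
  terms \<open>c(0) * w\<close>, which lie in the algebra of the forms, and the rest
  \<open>(c - c(0)) * w\<close> lies in the irrelevant ideal times the power.\<close>

lemma ideal_power_forms:
  assumes "a \<in> ideal_power gen_ideal k"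
  shows "order_ge (\<delta> * k) a" "hcomp (\<delta> * k) a \<in> adj mconst F"
    "a - hcomp (\<delta> * k) a \<in> irrelevant_ideal \<cdot>\<^bsub>ring_of_type_algebra\<^esub> ideal_power gen_ideal k"
proof -
  let ?mI = "irrelevant_ideal \<cdot>\<^bsub>ring_of_type_algebra\<^esub> ideal_power gen_ideal k"
  have mI: "ideal ?mI (ring_of_type_algebra :: ('v, 'f) mpoly ring)"
    by (rule ring.ideal_prod_is_ideal[OF ring_from_type_algebra ideal_irrelevant_ideal
          ideal_ideal_power[OF ideal_genideal_type]])
  have "a \<in> mspan UNIV (power_products F k)" using assms ideal_power_subset_mspan by blast
  then have "order_ge (\<delta> * k) a \<and> hcomp (\<delta> * k) a \<in> adj mconst F \<and> a - hcomp (\<delta> * k) a \<in> ?mI"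
  proof induction
    case mspan_0
    then show ?case using ideal_type_zero[OF mI] by (simp add: order_ge_def)
  next
    case (mspan_step c w s)
    have w: "homog (\<delta> * k) w" by (rule homog_power_products[OF homog mspan_step(2)])
    have ge: "order_ge (\<delta> * k) (c * w)"
      using order_ge_mult[of 0 c, OF _ homog_imp_order_ge[OF w]] by simp
    have hc: "hcomp (\<delta> * k) (c * w) = hcomp 0 c * w"
      using hcomp_mult[of 0 c, OF _ homog_imp_order_ge[OF w]] hcomp_homog[OF w] by simp
    have "(c - hcomp 0 c) * w \<in> ?mI"
      using ideal_prod.prod[OF diff_const_irrelevant subsetD[OF power_products_subset_ideal_power mspan_step(2)],
          where R = ring_of_type_algebra] by simp
    then have "c * w - hcomp (\<delta> * k) (c * w) \<in> ?mI" by (simp add: hc left_diff_distrib)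
    from ideal_type_add[OF mI this, of "s - hcomp (\<delta> * k) s"] mspan_step
    have "(c * w + s) - hcomp (\<delta> * k) (c * w + s) \<in> ?mI" by (simp add: hcomp_add algebra_simps)
    moreover have "hcomp (\<delta> * k) (c * w + s) \<in> adj mconst F"
      using mspan_step power_products_adj[OF mspan_step(2)]
      by (auto simp: hcomp_add hc hcomp_zero_eq intro!: adj_add adj_mult adj_scal)
    ultimately show ?case using ge mspan_step order_ge_add by blast
  qed
  then show "order_ge (\<delta> * k) a" "hcomp (\<delta> * k) a \<in> adj mconst F" "a - hcomp (\<delta> * k) a \<in> ?mI" by auto
qed

lemma irrelevant_mult_order_ge:
  assumes "a \<in> irrelevant_ideal \<cdot>\<^bsub>ring_of_type_algebra\<^esub> ideal_power gen_ideal k"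
  shows "order_ge (Suc (\<delta> * k)) a"
  using assms
proof (induction rule: ideal_prod.induct)
  case (prod i j)
  then show ?case
    using order_ge_mult[OF irrelevant_order_ge ideal_power_forms(1), of i j k] by simp
qed (simp add: order_ge_add)

text \<open>The homomorphism onto the algebra generated by the forms keeps from each coefficient,
  which lies in \<open>I\<^sup>k\<close>, only its component of the lowest possible degree \<open>\<delta> k\<close>.\<close>

definition lowest_poly :: "('v, 'f) mpoly poly \<Rightarrow> ('v, 'f) mpoly poly" where
  "lowest_poly p = Abs_poly (\<lambda>k. hcomp (\<delta> * k) (poly.coeff p k))"

lemma coeff_lowest_poly: "poly.coeff (lowest_poly p) k = hcomp (\<delta> * k) (poly.coeff p k)"
  unfolding lowest_poly_def
  by (subst coeff_Abs_poly[where n = "Polynomial.degree p"]) (simp_all add: coeff_eq_0)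

text \<open>Evaluation at \<open>1\<close> forgets the grading of the Rees algebra. Nothing is lost,
  since the \<open>k\<close>-th coefficient is homogeneous of degree \<open>\<delta> * k\<close> and
  these degrees are distinct.\<close>

definition lowest_form :: "('v, 'f) mpoly poly \<Rightarrow> ('v, 'f) mpoly" where
  "lowest_form p = poly (lowest_poly p) 1"

lemma lowest_poly_add: "lowest_poly (p + q) = lowest_poly p + lowest_poly q"
  by (rule poly_eqI) (simp add: coeff_lowest_poly hcomp_add)

lemma lowest_poly_mult:
  assumes "p \<in> carrier (rees_algebra gen_ideal)" "q \<in> carrier (rees_algebra gen_ideal)"
  shows "lowest_poly (p * q) = lowest_poly p * lowest_poly q"
proof (rule poly_eqI)
  fix n
  have "hcomp (\<delta> * n) (poly.coeff p i * poly.coeff q (n - i)) =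
      hcomp (\<delta> * i) (poly.coeff p i) * hcomp (\<delta> * (n - i)) (poly.coeff q (n - i))" if "i \<le> n" for i
  proof -
    have "\<delta> * n = \<delta> * i + \<delta> * (n - i)" using that by (simp flip: distrib_left)
    then show ?thesis using assms by (simp only:) (auto intro!: hcomp_mult ideal_power_forms(1))
  qed
  then show "poly.coeff (lowest_poly (p * q)) n = poly.coeff (lowest_poly p * lowest_poly q) n"
    by (simp add: coeff_lowest_poly coeff_mult hcomp_sum)
qed

lemma lowest_form_closed:
  assumes "p \<in> carrier (rees_algebra gen_ideal)"
  shows "lowest_form p \<in> adj mconst F"
  unfolding lowest_form_def poly_altdef coeff_lowest_poly
  using assms by (auto intro!: mconst.adj_sum ideal_power_forms(2))

lemma cring_rees: "cring (rees_algebra gen_ideal)"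
  by (rule cring_rees_algebra[OF ideal_genideal_type])

lemma lowest_form_hom: "ring_hom_ring (rees_algebra gen_ideal) (mfield.adj_ring F) lowest_form"
proof (rule ring_hom_ringI2)
  show "ring (rees_algebra gen_ideal)" using cring_rees by (rule cring.axioms)
  show "ring (mfield.adj_ring F)" using mfield.cring_adj_ring by (rule cring.axioms)
  have one: "lowest_poly 1 = 1"
  proof (rule poly_eqI)
    fix k
    show "poly.coeff (lowest_poly 1) k = poly.coeff 1 k"
      using hcomp_homog[OF homog_mconst[of "1::'f"], of 0] by (cases "k = 0") (auto simp: coeff_lowest_poly)
  qed
  show "lowest_form \<in> ring_hom (rees_algebra gen_ideal) (mfield.adj_ring F)"
    by (rule ring_hom_memI)
      (simp_all add: lowest_form_closed lowest_form_def[symmetric] del: rees_algebra_sel(1),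
        simp_all add: lowest_form_def lowest_poly_mult lowest_poly_add one del: rees_algebra_sel(1))
qed

lemma lowest_form_surj: "lowest_form ` carrier (rees_algebra gen_ideal) = adj mconst F"
proof
  show "lowest_form ` carrier (rees_algebra gen_ideal) \<subseteq> adj mconst F"
    using lowest_form_closed by blast
  interpret h: ring_hom_ring "rees_algebra gen_ideal" "mfield.adj_ring F" lowest_form by (rule lowest_form_hom)
  let ?C = "carrier (rees_algebra gen_ideal)"
  have zero: "0 \<in> ideal_power gen_ideal k" for k
    by (rule ideal_type_zero[OF ideal_ideal_power[OF ideal_genideal_type]])
  show "adj mconst F \<subseteq> lowest_form ` ?C"
  proof
    fix x assume "x \<in> adj mconst F"
    then show "x \<in> lowest_form ` ?C"
    proof induction
      case (adj_scal c)
      have "[:mconst c:] \<in> ?C" using zero by (auto simp: coeff_pCons ideal_power_0 split: nat.splits)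
      moreover have "lowest_poly [:mconst c:] = [:mconst c:]"
        by (rule poly_eqI) (simp add: coeff_lowest_poly coeff_pCons hcomp_homog[OF homog_mconst] split: nat.splits)
      then have "mconst c = lowest_form [:mconst c:]" by (simp add: lowest_form_def)
      ultimately show ?case by (rule rev_image_eqI)
    next
      case (adj_gen f)
      have "f \<in> power_products F 1" using adj_gen by auto
      then have f1: "f \<in> ideal_power gen_ideal 1" using power_products_subset_ideal_power by blast
      have "monom f 1 \<in> ?C" using zero f1 by auto
      moreover have "lowest_poly (monom f 1) = monom f 1"
        by (rule poly_eqI) (simp add: coeff_lowest_poly hcomp_homog[OF homog[OF adj_gen]])
      then have "f = lowest_form (monom f 1)" by (simp add: lowest_form_def poly_monom)
      ultimately show ?case by (rule rev_image_eqI)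
    next
      case (adj_add x y)
      then obtain p q where "p \<in> ?C" "q \<in> ?C" "x = lowest_form p" "y = lowest_form q" by blast
      then have "x + y = lowest_form (p + q)" "p + q \<in> ?C"
        using h.hom_add[of p q] h.R.add.m_closed[of p q] by (simp_all del: rees_algebra_sel(1))
      then show ?case by blast
    next
      case (adj_mult x y)
      then obtain p q where "p \<in> ?C" "q \<in> ?C" "x = lowest_form p" "y = lowest_form q" by blast
      then have "x * y = lowest_form (p * q)" "p * q \<in> ?C"
        using h.hom_mult[of p q] h.R.m_closed[of p q] by (simp_all del: rees_algebra_sel(1))
      then show ?case by blast
    qed
  qed
qed

text \<open>Because \<open>\<delta> > 0\<close>, the summands sit in different degrees, so the sum
  vanishes only if each lowest component does; each coefficient then equals its own remainder, which
  lies in the irrelevant extension.\<close>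

lemma lowest_form_kernel:
  "a_kernel (rees_algebra gen_ideal) (mfield.adj_ring F) lowest_form = irrelevant_extension gen_ideal"
proof -
  have "lowest_form p = 0 \<longleftrightarrow> p \<in> irrelevant_extension gen_ideal" if p: "p \<in> carrier (rees_algebra gen_ideal)" for p
  proof
    assume "lowest_form p = 0"
    then have s: "(\<Sum>k\<le>Polynomial.degree (lowest_poly p). hcomp (\<delta> * k) (poly.coeff p k)) = 0"
      by (simp add: lowest_form_def poly_altdef coeff_lowest_poly)
    have z: "hcomp (\<delta> * k) (poly.coeff p k) = 0" for k
    proof (cases "k \<le> Polynomial.degree (lowest_poly p)")
      case True
      have "hcomp (\<delta> * k) (hcomp (\<delta> * j) q) = (if j = k then hcomp (\<delta> * j) q else 0)"
        for j and q :: "('v, 'f) mpoly"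
        using hcomp_homog[OF homog_hcomp[of "\<delta> * j" q], of "\<delta> * k"] \<delta> by auto
      then have "hcomp (\<delta> * k) (\<Sum>j\<le>Polynomial.degree (lowest_poly p). hcomp (\<delta> * j) (poly.coeff p j)) =
          hcomp (\<delta> * k) (poly.coeff p k)"
        using True by (simp add: hcomp_sum)
      then show ?thesis using s by simp
    next
      case False
      then show ?thesis using coeff_eq_0[of "lowest_poly p" k] by (simp add: coeff_lowest_poly)
    qed
    show "p \<in> irrelevant_extension gen_ideal"
      unfolding irrelevant_extension_def
      using ideal_power_forms(3)[of "poly.coeff p k" k for k] p by (auto simp: z)
  next
    assume "p \<in> irrelevant_extension gen_ideal"
    then have "hcomp (\<delta> * k) (poly.coeff p k) = 0" for k
      by (intro hcomp_order_ge irrelevant_mult_order_ge) (simp add: irrelevant_extension_def)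
    then show "lowest_form p = 0" by (simp add: lowest_form_def poly_altdef coeff_lowest_poly)
  qed
  moreover have "irrelevant_extension gen_ideal \<subseteq> carrier (rees_algebra gen_ideal)"
    using ideal.Icarr[OF ideal_irrelevant_extension[OF ideal_genideal_type]] by blast
  ultimately show ?thesis by (auto simp: a_kernel_def' simp del: rees_algebra_sel(1))
qed

theorem krull_dim_special_fiber:
  "krull_dim (special_fiber gen_ideal) = krull_dim (mfield.adj_ring F)"
proof -
  have "(\<lambda>C. the_elem (lowest_form ` C)) \<in> ring_iso (special_fiber gen_ideal) (mfield.adj_ring F)"
    using ring_hom_ring.FactRing_iso_set[OF lowest_form_hom] lowest_form_surj
    by (simp add: lowest_form_kernel special_fiber_def)
  then show ?thesis
    by (rule krull_dim_ring_iso[OF cring_special_fiber[OF ideal_genideal_type] mfield.cring_adj_ring])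
qed

end

section \<open>The Jacobian criterion\<close>

definition mderiv :: "'v \<Rightarrow> ('v, 'f::comm_ring_1) mpoly \<Rightarrow> ('v, 'f) mpoly" where
  "mderiv v P = (\<Sum>m\<in>keys P.
    single (m - single v 1) (of_nat (lookup m v) * lookup P m))"

lemma mderiv_superset:
  assumes "finite S" "keys P \<subseteq> S"
  shows "mderiv v P = (\<Sum>m\<in>S. single (m - single v 1)
    (of_nat (lookup m v) * lookup P m))"
  unfolding mderiv_def using assms by (intro sum.mono_neutral_left) (auto simp: in_keys_iff)

lemma mderiv_add: "mderiv v (P + Q) = mderiv v P + mderiv v Q"
proof -
  let ?S = "keys P \<union> keys Q"
  have "keys (P + Q) \<subseteq> ?S" by (rule Poly_Mapping.keys_add)
  then show ?thesis
    by (simp add: mderiv_superset[of ?S] lookup_add distrib_left single_add sum.distrib)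
qed

lemma mderiv_0 [simp]: "mderiv v 0 = 0"
  by (simp add: mderiv_def)

lemma mderiv_single: "mderiv v (single m c) =
    single (m - single v 1) (of_nat (lookup m v) * c)"
  by (cases "c = 0") (simp_all add: mderiv_def)

lemma mderiv_mconst [simp]: "mderiv v (mconst c) = 0"
  by (simp add: mconst_def mderiv_single)

lemma mderiv_mvar: "mderiv v (mvar w) = (if v = w then 1 else 0)"
  by (simp add: mvar_def mderiv_single lookup_single when_def)

lemma mderiv_mult: "mderiv v (P * Q) = mderiv v P * Q + P * mderiv v Q"
proof (induction P rule: poly_mapping_single_induct)
  case (single m c)
  show ?case
  proof (induction Q rule: poly_mapping_single_induct)
    case (single m' c')
    let ?e = "single v (1::nat)"
    have 1: "m - ?e + m' = m + m' - ?e" if "lookup m v > 0"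
      using that by (intro poly_mapping_eqI) (auto simp: lookup_add lookup_minus lookup_single when_def)
    have 2: "m + (m' - ?e) = m + m' - ?e" if "lookup m' v > 0"
      using that by (intro poly_mapping_eqI) (auto simp: lookup_add lookup_minus lookup_single when_def)
    show ?case
      using 1 2
      by (cases "lookup m v = 0"; cases "lookup m' v = 0")
        (simp_all add: mult_single mderiv_single lookup_add algebra_simps flip: single_add)
  qed (simp_all add: distrib_left mderiv_add)
qed (simp_all add: distrib_right mderiv_add)

lemma mderiv_uminus: "mderiv v (- P) = - mderiv v P"
  using mderiv_add[of v P "- P"] by (simp add: eq_neg_iff_add_eq_0 add.commute)

lemma mderiv_diff: "mderiv v (P - Q) = mderiv v P - mderiv v Q"
  using mderiv_add[of v P "- Q"] by (simp add: mderiv_uminus)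

lemma lookup_mderiv:
  "lookup (mderiv v P) m =
    of_nat (Suc (lookup m v)) * lookup P (m + single v 1)"
proof (induction P rule: poly_mapping_single_induct)
  case (single m' c)
  let ?e = "single v (1::nat)"
  have "m' = m + ?e" if "m' - ?e = m" "lookup m' v \<noteq> 0"
    using that by (intro poly_mapping_eqI) (auto simp: lookup_add lookup_minus lookup_single when_def)
  then have "m' - ?e \<noteq> m" if "m' \<noteq> m + ?e" "lookup m' v \<noteq> 0" using that by blast
  moreover have "m + ?e - ?e = m" "lookup (m + ?e) v = Suc (lookup m v)"
    by (simp_all add: lookup_add)
  ultimately show ?case
    by (cases "m' = m + ?e"; cases "lookup m' v = 0")
      (simp_all add: mderiv_single lookup_single when_def)
qed (simp_all add: mderiv_add lookup_add algebra_simps)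

lemma polys_in_mderiv:
  assumes "P \<in> polys_in A"
  shows "mderiv v P \<in> polys_in A"
  unfolding polys_in_def mem_Collect_eq
proof
  fix m assume "m \<in> keys (mderiv v P)"
  then have "m + single v 1 \<in> keys P"
    by (auto simp: in_keys_iff lookup_mderiv)
  moreover have "keys m \<subseteq> keys (m + single v 1)"
    by (auto simp: in_keys_iff lookup_add)
  ultimately show "keys m \<subseteq> A" using assms by (auto simp: polys_in_def)
qed

text \<open>Both sides are derivations in \<open>P\<close> along the evaluation, so it suffices to
  compare them on constants and on the variables in \<open>A\<close>.\<close>

lemma chain_rule:
  fixes P :: "('a, 'f::comm_ring_1) mpoly" and g :: "'a \<Rightarrow> ('v, 'f) mpoly"
  assumes "P \<in> polys_in A" "finite A"
  shows "mderiv c (mpoly_eval mconst g P) = (\<Sum>a\<in>A. mpoly_eval mconst g (mderiv a P) * mderiv c (g a))"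
proof -
  interpret e: comm_ring_1_hom "mpoly_eval mconst g :: ('a, 'f) mpoly \<Rightarrow> _" by (rule mconst.mpoly_eval_hom)
  have "mpoly_eval mconst mvar P \<in> adj mconst (mvar ` A)"
    by (rule mconst.mpoly_eval_in_adj[OF assms(1)]) (auto intro: adj_gen)
  then have "P \<in> adj mconst (mvar ` A)" by simp
  then show ?thesis
  proof induction
    case (adj_scal b)
    show ?case by simp
  next
    case (adj_gen p)
    then obtain b where b: "b \<in> A" "p = mvar b" by blast
    have "(\<Sum>a\<in>A. mpoly_eval mconst g (mderiv a p) * mderiv c (g a)) =
        (\<Sum>a\<in>A. if a = b then mderiv c (g a) else 0)"
      by (intro sum.cong) (auto simp: b mderiv_mvar)
    then show ?case using b assms(2) by simp
  next
    case (adj_add p q)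
    then show ?case by (simp add: e.hom_add mderiv_add distrib_right sum.distrib)
  next
    case (adj_mult p q)
    then show ?case
      by (simp add: e.hom_mult e.hom_add mderiv_mult distrib_right distrib_left sum.distrib
          sum_distrib_left sum_distrib_right ac_simps)
  qed
qed

text \<open>For \<open>k = p\<close> in characteristic \<open>p\<close> this agrees with the
  Frobenius map on polynomials over the prime field, but it is linear over all of the base
  ring.\<close>

definition stretch :: "nat \<Rightarrow> ('v, 'f::comm_ring_1) mpoly \<Rightarrow> ('v, 'f) mpoly" where
  "stretch k = mpoly_eval mconst (\<lambda>v. mvar v ^ k)"

lemma lookup_map_times: "lookup (Poly_Mapping.map ((*) k) m) v = k * lookup m v"
  for k :: nat
  by (simp add: map.rep_eq when_def)

lemma stretch_single:
  "stretch k (single m c) = single (Poly_Mapping.map ((*) k) m) c"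
proof -
  have "monom_val (\<lambda>v. mvar v ^ k) m = single (Poly_Mapping.map ((*) k) m) (1::'b)"
  proof (induction m rule: poly_mapping_single_induct)
    case zero
    have "Poly_Mapping.map ((*) k) (0 :: 'a \<Rightarrow>\<^sub>0 nat) = 0"
      by (rule poly_mapping_eqI) (simp add: lookup_map_times)
    then show ?case by simp
  next
    case (single v j)
    have "Poly_Mapping.map ((*) k) (single v j) = single v (k * j)"
      by (rule poly_mapping_eqI) (simp add: lookup_map_times lookup_single when_def)
    moreover have "(mvar v ^ k) ^ j = single (single v (k * j)) (1::'b)"
      using mvar_power[of v "k * j"] by (simp only: power_mult)
    ultimately show ?case by simp
  next
    case (add m m')
    have "Poly_Mapping.map ((*) k) (m + m') = Poly_Mapping.map ((*) k) m + Poly_Mapping.map ((*) k) m'"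
      by (rule poly_mapping_eqI) (simp add: lookup_map_times lookup_add distrib_left)
    then show ?case by (simp add: monom_val_add add mult_single)
  qed
  then show ?thesis by (simp add: stretch_def mconst.mpoly_eval_single mconst_mult_single)
qed

lemma stretch_add: "stretch k (P + Q) = stretch k P + stretch k Q"
  by (simp add: stretch_def mconst.mpoly_eval_add)

lemma lookup_stretch:
  assumes "k > 0"
  shows "lookup (stretch k P) (Poly_Mapping.map ((*) k) m) = lookup P m"
proof (induction P rule: poly_mapping_single_induct)
  case (single m' c)
  have "Poly_Mapping.map ((*) k) m' = Poly_Mapping.map ((*) k) m \<longleftrightarrow> m' = m"
    using assms by (auto simp: poly_mapping_eq_iff fun_eq_iff lookup_map_times)
  then show ?case by (simp add: stretch_single lookup_single when_def)
qed (simp_all add: stretch_add lookup_add, simp add: stretch_def)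

lemma stretch_eq_0_iff: "k > 0 \<Longrightarrow> stretch k P = 0 \<longleftrightarrow> P = 0"
  by (metis lookup_stretch lookup_zero poly_mapping_eqI stretch_def mconst.mpoly_eval_0)

lemma ex_stretch:
  assumes "\<And>m v. m \<in> keys P \<Longrightarrow> k dvd lookup m v" "k > 0"
  obtains Q where "P = stretch k Q" "\<And>m'. m' \<in> keys Q \<Longrightarrow> Poly_Mapping.map ((*) k) m' \<in> keys P"
proof
  define r where "r m = Poly_Mapping.map (\<lambda>j. j div k) m" for m :: "'a \<Rightarrow>\<^sub>0 nat"
  define Q where "Q = (\<Sum>m\<in>keys P. single (r m) (lookup P m))"
  have r: "Poly_Mapping.map ((*) k) (r m) = m" if "m \<in> keys P" for m
  proof (rule poly_mapping_eqI)
    fix v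
    have "lookup (r m) v = lookup m v div k"
      by (simp add: r_def map.rep_eq when_def)
    then show "lookup (Poly_Mapping.map ((*) k) (r m)) v = lookup m v"
      using assms(1)[OF that, of v] by (simp add: lookup_map_times)
  qed
  interpret s: comm_ring_1_hom "stretch k :: ('a, 'b) mpoly \<Rightarrow> _" unfolding stretch_def by (rule mconst.mpoly_eval_hom)
  have "stretch k Q = (\<Sum>m\<in>keys P. single m (lookup P m))"
    unfolding Q_def s.hom_sum by (intro sum.cong) (simp_all add: stretch_single r)
  then show eq: "P = stretch k Q" using mpoly_eq_sum_single[of P] by simp
  show "Poly_Mapping.map ((*) k) m' \<in> keys P" if "m' \<in> keys Q" for m'
    using that assms(2) by (simp add: in_keys_iff eq lookup_stretch)
qed

lemma CHAR_mpoly: "CHAR(('v, 'f::comm_ring_1) mpoly) = CHAR('f)"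
proof (rule CHAR_eqI)
  have of_nat: "(of_nat n :: ('v, 'f) mpoly) = mconst (of_nat n)" for n
    using mconst.hom_of_int[of "int n", symmetric] by simp
  show "(of_nat CHAR('f) :: ('v, 'f) mpoly) = 0" by (simp add: of_nat)
  show "CHAR('f) dvd n" if "(of_nat n :: ('v, 'f) mpoly) = 0" for n
    using that by (simp add: of_nat of_nat_eq_0_iff_char_dvd)
qed

text \<open>In characteristic \<open>p\<close> a relation \<open>P\<close> of minimal degree is a polynomial \<open>Q\<close> in the \<open>p\<close>-th
  powers of the variables; since the coefficients of the forms lie in the prime field, this gives
  \<open>Q(f)(x\<^sup>p) = Q(f\<^sup>p) = P(f) = 0\<close>, and \<open>Q\<close> is a relation of smaller degree.\<close>

theorem jacobian_imp_algebraically_independent: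
  fixes G :: "('v::linorder, 'f::field) mpoly set"
  assumes G: "finite G"
    and jac: "\<And>u. (\<And>c. (\<Sum>a\<in>G. u a * mderiv c a) = 0) \<Longrightarrow> \<forall>a\<in>G. u a = 0"
    and frob: "\<And>a. CHAR('f) > 0 \<Longrightarrow> a \<in> G \<Longrightarrow> stretch CHAR('f) a = a ^ CHAR('f)"
  shows "algebraically_independent mconst G"
proof -
  let ?e = "mpoly_eval mconst (\<lambda>a. a) :: (('v, 'f) mpoly, 'f) mpoly \<Rightarrow> _"
  have "P = 0" if "P \<in> polys_in G" "?e P = 0" "\<And>m. m \<in> keys P \<Longrightarrow> mdeg m \<le> D" for P D
    using that
  proof (induction D arbitrary: P rule: less_induct)
    case (less D)
    have const: "P = 0" if "keys P \<subseteq> {0}"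
    proof -
      have "P = mconst (lookup P 0)" using that by (intro polys_in_empty) (auto simp: polys_in_def)
      moreover from this less.prems(2) have "mconst (lookup P 0) = (0 :: ('v, 'f) mpoly)"
        by (metis mconst.mpoly_eval_mconst)
      ultimately show ?thesis by simp
    qed
    show ?case
    proof (cases "D = 0")
      case True
      then show ?thesis using less.prems(3) by (intro const) (auto simp: mdeg_eq_0_iff)
    next
      case False
      \<comment> \<open>Differentiating the relation gives a linear relation between the gradients.
        By their independence every partial derivative of \<open>P\<close> is again a relation, of
        smaller degree, hence zero.\<close>
      have "(\<Sum>a\<in>G. ?e (mderiv a P) * mderiv c a) = 0" for c
        using chain_rule[OF less.prems(1) G, of c "\<lambda>a. a"] less.prems(2) by simp
      from jac[OF this] have "\<forall>a\<in>G. ?e (mderiv a P) = 0" .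
      moreover have "mdeg m \<le> D - 1" if "m \<in> keys (mderiv a P)" for m a
      proof -
        from that have "m + single a 1 \<in> keys P"
          by (auto simp: in_keys_iff lookup_mderiv)
        from less.prems(3)[OF this] show ?thesis by (simp add: mdeg_add)
      qed
      ultimately have dz: "mderiv a P = 0" if "a \<in> G" for a
        using less.IH[of "D - 1" "mderiv a P"] False that polys_in_mderiv[OF less.prems(1)] by auto
      have z: "(of_nat (lookup m a) :: 'f) = 0" if m: "m \<in> keys P" for m a
      proof (cases "lookup m a = 0")
        case False
        then have "a \<in> keys m" by (simp add: in_keys_iff)
        then have "a \<in> G" using m less.prems(1) by (auto simp: polys_in_def)
        define m' where "m' = m - single a 1"
        have m': "m' + single a 1 = m"
          using False by (intro poly_mapping_eqI) (auto simp: m'_def lookup_add lookup_minus lookup_single when_def)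
        have "Suc (lookup m' a) = lookup m a"
          using arg_cong[OF m', of "\<lambda>m. lookup m a"] by (simp add: lookup_add)
        then have "of_nat (lookup m a) * lookup P m = 0"
          using lookup_mderiv[of a P m', unfolded m'] dz[OF \<open>a \<in> G\<close>] by (simp del: of_nat_Suc)
        then show ?thesis using m by (simp add: in_keys_iff)
      qed simp
      show ?thesis
      proof (cases "CHAR('f) = 0")
        case True
        have "m = 0" if "m \<in> keys P" for m
          using z[OF that] True by (intro poly_mapping_eqI) (simp add: of_nat_eq_0_iff_char_dvd)
        then show ?thesis by (intro const) auto
      next
        case False
        let ?p = "CHAR('f)"
        have p: "prime ?p" using False by (intro prime_CHAR_semidom) simp
        then have p2: "?p \<ge> 2" by (rule prime_ge_2_nat)
        have "?p dvd lookup m a" if "m \<in> keys P" for m a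
          using z[OF that] by (simp add: of_nat_eq_0_iff_char_dvd)
        then obtain Q where Q: "P = stretch ?p Q"
          "\<And>m. m \<in> keys Q \<Longrightarrow> Poly_Mapping.map ((*) ?p) m \<in> keys P"
          using ex_stretch[of P ?p] p2 by auto
        have km: "keys (Poly_Mapping.map ((*) ?p) m) = keys m" for m :: "('v, 'f) mpoly \<Rightarrow>\<^sub>0 nat"
          using p2 by (auto simp: in_keys_iff lookup_map_times)
        have QG: "Q \<in> polys_in G" using less.prems(1) Q(2) km by (fastforce simp: polys_in_def)
        have "mdeg m < D" if "m \<in> keys Q" for m
        proof -
          have "?p * mdeg m = mdeg (Poly_Mapping.map ((*) ?p) m)"
            unfolding mdeg_def km by (simp add: lookup_map_times sum_distrib_left)
          also have "\<dots> \<le> D" using less.prems(3)[OF Q(2)[OF that]] .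
          \<comment> \<open>Taking \<open>p\<close>-th roots of the monomials at least halves the
            degree, which is a strict decrease because \<open>D\<close> is positive.\<close>
          finally have "2 * mdeg m \<le> D" using p2 by (meson le_trans mult_le_mono1)
          then show ?thesis using \<open>D \<noteq> 0\<close> by linarith
        qed
        then have Qdeg: "mdeg m \<le> D - 1" if "m \<in> keys Q" for m using that by fastforce
        have "stretch ?p (?e Q) = mpoly_eval mconst (\<lambda>a. stretch ?p a) Q"
          unfolding stretch_def by (subst mconst.hom_mpoly_eval[OF mconst.mpoly_eval_hom]) simp
        also have "\<dots> = mpoly_eval mconst (\<lambda>a. a ^ ?p) Q"
          using frob p2 QG by (intro mpoly_eval_cong) (auto simp: polys_in_def)
        also have "\<dots> = ?e (stretch ?p Q)"
        proof -
          interpret e: comm_ring_1_hom ?e by (rule mconst.mpoly_eval_hom)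
          show ?thesis
            unfolding stretch_def by (subst mconst.hom_mpoly_eval[OF mconst.mpoly_eval_hom]) (simp add: e.hom_power)
        qed
        also have "\<dots> = 0" using less.prems(2) Q(1) by simp
        finally have "?e Q = 0" using stretch_eq_0_iff[of ?p] p2 by auto
        with less.IH[of "D - 1" Q] QG Qdeg \<open>D \<noteq> 0\<close> have "Q = 0" by auto
        then show ?thesis using Q(1) p2 stretch_eq_0_iff[of ?p Q] by auto
      qed
    qed
  qed
  note claim = this
  show ?thesis
    unfolding algebraically_independent_iff
  proof (intro ballI impI)
    fix P :: "(('v, 'f) mpoly, 'f) mpoly" assume P: "P \<in> polys_in G" "?e P = 0"
    show "P = 0"
      by (rule claim[OF P, of "Max (mdeg ` keys P)"]) simp
  qed
qed


section \<open>The rows of the hyperconnectivity matrix as gradients\<close>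

text \<open>The edge binomial over an arbitrary commutative ring, so that it can also be formed over
  the integers.\<close>

definition binomial_form :: "'n::linorder set \<Rightarrow> ('n coord, 'f::comm_ring_1) mpoly" where
  "binomial_form e = mvar (CX (Min e)) * mvar (CY (Max e)) - mvar (CX (Max e)) * mvar (CY (Min e))"

lemma edge_binomial_eq: "edge_binomial e = binomial_form e"
  by (simp add: edge_binomial_def binomial_form_def Let_def)

lemma mderiv_binomial_form_CX:
  assumes "Min e \<noteq> Max e"
  shows "mderiv (CX k) (binomial_form e) =
    (if k = Min e then mvar (CY (Max e)) else if k = Max e then - mvar (CY (Min e)) else 0)"
  using assms by (simp add: binomial_form_def mderiv_diff mderiv_mult mderiv_mvar)

lemma mderiv_binomial_form_CY:
  assumes "Min e \<noteq> Max e"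
  shows "mderiv (CY k) (binomial_form e) =
    (if k = Max e then mvar (CX (Min e)) else if k = Min e then - mvar (CX (Max e)) else 0)"
  using assms by (simp add: binomial_form_def mderiv_diff mderiv_mult mderiv_mvar)

lemma Min_ne_Max:
  assumes "card e = 2"
  shows "Min e \<noteq> (Max e :: 'n::linorder)" "e = {Min e, Max e}"
proof -
  obtain a b where ab: "e = {a, b}" "a \<noteq> b" using assms by (auto simp: card_2_iff)
  show "Min e \<noteq> Max e" "e = {Min e, Max e}" using ab(2) by (auto simp: ab(1) min_def max_def)
qed

lemma stretch_binomial_form:
  assumes "prime CHAR('f::field)"
  shows "stretch CHAR('f) (binomial_form e :: ('n::linorder coord, 'f) mpoly) = binomial_form e ^ CHAR('f)"
proof -
  let ?p = "CHAR('f)"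
  let ?a = "mvar (CX (Min e)) * mvar (CY (Max e)) :: ('n coord, 'f) mpoly"
  let ?b = "mvar (CX (Max e)) * mvar (CY (Min e)) :: ('n coord, 'f) mpoly"
  interpret s: comm_ring_1_hom "stretch ?p :: ('n coord, 'f) mpoly \<Rightarrow> _" unfolding stretch_def by (rule mconst.mpoly_eval_hom)
  \<comment> \<open>Adding \<open>?b\<close> back applies the Frobenius identity to a sum and avoids
    a discussion of the sign \<open>(- 1) ^ p\<close>.\<close>
  have "((?a - ?b) + ?b) ^ ?p = (?a - ?b) ^ ?p + ?b ^ ?p"
    by (rule freshmans_dream) (simp_all add: CHAR_mpoly assms)
  then have "?a ^ ?p - ?b ^ ?p = (?a - ?b) ^ ?p" by simp
  moreover have "stretch ?p (mvar c) = (mvar c ^ ?p :: ('n coord, 'f) mpoly)" for c by (simp add: stretch_def)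
  ultimately show ?thesis
    by (simp add: binomial_form_def s.hom_diff s.hom_mult power_mult_distrib)
qed

section \<open>Clearing denominators\<close>

lemma Fract_hom: "comm_ring_1_hom (\<lambda>x :: 'a::idom. Fract x 1)"
  by standard (simp_all add: One_fract_def)

lemma Fract_1_eq_0_iff [simp]: "Fract x 1 = 0 \<longleftrightarrow> x = 0"
  by (simp add: Zero_fract_def eq_fract)

interpretation Fract: comm_ring_1_hom "\<lambda>x :: 'a::idom. Fract x 1"
  by (rule Fract_hom)

text \<open>Turns a linear relation over the field of rational functions into one with polynomial
  coefficients.\<close>

lemma common_denominator:
  fixes w :: "'i \<Rightarrow> 'a::idom fract"
  assumes "finite I"
  shows "\<exists>d v. d \<noteq> 0 \<and> (\<forall>i\<in>I. Fract d 1 * w i = Fract (v i) 1)"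
  using assms
proof (induction I rule: finite_induct)
  case empty
  show ?case by (intro exI[of _ 1]) auto
next
  case (insert i I)
  then obtain d v where dv: "d \<noteq> 0" "\<forall>i\<in>I. Fract d 1 * w i = Fract (v i) 1" by blast
  obtain a b where ab: "w i = Fract a b" "b \<noteq> 0" by (cases "w i") auto
  have "Fract (b * d) 1 * w j = Fract ((if j = i then d * a else b * v j)) 1" if "j \<in> insert i I" for j
  proof (cases "j = i")
    case True
    then show ?thesis using ab by (simp add: eq_fract)
  next
    case False
    then have "Fract d 1 * w j = Fract (v j) 1" using dv that by blast
    then have "Fract b 1 * (Fract d 1 * w j) = Fract b 1 * Fract (v j) 1" by simp
    then show ?thesis using False by (simp flip: mult.assoc)
  qed
  then show ?case using dv ab by (intro exI[of _ "b * d"] exI[of _ "\<lambda>j. if j = i then d * a else b * v j"]) auto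
qed

fun dual_coord :: "'n coord \<Rightarrow> 'n coord" where
  "dual_coord (CX k) = CY k"
| "dual_coord (CY k) = CX k"

lemma dual_coord_dual [simp]: "dual_coord (dual_coord c) = c"
  by (cases c) auto

text \<open>Together with \<open>dual_coord\<close> this is the standard symplectic rotation
  exchanging \<open>x_k\<close> and \<open>y_k\<close>: the derivative of the form by
  \<open>y_i\<close> is \<open>- x_j\<close>, its derivative by \<open>x_i\<close> is
  \<open>y_j\<close>.\<close>

definition coord_sign :: "'n coord \<Rightarrow> 'a::comm_ring_1" where
  "coord_sign c = (case c of CX _ \<Rightarrow> - 1 | CY _ \<Rightarrow> 1)"

lemma coord_sign_sq [simp]: "coord_sign c * coord_sign c = 1"
  by (cases c) (auto simp: coord_sign_def)

lemma hyperconn_row_mderiv: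
  fixes e :: "'n::{finite,linorder} set"
  assumes "card e = 2"
  shows "hyperconn_row e $ c =
    Fract (coord_sign c * mderiv (dual_coord c) (binomial_form e :: ('n coord, 'f::field) mpoly)) 1"
  using Min_ne_Max(1)[OF assms]
  by (cases c) (simp_all add: hyperconn_row_def generic_coord_def Let_def coord_sign_def
      mderiv_binomial_form_CX mderiv_binomial_form_CY)

text \<open>Permuting columns and changing their signs preserves the linear relations of the rows,
  and denominators can be cleared. Injectivity of the rows is contained in the right side, since
  equal rows give the relation with coefficients \<open>1\<close> and \<open>- 1\<close>.\<close>

lemma hyperconn_indep_iff:
  fixes S :: "'n::{finite,linorder} set set"
  assumes S: "\<And>e. e \<in> S \<Longrightarrow> card e = 2"
  shows "hyperconn_indep TYPE('f::field) S \<longleftrightarrow>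
    (\<forall>u :: 'n set \<Rightarrow> ('n coord, 'f) mpoly.
      (\<forall>c. (\<Sum>e\<in>S. u e * mderiv c (binomial_form e)) = 0) \<longrightarrow> (\<forall>e\<in>S. u e = 0))"
    (is "?H \<longleftrightarrow> ?J")
proof
  let ?row = "hyperconn_row :: 'n set \<Rightarrow> ('n coord, 'f) mpoly fract ^ 'n coord"
  have fin: "finite S" by simp
  {
    assume H: ?H
    then have inj: "inj_on ?row S" and ind: "vec.independent (?row ` S)" by (auto simp: hyperconn_indep_def)
    show ?J
    proof (intro allI impI)
      fix u :: "'n set \<Rightarrow> ('n coord, 'f) mpoly"
      assume u: "\<forall>c. (\<Sum>e\<in>S. u e * mderiv c (binomial_form e)) = 0"
      let ?w = "\<lambda>r. Fract (u (the_inv_into S ?row r)) 1"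
      have "(\<Sum>r\<in>?row ` S. ?w r *s r) = (\<Sum>e\<in>S. Fract (u e) 1 *s ?row e)"
        using inj by (subst sum.reindex) (auto simp: the_inv_into_f_f)
      also have "\<dots> = 0"
      proof (rule vec_eq_iff[THEN iffD2], rule allI)
        fix c :: "'n coord"
        have "(\<Sum>e\<in>S. Fract (u e) 1 *s ?row e) $ c =
            (\<Sum>e\<in>S. Fract (coord_sign c * (u e * mderiv (dual_coord c) (binomial_form e))) 1)"
          by (simp add: hyperconn_row_mderiv S ac_simps)
        also have "\<dots> = Fract (coord_sign c * (\<Sum>e\<in>S. u e * mderiv (dual_coord c) (binomial_form e))) 1"
          by (simp add: sum_distrib_left Fract.hom_sum)
        finally show "(\<Sum>e\<in>S. Fract (u e) 1 *s ?row e) $ c = 0 $ c" using u by simp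
      qed
      finally have "\<forall>r\<in>?row ` S. ?w r = 0"
        using vec.independentD[OF ind, of "?row ` S" ?w] fin by auto
      then show "\<forall>e\<in>S. u e = 0" using inj by (auto simp: the_inv_into_f_f)
    qed
  }
  {
    assume J: ?J
    have inj: "inj_on ?row S"
    proof (rule inj_onI, rule ccontr)
      fix e e' assume e: "e \<in> S" "e' \<in> S" "?row e = ?row e'" "e \<noteq> e'"
      have d: "mderiv c (binomial_form e) = (mderiv c (binomial_form e') :: ('n coord, 'f) mpoly)" for c
      proof -
        have "Fract (coord_sign (dual_coord c) * mderiv c (binomial_form e) :: ('n coord, 'f) mpoly) 1 =
            Fract (coord_sign (dual_coord c) * mderiv c (binomial_form e')) 1"
          using e(3) hyperconn_row_mderiv[OF S[OF e(1)], of "dual_coord c", where 'f = 'f]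
            hyperconn_row_mderiv[OF S[OF e(2)], of "dual_coord c", where 'f = 'f] by simp
        then have "coord_sign (dual_coord c) * (mderiv c (binomial_form e) :: ('n coord, 'f) mpoly) =
            coord_sign (dual_coord c) * mderiv c (binomial_form e')" by (simp add: eq_fract)
        then have "coord_sign (dual_coord c) * (coord_sign (dual_coord c) * (mderiv c (binomial_form e) :: ('n coord, 'f) mpoly)) =
            coord_sign (dual_coord c) * (coord_sign (dual_coord c) * mderiv c (binomial_form e'))" by simp
        then show ?thesis by (simp flip: mult.assoc)
      qed
      let ?u = "\<lambda>a. if a = e then 1 else if a = e' then - 1 else 0 :: ('n coord, 'f) mpoly"
      have "(\<Sum>a\<in>S. ?u a * mderiv c (binomial_form a)) = 0" for c
      proof -
        have "(\<Sum>a\<in>S. ?u a * mderiv c (binomial_form a)) = (\<Sum>a\<in>{e, e'}. ?u a * mderiv c (binomial_form a))"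
          using e fin by (intro sum.mono_neutral_right) auto
        then show ?thesis using e(4) d[of c] by simp
      qed
      then have "\<forall>a\<in>S. ?u a = 0" by (intro J[THEN spec, THEN mp] allI)
      then show False using e(1) by force
    qed
    have "vec.independent (?row ` S)"
    proof (rule vec.independent_if_scalars_zero)
      show "finite (?row ` S)" by simp
      fix w r assume w: "(\<Sum>r\<in>?row ` S. w r *s r) = 0" and r: "r \<in> ?row ` S"
      then obtain e where e: "e \<in> S" "r = ?row e" by blast
      obtain d v where dv: "d \<noteq> 0" "\<forall>e\<in>S. Fract d 1 * w (?row e) = Fract (v e) 1"
        using common_denominator[OF fin, of "\<lambda>e. w (?row e)"] by blast
      have w': "(\<Sum>e\<in>S. w (?row e) *s ?row e) = 0"
        using w inj by (subst (asm) sum.reindex) auto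
      have "(\<Sum>e\<in>S. v e * mderiv c (binomial_form e)) = 0" for c
      proof -
        let ?c = "dual_coord c"
        have "0 = Fract d 1 * (\<Sum>e\<in>S. w (?row e) *s ?row e) $ ?c" by (simp add: w')
        also have "\<dots> = (\<Sum>e\<in>S. (Fract d 1 * w (?row e)) * ?row e $ ?c)"
          by (simp add: sum_distrib_left ac_simps)
        also have "\<dots> = (\<Sum>e\<in>S. Fract (v e * (coord_sign ?c * mderiv c (binomial_form e))) 1)"
          using dv(2) by (intro sum.cong) (simp_all add: hyperconn_row_mderiv S)
        also have "\<dots> = Fract (coord_sign ?c * (\<Sum>e\<in>S. v e * mderiv c (binomial_form e))) 1"
          by (simp add: sum_distrib_left Fract.hom_sum ac_simps)
        finally have "coord_sign ?c * (\<Sum>e\<in>S. v e * mderiv c (binomial_form e)) = 0" by simp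
        then have "coord_sign ?c * (coord_sign ?c * (\<Sum>e\<in>S. v e * mderiv c (binomial_form e))) = 0" by simp
        then show ?thesis by (simp flip: mult.assoc)
      qed
      then have "v e = 0" using J e(1) by blast
      then have "Fract d 1 * w r = 0" using dv(2) e by auto
      then show "w r = 0" using dv(1) by simp
    qed
    then show ?H using inj by (simp add: hyperconn_indep_def)
  }
qed

text \<open>The Jacobian criterion speaks of a set of forms, linear independence of a family indexed
  by edges. Two edges with the same form would have the same gradient, so the passage is
  harmless.\<close>

theorem hyperconn_indep_imp_algebraic_indep:
  fixes S :: "'n::{finite,linorder} set set"
  assumes S: "\<And>e. e \<in> S \<Longrightarrow> card e = 2" and H: "hyperconn_indep TYPE('f::field) S"
  shows "algebraic_indep TYPE('f) S"
proof -
  let ?f = "binomial_form :: 'n set \<Rightarrow> ('n coord, 'f) mpoly"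
  have J: "\<forall>e\<in>S. u e = 0" if "\<And>c. (\<Sum>e\<in>S. u e * mderiv c (?f e)) = 0" for u
    using H that hyperconn_indep_iff[OF S, where 'f = 'f] by blast
  have inj: "inj_on ?f S"
  proof (rule inj_onI, rule ccontr)
    fix e e' assume e: "e \<in> S" "e' \<in> S" "?f e = ?f e'" "e \<noteq> e'"
    let ?u = "\<lambda>a. if a = e then 1 else if a = e' then - 1 else 0 :: ('n coord, 'f) mpoly"
    have "(\<Sum>a\<in>S. ?u a * mderiv c (?f a)) = 0" for c
    proof -
      have "(\<Sum>a\<in>S. ?u a * mderiv c (?f a)) = (\<Sum>a\<in>{e, e'}. ?u a * mderiv c (?f a))"
        using e by (intro sum.mono_neutral_right) auto
      then show ?thesis using e(3,4) by simp
    qed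
    from J[of ?u, OF this] e(1) show False by force
  qed
  have "algebraically_independent mconst (?f ` S)"
  proof (rule jacobian_imp_algebraically_independent)
    show "\<forall>a\<in>?f ` S. u a = 0" if "\<And>c. (\<Sum>a\<in>?f ` S. u a * mderiv c a) = 0" for u
      using J[of "\<lambda>e. u (?f e)"] that inj by (auto simp: sum.reindex)
    show "stretch CHAR('f) a = a ^ CHAR('f)" if p: "CHAR('f) > 0" and "a \<in> ?f ` S" for a
      using that(2) stretch_binomial_form[OF prime_CHAR_semidom[OF p]] by auto
  qed simp
  then show ?thesis by (simp add: algebraic_indep_def edge_binomial_eq[abs_def])
qed

section \<open>From algebraic independence to a nonvanishing minor over the integers\<close>

definition reduce_coeffs :: "('v, int) mpoly \<Rightarrow> ('v, 'f::comm_ring_1) mpoly" where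
  "reduce_coeffs = mpoly_eval (\<lambda>k. mconst (of_int k)) mvar"

lemma of_int_hom: "comm_ring_1_hom (of_int :: int \<Rightarrow> 'a::comm_ring_1)"
  by standard simp_all

lemma mconst_of_int_hom: "comm_ring_1_hom (\<lambda>k :: int. mconst (of_int k) :: ('v, 'f::comm_ring_1) mpoly)"
  by (rule comm_ring_1_hom.comp_hom[OF of_int_hom mconst_hom])

interpretation mci: comm_ring_1_hom "\<lambda>k :: int. mconst (of_int k) :: ('v, 'f::comm_ring_1) mpoly"
  by (rule mconst_of_int_hom)

lemma reduce_coeffs_hom: "comm_ring_1_hom (reduce_coeffs :: ('v, int) mpoly \<Rightarrow> ('v, 'f::comm_ring_1) mpoly)"
  unfolding reduce_coeffs_def by (rule mci.mpoly_eval_hom)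

interpretation red: comm_ring_1_hom "reduce_coeffs :: ('v, int) mpoly \<Rightarrow> ('v, 'f::comm_ring_1) mpoly"
  by (rule reduce_coeffs_hom)

lemma reduce_coeffs_mvar [simp]: "reduce_coeffs (mvar v) = mvar v"
  by (simp add: reduce_coeffs_def)

lemma reduce_coeffs_mconst [simp]: "reduce_coeffs (mconst k) = mconst (of_int k)"
  by (simp add: reduce_coeffs_def)

lemma lookup_reduce_coeffs:
  "lookup (reduce_coeffs P :: ('v, 'f::comm_ring_1) mpoly) m = of_int (lookup P m)"
proof (induction P rule: poly_mapping_single_induct)
  case (single m' c)
  have "reduce_coeffs (single m' c) = (single m' (of_int c) :: ('v, 'f) mpoly)"
    by (simp add: reduce_coeffs_def mci.mpoly_eval_single monom_val_mvar mconst_mult_single)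
  then show ?case by (simp add: lookup_single when_def)
qed (simp_all add: red.hom_add lookup_add)

lemma reduce_coeffs_binomial_form: "reduce_coeffs (binomial_form e) = binomial_form e"
  by (simp add: binomial_form_def red.hom_diff red.hom_mult)

lemma mvar_neq_0 [simp]: "mvar v \<noteq> (0 :: ('v, 'f::comm_ring_1) mpoly)"
  by (metis lookup_single_eq lookup_zero mvar_def zero_neq_one)

text \<open>The \<open>x\<close>-variables occurring in the form reveal its edge, so distinct edges
  have distinct forms over every coefficient ring.\<close>

lemma edge_of_binomial_form:
  assumes "card e = 2"
  shows "e = {k. mderiv (CX k) (binomial_form e :: ('n::linorder coord, 'f::comm_ring_1) mpoly) \<noteq> 0}"
proof -
  have "{k. mderiv (CX k) (binomial_form e :: ('n coord, 'f) mpoly) \<noteq> 0} = {Min e, Max e}"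
    using Min_ne_Max(1)[OF assms] by (auto simp: mderiv_binomial_form_CX)
  then show ?thesis using Min_ne_Max(2)[OF assms] by simp
qed

lemma inj_on_binomial_form:
  assumes "\<And>e. e \<in> S \<Longrightarrow> card e = 2"
  shows "inj_on (binomial_form :: _ \<Rightarrow> ('n::linorder coord, 'f::comm_ring_1) mpoly) S"
  by (rule inj_onI) (metis edge_of_binomial_form assms)

text \<open>A relation over the integers is divisible by arbitrarily high powers of the
  characteristic, because its reduction is a relation over \<open>'f\<close>.\<close>

lemma algebraic_indep_imp_int:
  fixes S :: "'n::{finite,linorder} set set"
  assumes S: "\<And>e. e \<in> S \<Longrightarrow> card e = 2" and indep: "algebraic_indep TYPE('f::field) S"
  shows "algebraically_independent (mconst :: int \<Rightarrow> ('n coord, int) mpoly) (binomial_form ` S)"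
proof -
  let ?fZ = "binomial_form :: _ \<Rightarrow> ('n coord, int) mpoly"
  let ?fF = "binomial_form :: _ \<Rightarrow> ('n coord, 'f) mpoly"
  let ?eZ = "mpoly_eval mconst (\<lambda>a. a) :: (('n coord, int) mpoly, int) mpoly \<Rightarrow> _"
  let ?eF = "mpoly_eval mconst (\<lambda>a. a) :: (('n coord, 'f) mpoly, 'f) mpoly \<Rightarrow> _"
  let ?red = "reduce_coeffs :: ('n coord, int) mpoly \<Rightarrow> ('n coord, 'f) mpoly"
  have F: "algebraically_independent mconst (?fF ` S)"
    using indep by (simp add: algebraic_indep_def edge_binomial_eq[abs_def])
  have injF: "inj_on ?fF S" by (rule inj_on_binomial_form[OF S])
  \<comment> \<open>The indeterminates of a relation are named by polynomials, so reducing a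
    relation among the forms also renames them. \<open>lift\<close> restores the integral names,
    after which coefficients can be compared.\<close>
  define lift where "lift b = ?fZ (the_inv_into S ?fF b)" for b
  have lift: "lift (?red a) = a" if "a \<in> ?fZ ` S" for a
    using that injF by (auto simp: lift_def reduce_coeffs_binomial_form the_inv_into_f_f)
  have zero: "(of_int (lookup P m) :: 'f) = 0"
    if P: "P \<in> polys_in (?fZ ` S)" "?eZ P = 0" for P m
  proof -
    define Q :: "(('n coord, 'f) mpoly, 'f) mpoly"
      where "Q = mpoly_eval (\<lambda>k. mconst (of_int k)) (\<lambda>a. mvar (?red a)) P"
    have Q_eq: "Q = mpoly_eval mconst (\<lambda>a. mvar (?red a)) (reduce_coeffs P)"
      unfolding Q_def reduce_coeffs_def[where 'v = "('n coord, int) mpoly"]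
      by (subst mci.hom_mpoly_eval[OF mconst.mpoly_eval_hom]) simp
    have "Q \<in> adj mconst (mvar ` (?fF ` S))"
    proof -
      have "reduce_coeffs P \<in> (polys_in (?fZ ` S) :: (_, 'f) mpoly set)"
        using P(1) unfolding polys_in_def
        by (auto simp: in_keys_iff lookup_reduce_coeffs)
      then show ?thesis
        unfolding Q_eq
      proof (rule mconst.mpoly_eval_in_adj)
        fix a assume "a \<in> ?fZ ` S"
        then have "?red a \<in> ?fF ` S" by (auto simp: reduce_coeffs_binomial_form)
        then show "mvar (?red a) \<in> adj mconst (mvar ` (?fF ` S))" by (intro adj_gen) blast
      qed
    qed
    then have Qin: "Q \<in> polys_in (?fF ` S)"
      by induction (auto intro: polys_in_mconst polys_in_mvar polys_in_add polys_in_mult)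
    have "?eF Q = mpoly_eval (\<lambda>k. mconst (of_int k)) ?red P"
      unfolding Q_def by (subst mci.hom_mpoly_eval[OF mconst.mpoly_eval_hom]) simp
    also have "\<dots> = ?red (?eZ P)"
      by (subst mconst.hom_mpoly_eval[OF reduce_coeffs_hom]) simp
    finally have "?eF Q = 0" using P(2) by simp
    with F Qin have "Q = 0" by (auto simp: algebraically_independent_iff)
    then have "mpoly_eval mconst (\<lambda>b. mvar (lift b)) Q = (0 :: (_, 'f) mpoly)" by simp
    also have "mpoly_eval mconst (\<lambda>b. mvar (lift b)) Q =
        mpoly_eval (\<lambda>k. mconst (of_int k)) (\<lambda>a. mvar (lift (?red a))) P"
      unfolding Q_def by (subst mci.hom_mpoly_eval[OF mconst.mpoly_eval_hom]) simp
    also have "\<dots> = reduce_coeffs P"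
      unfolding reduce_coeffs_def[where 'v = "('n coord, int) mpoly"]
    proof (rule mpoly_eval_cong)
      fix v assume "v \<in> (\<Union>m\<in>keys P. keys m)"
      then have "v \<in> ?fZ ` S" using P(1) by (auto simp: polys_in_def)
      then show "mvar (lift (?red v)) = (mvar v :: (_, 'f) mpoly)" by (simp only: lift)
    qed
    finally show ?thesis by (metis lookup_reduce_coeffs lookup_zero)
  qed
  let ?p = "int CHAR('f)"
  have dvd: "?p ^ N dvd lookup P m"
    if "P \<in> polys_in (?fZ ` S)" "?eZ P = 0" for P m N
    using that
  proof (induction N arbitrary: P)
    case (Suc N)
    have d: "?p dvd lookup P m" for m
      using zero[OF Suc.prems, of m] by (simp add: of_int_eq_0_iff_char_dvd)
    show ?case
    proof (cases "?p = 0")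
      \<comment> \<open>In characteristic zero, divisibility by \<open>?p = 0\<close> already says
        that the coefficient vanishes.\<close>
      case True
      then show ?thesis using d[of m] by simp
    next
      case False
      define Q where "Q = Poly_Mapping.map (\<lambda>k. k div ?p) P"
      have lQ: "lookup Q m = lookup P m div ?p" for m
        by (simp add: Q_def map.rep_eq when_def)
      have PQ: "P = mconst ?p * Q"
      proof (rule poly_mapping_eqI)
        fix m
        have "lookup (mconst c * Q) m = c * lookup Q m" for c
        proof (induction Q rule: poly_mapping_single_induct)
          case (single m' c')
          then show ?case by (simp add: mconst_mult_single lookup_single when_def)
        qed (simp_all add: distrib_left lookup_add)
        then show "lookup P m = lookup (mconst ?p * Q) m"
          using d[of m] by (simp add: lQ)
      qed
      have "keys Q \<subseteq> keys P" by (auto simp: in_keys_iff lQ)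
      then have Qin: "Q \<in> polys_in (?fZ ` S)" using Suc.prems(1) by (auto simp: polys_in_def)
      interpret e: comm_ring_1_hom ?eZ by (rule mconst.mpoly_eval_hom)
      have "mconst ?p * ?eZ Q = 0" using Suc.prems(2) by (simp add: PQ e.hom_mult)
      then have "?eZ Q = 0" using False by simp
      from Suc.IH[OF Qin this] have "?p ^ N dvd lookup Q m" .
      then have "?p * ?p ^ N dvd ?p * lookup Q m" by (rule mult_dvd_mono[OF dvd_refl])
      then show ?thesis using d[of m] by (simp add: lQ)
    qed
  qed simp
  show ?thesis
    unfolding algebraically_independent_iff
  proof (intro ballI impI poly_mapping_eqI)
    fix P :: "(('n coord, int) mpoly, int) mpoly" and m
    assume P: "P \<in> polys_in (?fZ ` S)" "?eZ P = 0"
    show "lookup P m = lookup 0 m"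
    proof (rule ccontr)
      assume "lookup P m \<noteq> lookup 0 m"
      then have nz: "lookup P m \<noteq> 0" by simp
      \<comment> \<open>The coefficient itself serves as exponent: for \<open>?p \<ge> 2\<close> the
        power \<open>?p ^ N\<close> exceeds \<open>N\<close>, so it cannot divide a nonzero number
        of absolute value \<open>N\<close>.\<close>
      define N where "N = nat \<bar>lookup P m\<bar>"
      have "\<bar>?p ^ N\<bar> \<le> int N" using dvd_imp_le_int[OF nz dvd[OF P, of N]] by (simp add: N_def)
      moreover have "int N < 2 ^ N" by (rule of_nat_less_two_power)
      moreover have "?p = 0 \<or> ?p \<ge> 2"
        using CHAR_not_1[where 'a = 'f] by (cases "CHAR('f)") auto
      moreover have "N > 0" using nz by (simp add: N_def)
      ultimately show False
      proof (elim disjE)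
        assume "?p = 0"
        with dvd[OF P, of 1 m] nz show False by simp
      next
        assume "?p \<ge> 2"
        then have "(2::int) ^ N \<le> ?p ^ N" by (intro power_mono) auto
        with \<open>\<bar>?p ^ N\<bar> \<le> int N\<close> \<open>int N < 2 ^ N\<close> show False by linarith
      qed
    qed
  qed
qed

text \<open>In characteristic \<open>0\<close>, differentiating a relation of minimal degree for a coordinate over
  a maximal algebraically independent set expresses the coordinate's gradient through the
  gradients of that set.\<close>

lemma ex_gradient_relation:
  fixes G :: "('v::linorder, 'f::{idom, ring_char_0}) mpoly set"
  assumes G: "finite G" and rel: "\<exists>c n. (\<forall>i. c i \<in> adj mconst G) \<and> c n \<noteq> 0 \<and> (\<Sum>i\<le>n. c i * x ^ i) = 0"
  shows "\<exists>d C. d \<noteq> 0 \<and> (\<forall>v. d * mderiv v x = (\<Sum>g\<in>G. C g * mderiv v g))"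
proof -
  define n where "n = (LEAST n. \<exists>c. (\<forall>i. c i \<in> adj mconst G) \<and> c n \<noteq> 0 \<and> (\<Sum>i\<le>n. c i * x ^ i) = 0)"
  have "\<exists>n c. (\<forall>i. c i \<in> adj mconst G) \<and> c n \<noteq> 0 \<and> (\<Sum>i\<le>n. c i * x ^ i) = 0" using rel by blast
  from LeastI_ex[OF this] obtain c where c: "\<And>i. c i \<in> adj mconst G" "c n \<noteq> 0" "(\<Sum>i\<le>n. c i * x ^ i) = 0"
    unfolding n_def by blast
  have min: "(\<Sum>i\<le>k. c' i * x ^ i) \<noteq> 0" if "k < n" "\<And>i. c' i \<in> adj mconst G" "c' k \<noteq> 0" for k c'
    using not_less_Least[OF that(1)[unfolded n_def]] that(2,3) by blast
  have n0: "n > 0" using c(2,3) by (cases n) auto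
  \<comment> \<open>The derivative of the relation with respect to \<open>x\<close>. Its leading
    coefficient \<open>n * c n\<close> is nonzero in characteristic zero and its degree is smaller,
    so minimality forbids that it vanishes.\<close>
  define d where "d = (\<Sum>i\<le>n - 1. (of_nat (Suc i) * c (Suc i)) * x ^ i)"
  have "d \<noteq> 0"
    unfolding d_def
  proof (rule min)
    show "n - 1 < n" using n0 by simp
    show "of_nat (Suc i) * c (Suc i) \<in> adj mconst G" for i
    proof (rule adj_mult[OF _ c(1)])
      have "(of_nat (Suc i) :: ('v, 'f) mpoly) = mconst (of_nat (Suc i))"
        using mconst.hom_of_int[of "int (Suc i)", symmetric] by simp
      then show "of_nat (Suc i) \<in> adj mconst G" by (simp only: adj_scal)
    qed
    show "of_nat (Suc (n - 1)) * c (Suc (n - 1)) \<noteq> 0" using c(2) n0 by (simp del: of_nat_Suc)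
  qed
  have "\<exists>P\<in>polys_in G. c i = mpoly_eval mconst (\<lambda>a. a) P" for i
    using c(1)[of i] mconst.adj_iff by blast
  then obtain P where P: "\<And>i. P i \<in> polys_in G" "\<And>i. c i = mpoly_eval mconst (\<lambda>a. a) (P i)" by metis
  define C where "C g = - (\<Sum>i\<le>n. mpoly_eval mconst (\<lambda>a. a) (mderiv g (P i)) * x ^ i)" for g
  have pow: "mderiv v (x ^ k) = of_nat k * x ^ (k - 1) * mderiv v x" for v k
  proof (induction k)
    case 0
    show ?case using mderiv_mconst[of v 1] by simp
  next
    case (Suc k)
    then show ?case by (cases k) (simp_all add: mderiv_mult algebra_simps)
  qed
  have msum: "mderiv v (\<Sum>i\<le>k. f i) = (\<Sum>i\<le>k. mderiv v (f i))" for v f and k :: nat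
    by (induction k) (simp_all add: mderiv_add)
  have "d * mderiv v x = (\<Sum>g\<in>G. C g * mderiv v g)" for v
  proof -
    have "0 = mderiv v (\<Sum>i\<le>n. c i * x ^ i)" by (simp add: c(3))
    also have "\<dots> = (\<Sum>i\<le>n. mderiv v (c i) * x ^ i) + (\<Sum>i\<le>n. c i * mderiv v (x ^ i))"
      by (simp add: msum mderiv_mult sum.distrib)
    also have "(\<Sum>i\<le>n. c i * mderiv v (x ^ i)) = d * mderiv v x"
    proof -
      obtain n' where n': "n = Suc n'" using n0 by (cases n) auto
      show ?thesis
        unfolding n' d_def sum_distrib_right
        by (subst sum.atMost_Suc_shift)
          (simp add: pow ac_simps mderiv_mconst[of v 1, simplified] del: power_Suc of_nat_Suc)
    qed
    also have "(\<Sum>i\<le>n. mderiv v (c i) * x ^ i) = (\<Sum>g\<in>G. - C g * mderiv v g)"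
    proof -
      have "(\<Sum>i\<le>n. mderiv v (c i) * x ^ i) =
          (\<Sum>i\<le>n. \<Sum>g\<in>G. mpoly_eval mconst (\<lambda>a. a) (mderiv g (P i)) * mderiv v g * x ^ i)"
        by (intro sum.cong refl) (simp add: P(2) chain_rule[OF P(1) G] sum_distrib_right)
      also have "\<dots> = (\<Sum>g\<in>G. - C g * mderiv v g)"
        by (subst sum.swap) (simp add: C_def sum_distrib_left sum_distrib_right ac_simps)
      finally show ?thesis .
    qed
    finally show ?thesis by (simp add: sum_negf eq_neg_iff_add_eq_0 add.commute)
  qed
  then show ?thesis using \<open>d \<noteq> 0\<close> by blast
qed

text \<open>A unit row is the gradient of the coordinate it is indexed by.\<close>

definition gradient_row :: "('n::linorder set + 'n coord) \<Rightarrow> 'n coord \<Rightarrow> ('n coord, 'f::comm_ring_1) mpoly" where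
  "gradient_row k c = (case k of Inl e \<Rightarrow> mderiv c (binomial_form e) | Inr c' \<Rightarrow> if c = c' then 1 else 0)"

text \<open>The forms are completed by coordinates to a maximal independent set \<open>G\<close>. A
  nonzero multiple of every unit vector is then a combination of the gradients of \<open>G\<close>,
  so their matrix has a left factor making it diagonal with nonzero entries.\<close>

theorem ex_nonzero_jacobian_det:
  fixes S :: "'n::{finite,linorder} set set"
  assumes indep: "algebraically_independent (mconst :: int \<Rightarrow> ('n coord, int) mpoly) (binomial_form ` S)"
    and S: "\<And>e. e \<in> S \<Longrightarrow> card e = 2"
  shows "\<exists>\<kappa> :: 'n coord \<Rightarrow> 'n set + 'n coord. (\<forall>e\<in>S. Inl e \<in> range \<kappa>) \<and> (\<forall>r e. \<kappa> r = Inl e \<longrightarrow> e \<in> S) \<and>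
    det (\<chi> r c. (gradient_row (\<kappa> r) c :: ('n coord, int) mpoly)) \<noteq> 0"
proof -
  let ?f = "binomial_form :: 'n set \<Rightarrow> ('n coord, int) mpoly"
  let ?V = "range mvar :: ('n coord, int) mpoly set"
  let ?ind = "algebraically_independent (mconst :: int \<Rightarrow> ('n coord, int) mpoly)"
  have fin: "finite (?f ` S \<union> ?V)" by simp
  define \<G> where "\<G> = {G. ?f ` S \<subseteq> G \<and> G \<subseteq> ?f ` S \<union> ?V \<and> ?ind G}"
  have "finite \<G>" by (rule finite_subset[of _ "Pow (?f ` S \<union> ?V)"]) (auto simp: \<G>_def)
  moreover have "\<G> \<noteq> {}" using indep by (auto simp: \<G>_def)
  ultimately have "\<exists>G\<in>\<G>. \<forall>G'\<in>\<G>. G \<subseteq> G' \<longrightarrow> G = G'" by (rule finite_has_maximal)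
  then obtain G where G\<G>: "G \<in> \<G>" and Gmax: "\<And>G'. G' \<in> \<G> \<Longrightarrow> G \<subseteq> G' \<Longrightarrow> G = G'"
    by blast
  then have G: "?f ` S \<subseteq> G" "G \<subseteq> ?f ` S \<union> ?V" "?ind G" by (auto simp: \<G>_def)
  have finG: "finite G" using G(2) fin by (rule finite_subset)
  have UNIV_adj: "P \<in> adj mconst ?V" for P :: "('n coord, int) mpoly"
    by (induction P rule: mpoly_induct) (auto intro: adj.intros)
  \<comment> \<open>The polynomial ring is its own finite module over the algebra of the variables,
    so the count applies with \<open>W = {1}\<close> and \<open>g = 1\<close>.\<close>
  have cardG: "card G \<le> CARD('n coord)"
  proof -
    have "card G \<le> card ?V"
    proof (rule mdom.card_le_of_localized_finite[where Y = ?V and W = "{1}" and g = 1])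
      show "1 * y * w \<in> mspan (adj mconst ?V) {1}" if "w \<in> {1}" for y w :: "('n coord, int) mpoly"
        using mspan_single[OF UNIV_adj, of 1 "{1}" y] that by simp
    qed (use finG G(3) UNIV_adj in auto)
    also have "\<dots> \<le> CARD('n coord)" by (rule card_image_le) simp
    finally show ?thesis .
  qed
  have "\<exists>d C. d \<noteq> 0 \<and> (\<forall>v. d * mderiv v (mvar c) = (\<Sum>g\<in>G. C g * mderiv v g))" for c :: "'n coord"
  proof (rule ex_gradient_relation[OF finG])
    show "\<exists>a n. (\<forall>i. a i \<in> adj mconst G) \<and> a n \<noteq> 0 \<and> (\<Sum>i\<le>n. a i * mvar c ^ i) = 0"
    proof (cases "mvar c \<in> G")
      case True
      let ?a = "\<lambda>i::nat. if i = 0 then - mvar c else 1 :: ('n coord, int) mpoly"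
      have "(\<Sum>i\<le>1. ?a i * mvar c ^ i) = 0" by simp
      moreover have "?a i \<in> adj mconst G" for i using True by (auto intro: mconst.adj_uminus adj_gen)
      ultimately show ?thesis by (intro exI[of _ ?a] exI[of _ 1]) auto
    next
      case False
      have "\<not> ?ind (insert (mvar c) G)"
      proof
        assume "?ind (insert (mvar c) G)"
        then have "insert (mvar c) G \<in> \<G>" using G by (auto simp: \<G>_def)
        with Gmax False show False by blast
      qed
      from mdom.ex_algebraic_relation[OF G(3) this] obtain a n
        where "\<And>i. a i \<in> adj mconst G" "a n \<noteq> 0" "(\<Sum>i\<le>n. a i * mvar c ^ i) = 0" by blast
      then show ?thesis by blast
    qed
  qed
  then have "\<forall>c :: 'n coord. \<exists>d C. d \<noteq> 0 \<and> (\<forall>v. d * mderiv v (mvar c) = (\<Sum>g\<in>G. C g * mderiv v g))"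
    by blast
  from choice[OF this] obtain d :: "'n coord \<Rightarrow> ('n coord, int) mpoly"
    where "\<forall>c. \<exists>C. d c \<noteq> 0 \<and> (\<forall>v. d c * mderiv v (mvar c) = (\<Sum>g\<in>G. C g * mderiv v g))"
    by blast
  from choice[OF this] obtain C
    where dC: "\<And>c. d c \<noteq> 0" "\<And>c v. d c * mderiv v (mvar c) = (\<Sum>g\<in>G. C c g * mderiv v g)"
    by blast
  obtain h :: "_ \<Rightarrow> 'n coord" where h: "inj_on h G" using card_le_inj[OF finG, of "UNIV :: 'n coord set"] cardG by auto
  define J :: "(('n coord, int) mpoly)^'n coord^'n coord"
    where "J = (\<chi> r c. if r \<in> h ` G then mderiv c (the_inv_into G h r) else 0)"
  define B :: "(('n coord, int) mpoly)^'n coord^'n coord"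
    where "B = (\<chi> c r. if r \<in> h ` G then C c (the_inv_into G h r) else 0)"
  have "B ** J = (\<chi> c v. if c = v then d c else 0)"
  proof (rule vec_eq_iff[THEN iffD2], rule allI, rule vec_eq_iff[THEN iffD2], rule allI)
    fix c v
    have "(B ** J) $ c $ v = (\<Sum>r\<in>h ` G. C c (the_inv_into G h r) * mderiv v (the_inv_into G h r))"
      unfolding matrix_matrix_mult_def B_def J_def
      by (simp, intro sum.mono_neutral_cong_right) auto
    also have "\<dots> = (\<Sum>g\<in>G. C c g * mderiv v g)"
      using h by (subst sum.reindex) (auto simp: the_inv_into_f_f)
    also have "\<dots> = (if c = v then d c else 0)" using dC(2)[of c v] by (auto simp: mderiv_mvar split: if_splits)
    finally show "(B ** J) $ c $ v = (\<chi> c v. if c = v then d c else 0) $ c $ v" by simp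
  qed
  then have "det (B ** J) = (\<Prod>c\<in>UNIV. d c)" by (subst det_diagonal) auto
  then have detJ: "det J \<noteq> 0" using dC(1) by (auto simp: det_mul)
  define \<kappa> where "\<kappa> r = (let g = the_inv_into G h r in if g \<in> ?f ` S then Inl (the_inv_into S ?f g)
    else Inr (the_inv_into UNIV mvar g))" for r
  have r: "r \<in> h ` G" for r
  proof (rule ccontr)
    assume "r \<notin> h ` G"
    then have "row r J = 0" by (simp add: row_def J_def vec_eq_iff)
    with detJ show False by (simp add: det_zero_row)
  qed
  have injf: "inj_on ?f S" by (rule inj_on_binomial_form[OF S])
  have injv: "inj (mvar :: 'n coord \<Rightarrow> ('n coord, int) mpoly)"
  proof (rule injI)
    fix c c' :: "'n coord" assume "mvar c = (mvar c' :: ('n coord, int) mpoly)"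
    then have "mderiv c (mvar c) = (mderiv c (mvar c') :: ('n coord, int) mpoly)" by simp
    then show "c = c'" by (simp add: mderiv_mvar split: if_splits)
  qed
  have row: "J $ r $ c = gradient_row (\<kappa> r) c" for r c
  proof -
    obtain g where g: "g \<in> G" "r = h g" using r by blast
    then have gr: "the_inv_into G h r = g" using h by (simp add: the_inv_into_f_f)
    then have J: "J $ r $ c = mderiv c g" using g by (simp add: J_def)
    show ?thesis
    proof (cases "g \<in> ?f ` S")
      case True
      then obtain e where "e \<in> S" "g = ?f e" by blast
      then show ?thesis using True injf by (simp add: J gr \<kappa>_def gradient_row_def the_inv_into_f_f)
    next
      case False
      then obtain v where "g = mvar v" using g G(2) by blast
      then show ?thesis using False injv
        by (simp add: J gr \<kappa>_def gradient_row_def the_inv_into_f_f mderiv_mvar)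
    qed
  qed
  have "J = (\<chi> r c. gradient_row (\<kappa> r) c)" by (simp add: vec_eq_iff row)
  then have "det (\<chi> r c. (gradient_row (\<kappa> r) c :: ('n coord, int) mpoly)) \<noteq> 0" using detJ by simp
  moreover have "Inl e \<in> range \<kappa>" if "e \<in> S" for e
  proof -
    have "?f e \<in> G" using G(1) that by blast
    then have "\<kappa> (h (?f e)) = Inl e" using that h injf by (simp add: \<kappa>_def the_inv_into_f_f)
    then show ?thesis by (metis rangeI)
  qed
  moreover have "e \<in> S" if "\<kappa> r = Inl e" for r e
    using that injf by (auto simp: \<kappa>_def Let_def the_inv_into_f_f split: if_splits)
  ultimately show ?thesis by blast
qed

section \<open>Coefficients of the minors\<close>

lemma (in comm_ring_1_hom) det_hom: "\<iota> (det A) = det (\<chi> i j. \<iota> (A $ i $ j))"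
  by (simp add: det_def hom_sum hom_mult hom_prod hom_of_int)

text \<open>Multilinearity applied to all rows at once: \<open>A\<close> records the rows that
  contribute their first summand.\<close>

lemma det_add_rows:
  fixes a b :: "'n::finite \<Rightarrow> 'a::comm_ring_1 ^ 'n"
  shows "det (\<chi> i. a i + b i) = (\<Sum>A\<in>Pow UNIV. det (\<chi> i. if i \<in> A then a i else b i))"
proof -
  have "(\<Prod>i\<in>UNIV. a i $ p i + b i $ p i) = (\<Sum>A\<in>Pow UNIV. \<Prod>i\<in>UNIV. (if i \<in> A then a i else b i) $ p i)" for p
  proof -
    have "(\<Prod>i\<in>UNIV. (if i \<in> A then a i else b i) $ p i) = (\<Prod>i\<in>A. a i $ p i) * (\<Prod>i\<in>UNIV - A. b i $ p i)" for A
    proof -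
      have "(\<Prod>i\<in>UNIV. (if i \<in> A then a i else b i) $ p i) = (\<Prod>i\<in>UNIV. if i \<in> A then a i $ p i else b i $ p i)"
        by (intro prod.cong) auto
      also have "\<dots> = (\<Prod>i\<in>A. a i $ p i) * (\<Prod>i\<in>UNIV - A. b i $ p i)"
        by (simp add: prod.If_cases Compl_eq_Diff_UNIV)
      finally show ?thesis .
    qed
    then show ?thesis by (simp add: prod_add)
  qed
  then show ?thesis
    unfolding det_def by (simp add: sum_distrib_left) (rule sum.swap)
qed

lemma det_cols_mul:
  fixes A :: "'a::comm_ring_1 ^ 'n ^ 'n::finite"
  shows "det (\<chi> i j. A $ i $ j * d j) = (\<Prod>j\<in>UNIV. d j) * det A"
proof -
  have "det (\<chi> i j. A $ i $ j * d j) = det (\<chi> j. d j *s (transpose A $ j))"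
    by (subst det_transpose[symmetric]) (simp add: transpose_def vector_scalar_mult_def mult.commute)
  also have "\<dots> = (\<Prod>j\<in>UNIV. d j) * det (\<chi> j. transpose A $ j)" by (rule det_rows_mul)
  finally show ?thesis by (simp add: vec_lambda_eta)
qed

lemma det_zero_row':
  fixes A :: "'a::comm_ring_1 ^ 'n ^ 'n::finite"
  assumes "A $ k = 0"
  shows "det A = 0"
proof -
  have "A = (\<chi> i. if i = k then 0 else A $ i)" using assms by (simp add: vec_eq_iff)
  then show ?thesis using det_row_0[of k "\<lambda>i. A $ i"] by simp
qed

definition unit_like :: "int ^ 'n \<Rightarrow> bool" where
  "unit_like z \<longleftrightarrow> z = 0 \<or> (\<exists>a. z = axis a 1 \<or> z = axis a (- 1))"

text \<open>Up to row signs such a matrix is a permutation matrix, or it has a zero row or two rows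
  in the same direction.\<close>

lemma abs_det_unit_like:
  fixes A :: "int ^ 'n ^ 'n::finite"
  assumes "\<And>r. unit_like (A $ r)"
  shows "\<bar>det A\<bar> \<le> 1"
proof (cases "\<exists>r. A $ r = 0")
  case True
  then show ?thesis using det_zero_row' by fastforce
next
  case False
  have "\<exists>a s. \<bar>s\<bar> = 1 \<and> A $ r = s *s axis a 1" for r
  proof -
    obtain a where "A $ r = axis a 1 \<or> A $ r = axis a (- 1)" using assms[of r] False by (auto simp: unit_like_def)
    then show ?thesis
    proof
      assume "A $ r = axis a 1"
      then show ?thesis by (intro exI[of _ a] exI[of _ 1]) (simp add: vector_scalar_mult_def vec_eq_iff)
    next
      assume "A $ r = axis a (- 1)"
      then show ?thesis by (intro exI[of _ a] exI[of _ "- 1"]) (simp add: vector_scalar_mult_def vec_eq_iff axis_def)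
    qed
  qed
  then obtain a s where as: "\<And>r. \<bar>s r\<bar> = (1::int)" "\<And>r. A $ r = s r *s axis (a r) 1" by metis
  have "A = (\<chi> r. s r *s axis (a r) 1)" using as(2) by (simp add: vec_eq_iff)
  then have "det A = (\<Prod>r\<in>UNIV. s r) * det (\<chi> r. (axis (a r) 1 :: int ^ 'n))" using det_rows_mul[of s "\<lambda>r. axis (a r) 1"] by simp
  moreover have "\<bar>\<Prod>r\<in>UNIV. s r\<bar> = 1" using as(1) by (simp add: abs_prod)
  moreover have "\<bar>det (\<chi> r. (axis (a r) 1 :: int ^ 'n))\<bar> \<le> 1"
  proof (cases "inj a")
    case True
    then have p: "a permutes UNIV" by (intro inj_imp_permutes) auto
    have "(\<chi> r. (axis (a r) 1 :: int ^ 'n)) = (\<chi> r. mat 1 $ a r)" by (simp add: vec_eq_iff mat_def axis_def)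
    then have "det (\<chi> r. (axis (a r) 1 :: int ^ 'n)) = of_int (sign a)" using det_permute_rows[OF p, of "mat 1 :: int ^ 'n ^ 'n"] by simp
    then show ?thesis by (simp add: sign_def)
  next
    case False
    then obtain i j where "i \<noteq> j" "a i = a j" by (auto simp: inj_def)
    then have "det (\<chi> r. (axis (a r) 1 :: int ^ 'n)) = 0" by (intro det_identical_rows[of i j]) (simp_all add: row_def)
    then show ?thesis by simp
  qed
  ultimately show ?thesis by (simp add: abs_mult)
qed

text \<open>A unit row is used to reduce the difference rows meeting its column; if no such row exists,
  the indicator of the columns without a unit row is in the kernel.\<close>

lemma abs_det_incidence:
  fixes A :: "int ^ 'n ^ 'n::finite"
  assumes "\<And>r. unit_like (A $ r) \<or> (\<exists>a b. a \<noteq> b \<and> A $ r = axis a 1 - axis b 1)"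
  shows "\<bar>det A\<bar> \<le> 1"
  using assms
proof (induction "card {r. \<not> unit_like (A $ r)}" arbitrary: A rule: less_induct)
  case less
  let ?D = "{r. \<not> unit_like (A $ r)}"
  have diff: "\<exists>a b. a \<noteq> b \<and> A $ r = axis a 1 - axis b 1" if "r \<in> ?D" for r using less.prems[of r] that by auto
  show ?case
  proof (cases "?D = {} \<or> (\<exists>r. A $ r = 0)")
    case True
    then show ?thesis using abs_det_unit_like[of A] det_zero_row'[of A] by fastforce
  next
    case False
    have nz: "A $ r \<noteq> 0" for r using False by auto
    show ?thesis
    proof (cases "\<exists>r q s a b. r \<in> ?D \<and> q \<notin> ?D \<and> a \<noteq> b \<and> A $ r = axis a 1 - axis b 1 \<and>
        \<bar>s\<bar> = 1 \<and> (A $ q = axis a s \<or> A $ q = axis b s)")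
      case True
      then obtain r q s a b where *: "r \<in> ?D" "q \<notin> ?D" "a \<noteq> b" "A $ r = axis a 1 - axis b 1" "\<bar>s\<bar> = 1"
        "A $ q = axis a s \<or> A $ q = axis b s" by blast
      have s: "s * s = 1" using *(5) by (metis abs_mult_self_eq mult_1)
      have ss: "s *s axis c s = (axis c 1 :: int ^ 'n)" "(- s) *s axis c s = (- axis c 1 :: int ^ 'n)" for c
        using s by (auto simp: vector_scalar_mult_def vec_eq_iff axis_def)
      \<comment> \<open>Adding a multiple of the unit row cancels one end of the difference row; the
        number of difference rows drops and the determinant is unchanged.\<close>
      obtain t where t: "unit_like (A $ r + t *s A $ q)"
      proof (cases "A $ q = axis a s")
        case True
        have "A $ r + (- s) *s A $ q = axis b (- 1)"
          unfolding True ss *(4) by (simp add: vec_eq_iff axis_def)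
        then show ?thesis using that[of "- s"] by (auto simp: unit_like_def)
      next
        case False
        then have q: "A $ q = axis b s" using * by blast
        have "A $ r + s *s A $ q = axis a 1" unfolding q ss *(4) by simp
        then show ?thesis using that[of s] by (auto simp: unit_like_def)
      qed
      define A' where "A' = (\<chi> k. if k = r then row r A + t *s row q A else row k A)"
      have row: "row k A = A $ k" for k by (simp add: row_def vec_lambda_eta)
      have A': "A' $ k = (if k = r then A $ r + t *s A $ q else A $ k)" for k by (simp add: A'_def row)
      have "{k. \<not> unit_like (A' $ k)} = ?D - {r}" using t by (auto simp: A')
      then have c: "card {k. \<not> unit_like (A' $ k)} < card ?D"
        using *(1) by (intro psubset_card_mono) auto
      have "r \<noteq> q" using * by auto
      then have "det A' = det A" unfolding A'_def by (rule det_row_operation)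
      moreover have "\<bar>det A'\<bar> \<le> 1" by (rule less.hyps[OF c]) (use less.prems t in \<open>auto simp: A'\<close>)
      ultimately show ?thesis by simp
    next
      case none: False
      define U where "U = {c. \<exists>q. q \<notin> ?D \<and> (A $ q = axis c 1 \<or> A $ q = axis c (- 1))}"
      \<comment> \<open>The kernel criterion for invertibility is applied over the rationals, hence
        the change of entries.\<close>
      define B :: "rat ^ 'n ^ 'n" where "B = (\<chi> i j. of_int (A $ i $ j))"
      define z :: "rat ^ 'n" where "z = (\<chi> c. if c \<in> U then 0 else 1)"
      have ax: "(\<Sum>j\<in>UNIV. of_int (axis c s $ j) * z $ j) = of_int s * z $ c" for c and s :: int
      proof -
        have "(\<Sum>j\<in>UNIV. of_int (axis c s $ j) * z $ j) = (\<Sum>j\<in>UNIV. if j = c then of_int s * z $ j else 0)"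
          by (intro sum.cong) (auto simp: axis_def)
        then show ?thesis by simp
      qed
      \<comment> \<open>No difference row can be reduced any more, so both of its columns lie
        outside \<open>U\<close> and its two contributions to the product with \<open>z\<close>
        cancel; a unit row has its column in \<open>U\<close>, where \<open>z\<close> is
        zero.\<close>
      have notU: "a \<notin> U \<and> b \<notin> U" if "r \<in> ?D" "a \<noteq> b" "A $ r = axis a 1 - axis b 1" for r a b
      proof (rule ccontr)
        assume "\<not> (a \<notin> U \<and> b \<notin> U)"
        then obtain c where c: "c \<in> U" "c = a \<or> c = b" by blast
        then obtain q where q: "q \<notin> ?D" "A $ q = axis c 1 \<or> A $ q = axis c (- 1)" by (auto simp: U_def)
        have "\<exists>s. \<bar>s\<bar> = 1 \<and> A $ q = axis c s"
          using q(2) by (rule disjE) (rule exI[of _ 1], simp, rule exI[of _ "- 1"], simp)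
        then obtain s where "\<bar>s\<bar> = 1" "A $ q = axis c s" by blast
        with none that q(1) c(2) show False by blast
      qed
      have "(B *v z) $ r = 0" for r
      proof (cases "r \<in> ?D")
        case True
        obtain a b where ab: "a \<noteq> b" "A $ r = axis a 1 - axis b 1" using diff[OF True] by blast
        have "(B *v z) $ r = (\<Sum>j\<in>UNIV. of_int (axis a 1 $ j) * z $ j) - (\<Sum>j\<in>UNIV. of_int (axis b 1 $ j) * z $ j)"
          by (simp add: matrix_vector_mult_def B_def ab left_diff_distrib sum_subtractf)
        also have "\<dots> = 0" using notU[OF True ab] by (simp only: ax) (simp add: z_def)
        finally show ?thesis .
      next
        case False
        then obtain c where c: "A $ r = axis c 1 \<or> A $ r = axis c (- 1)" using nz[of r] by (auto simp: unit_like_def)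
        then have cU: "c \<in> U" using False by (auto simp: U_def)
        obtain s where "A $ r = axis c s" using c by blast
        then have "(B *v z) $ r = (\<Sum>j\<in>UNIV. of_int (axis c s $ j) * z $ j)"
          by (simp add: matrix_vector_mult_def B_def)
        then show ?thesis using cU by (simp add: ax) (simp add: z_def)
      qed
      then have Bz: "B *v z = 0" by (simp add: vec_eq_iff)
      obtain r where "r \<in> ?D" using False by blast
      then obtain a b where "a \<noteq> b" "A $ r = axis a 1 - axis b 1" using diff by blast
      with notU[OF \<open>r \<in> ?D\<close>] have "z $ a = 1" by (simp add: z_def)
      then have "z \<noteq> 0" by auto
      then have "\<not> invertible B" using Bz matrix_left_invertible_ker[of B] by (auto simp: invertible_def)
      then have "det B = 0" by (simp add: invertible_det_nz)
      moreover have "det B = of_int (det A)"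
        using comm_ring_1_hom.det_hom[OF of_int_hom[where 'a = rat], of A] by (simp add: B_def)
      ultimately show ?thesis by simp
    qed
  qed
qed

section \<open>Splitting the gradients into the two blocks of columns\<close>

definition is_CX :: "'n coord \<Rightarrow> bool" where
  "is_CX c \<longleftrightarrow> (case c of CX _ \<Rightarrow> True | CY _ \<Rightarrow> False)"

lemma is_CX_simps [simp]: "is_CX (CX k)" "\<not> is_CX (CY k)"
  by (simp_all add: is_CX_def)

text \<open>A unit row belongs wholly to the first part. Its second part is zero, so the expansion
  does not count it twice.\<close>

definition incidence_row :: "bool \<Rightarrow> ('n::linorder set + 'n coord) \<Rightarrow> 'n coord \<Rightarrow> int" where
  "incidence_row b k c = (case k of
      Inl e \<Rightarrow> if b then (if c = CX (Min e) then 1 else if c = CX (Max e) then - 1 else 0)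
        else (if c = CY (Max e) then 1 else if c = CY (Min e) then - 1 else 0)
    | Inr c' \<Rightarrow> if b \<and> c = c' then 1 else 0)"

text \<open>The monomial left in a row after each column has been multiplied by its dual coordinate;
  for a unit row it is just that column factor.\<close>

definition row_exponent :: "bool \<Rightarrow> ('n::linorder set + 'n coord) \<Rightarrow> 'n coord \<Rightarrow>\<^sub>0 nat" where
  "row_exponent b k = (case k of
      Inl e \<Rightarrow> if b then single (CY (Min e)) 1 + single (CY (Max e)) 1
        else single (CX (Min e)) 1 + single (CX (Max e)) 1
    | Inr c' \<Rightarrow> single (dual_coord c') 1)"

definition gradient_part :: "bool \<Rightarrow> ('n::linorder set + 'n coord) \<Rightarrow> 'n coord \<Rightarrow> ('n coord, 'f::comm_ring_1) mpoly" where
  "gradient_part b k c = (case k of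
      Inl e \<Rightarrow> if is_CX c = b then gradient_row k c else 0
    | Inr c' \<Rightarrow> if b then gradient_row k c else 0)"

lemma gradient_part_add: "gradient_part True k c + gradient_part False k c = gradient_row k c"
  by (cases k) (simp_all add: gradient_part_def)

lemma mvar_mult_eq_single: "mvar a * mvar b = single (single a 1 + single b 1) (1::'f::comm_ring_1)"
  by (simp add: mvar_def mult_single)

text \<open>Multiplying the column of each coordinate by the dual coordinate turns the part of a
  gradient in either block into the signed incidence row of the edge times the monomial
  \<open>y\<^sub>iy\<^sub>j\<close> or \<open>x\<^sub>ix\<^sub>j\<close>.\<close>

lemma gradient_part_incidence:
  assumes "\<And>e. k = Inl e \<Longrightarrow> Min e \<noteq> Max e"
  shows "gradient_part b k c * mvar (dual_coord c) =
    (single (row_exponent b k) 1 * mconst (of_int (incidence_row b k c)) :: ('n::linorder coord, 'f::comm_ring_1) mpoly)"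
proof (cases k)
  case (Inl e)
  then have ne: "Min e \<noteq> Max e" using assms by blast
  show ?thesis
    using ne
    by (cases c; cases b)
      (auto simp: Inl gradient_part_def gradient_row_def incidence_row_def row_exponent_def
        mderiv_binomial_form_CX mderiv_binomial_form_CY mvar_mult_eq_single mconst_uminus add.commute)
next
  case (Inr c')
  then show ?thesis
    by (auto simp: gradient_part_def gradient_row_def incidence_row_def row_exponent_def mvar_def)
qed

lemma prod_single:
  "finite A \<Longrightarrow> (\<Prod>a\<in>A. single (f a) (1::'f::comm_ring_1)) = single (\<Sum>a\<in>A. f a) 1"
  by (induction A rule: finite_induct) (simp_all add: mult_single)

text \<open>Every row is split into its two blocks and the determinant expanded over the sets
  \<open>A\<close> of rows using the first one. With the columns scaled by the dual coordinates,
  each term is a single monomial times an integral determinant, so coefficients are sums over the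
  \<open>A\<close> with a given monomial.\<close>

lemma lookup_gradient_det:
  fixes \<kappa> :: "'n::{finite,linorder} coord \<Rightarrow> 'n set + 'n coord"
  assumes "\<And>r e. \<kappa> r = Inl e \<Longrightarrow> Min e \<noteq> Max e"
  shows "lookup ((\<Prod>c\<in>UNIV. mvar (dual_coord c)) *
      det (\<chi> r c. (gradient_row (\<kappa> r) c :: ('n coord, int) mpoly))) m =
    (\<Sum>A\<in>{A. (\<Sum>r\<in>UNIV. row_exponent (r \<in> A) (\<kappa> r)) = m}. det (\<chi> r c. incidence_row (r \<in> A) (\<kappa> r) c))"
proof -
  let ?d = "\<Prod>c\<in>UNIV. mvar (dual_coord c) :: ('n coord, int) mpoly"
  let ?N = "\<lambda>A. det (\<chi> r c. incidence_row (r \<in> A) (\<kappa> r) c)"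
  let ?\<mu> = "\<lambda>A. \<Sum>r\<in>UNIV. row_exponent (r \<in> A) (\<kappa> r)"
  have part: "?d * det (\<chi> r c. (gradient_part (r \<in> A) (\<kappa> r) c :: ('n coord, int) mpoly)) =
      single (?\<mu> A) (?N A)" for A
  proof -
    have "?d * det (\<chi> r c. (gradient_part (r \<in> A) (\<kappa> r) c :: ('n coord, int) mpoly)) =
        det (\<chi> r c. gradient_part (r \<in> A) (\<kappa> r) c * mvar (dual_coord c))"
      by (subst det_cols_mul[symmetric]) simp
    also have "\<dots> = det (\<chi> r. single (row_exponent (r \<in> A) (\<kappa> r)) 1 *s
        (\<chi> c. mconst (incidence_row (r \<in> A) (\<kappa> r) c)))"
      using gradient_part_incidence[OF assms, where 'f = int] by (simp add: vector_scalar_mult_def)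
    also have "\<dots> = (\<Prod>r\<in>UNIV. single (row_exponent (r \<in> A) (\<kappa> r)) 1) *
        det (\<chi> r c. mconst (incidence_row (r \<in> A) (\<kappa> r) c))"
      by (rule det_rows_mul)
    also have "det (\<chi> r c. mconst (incidence_row (r \<in> A) (\<kappa> r) c)) = (mconst (?N A) :: ('n coord, int) mpoly)"
      by (subst mconst.det_hom) simp
    finally show ?thesis by (simp add: prod_single mconst_mult_single mult.commute[of _ "mconst _"])
  qed
  have "det (\<chi> r c. (gradient_row (\<kappa> r) c :: ('n coord, int) mpoly)) =
      det (\<chi> r. (\<chi> c. gradient_part True (\<kappa> r) c) + (\<chi> c. gradient_part False (\<kappa> r) c))"
    by (rule arg_cong[where f = det]) (simp add: vec_eq_iff gradient_part_add)
  also have "\<dots> = (\<Sum>A\<in>Pow UNIV. det (\<chi> r c. gradient_part (r \<in> A) (\<kappa> r) c))"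
    unfolding det_add_rows
    by (intro sum.cong refl arg_cong[where f = det]) (simp add: vec_eq_iff)
  finally have "?d * det (\<chi> r c. (gradient_row (\<kappa> r) c :: ('n coord, int) mpoly)) =
      (\<Sum>A\<in>UNIV. single (?\<mu> A) (?N A))"
    by (simp add: sum_distrib_left part)
  then show ?thesis
    by (simp add: lookup_sum lookup_single when_def sum.If_cases Int_def)
qed

text \<open>The rows of a nonsingular matrix are linearly independent over the rationals, so at most
  \<open>card T\<close> of them fit into the span of \<open>T\<close>. This bounds edge sets in a
  nonzero term.\<close>

lemma card_le_of_det_nonzero:
  fixes N :: "int ^ 'm ^ 'm::finite" and T :: "(rat ^ 'm) set"
  assumes det: "det N \<noteq> 0" and T: "finite T"
    and C: "\<And>r. r \<in> C \<Longrightarrow> (\<chi> c. of_int (N $ r $ c)) \<in> vec.span T"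
  shows "card C \<le> card T"
proof -
  define B :: "rat ^ 'm ^ 'm" where "B = (\<chi> i j. of_int (N $ i $ j))"
  have "det B = of_int (det N)"
    using comm_ring_1_hom.det_hom[OF of_int_hom[where 'a = rat], of N] by (simp add: B_def)
  then have dB: "det B \<noteq> 0" using det by simp
  have row: "row r B = B $ r" for r by (simp add: row_def vec_lambda_eta)
  have ind: "vec.independent (rows B)" using det_dependent_rows[of B] dB by blast
  have inj: "inj (\<lambda>r. B $ r)"
  proof (rule injI, rule ccontr)
    fix r r' assume "B $ r = B $ r'" "r \<noteq> r'"
    with det_identical_rows[of r r' B] dB show False by (simp add: row)
  qed
  have "(\<lambda>r. B $ r) ` C \<subseteq> rows B" by (auto simp: rows_def row)
  then have "vec.independent ((\<lambda>r. B $ r) ` C)" using ind vec.independent_mono by blast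
  moreover have "(\<lambda>r. B $ r) ` C \<subseteq> vec.span T" using C by (auto simp: B_def)
  ultimately have "card ((\<lambda>r. B $ r) ` C) \<le> card T" using vec.independent_span_bound[OF T] by blast
  then show ?thesis using inj by (simp add: card_image inj_on_def)
qed

text \<open>A monomial fixes the degree sequence of the set \<open>A\<close> of edges that contribute their first
  block.  If \<open>A0\<close> gives a nonzero minor, it is a forest and its complement has at most \<open>n\<close> edges;
  \<open>A\<close> is determined by its part outside \<open>A0\<close>, because the difference of two sets with equal degrees
  has no leaf and hence is not a nonempty forest.\<close>

lemma card_fiber_le:
  fixes \<kappa> :: "'n::{finite,linorder} coord \<Rightarrow> 'n set + 'n coord"
  assumes card2: "\<And>r e. \<kappa> r = Inl e \<Longrightarrow> card e = 2"
  shows "card {A. (\<Sum>r\<in>UNIV. row_exponent (r \<in> A) (\<kappa> r)) = m \<and>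
    det (\<chi> r c. incidence_row (r \<in> A) (\<kappa> r) c) \<noteq> 0} \<le> 2 ^ CARD('n)"
    (is "card ?\<Phi> \<le> _")
proof (cases "?\<Phi> = {}")
  case False
  then obtain A0 where A0: "A0 \<in> ?\<Phi>" by blast
  define IE where "IE = {r. \<exists>e. \<kappa> r = Inl e}"
  define ed where "ed r = projl (\<kappa> r)" for r
  have ed: "\<kappa> r = Inl (ed r)" if "r \<in> IE" for r using that by (auto simp: IE_def ed_def)
  have ed2: "card (ed r) = 2" if "r \<in> IE" for r using card2[OF ed[OF that]] .
  have mm: "Min (ed r) \<noteq> Max (ed r)" "ed r = {Min (ed r), Max (ed r)}" if "r \<in> IE" for r
    using Min_ne_Max[OF ed2[OF that]] by blast+
  \<comment> \<open>A unit row outside \<open>A\<close> contributes a zero row, so sets with nonzero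
    determinant contain all unit rows and can differ only in edge rows.\<close>
  have unit: "r \<in> A" if "A \<in> ?\<Phi>" "r \<notin> IE" for A r
  proof (rule ccontr)
    assume "r \<notin> A"
    moreover obtain c' where "\<kappa> r = Inr c'" using \<open>r \<notin> IE\<close> by (cases "\<kappa> r") (auto simp: IE_def)
    ultimately have "(\<chi> r c. incidence_row (r \<in> A) (\<kappa> r) c) $ r = 0"
      by (simp add: vec_eq_iff incidence_row_def)
    then have "det (\<chi> r c. incidence_row (r \<in> A) (\<kappa> r) c) = 0" by (rule det_zero_row')
    with that(1) show False by simp
  qed
  define B0 where "B0 = IE - A0"
  \<comment> \<open>The edges outside \<open>A0\<close> use the second block, whose \<open>n\<close>
    columns \<open>CY v\<close> leave room for at most \<open>n\<close> independent rows. This is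
    the source of the exponent \<open>n\<close>.\<close>
  have "card B0 \<le> card (range (\<lambda>v :: 'n. axis (CY v) (1::rat)))"
  proof (rule card_le_of_det_nonzero[where N = "\<chi> r c. incidence_row (r \<in> A0) (\<kappa> r) c"])
    show "det (\<chi> r c. incidence_row (r \<in> A0) (\<kappa> r) c) \<noteq> 0" using A0 by simp
    fix r assume r: "r \<in> B0"
    then have rI: "r \<in> IE" by (simp add: B0_def)
    have "(\<chi> c. of_int ((\<chi> r c. incidence_row (r \<in> A0) (\<kappa> r) c) $ r $ c)) =
        axis (CY (Max (ed r))) (1::rat) - axis (CY (Min (ed r))) 1"
      using r mm(1)[OF rI] by (auto simp: vec_eq_iff axis_def incidence_row_def ed[OF rI] B0_def)
    also have "\<dots> \<in> vec.span (range (\<lambda>v :: 'n. axis (CY v) (1::rat)))"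
      by (intro vec.span_diff vec.span_base) auto
    finally show "(\<chi> c. of_int ((\<chi> r c. incidence_row (r \<in> A0) (\<kappa> r) c) $ r $ c)) \<in>
        vec.span (range (\<lambda>v :: 'n. axis (CY v) (1::rat)))" .
  qed simp
  also have "\<dots> \<le> CARD('n)" by (rule card_image_le) simp
  finally have B0: "card B0 \<le> CARD('n)" .
  have inj: "inj_on (\<lambda>A. A \<inter> B0) ?\<Phi>"
  proof (rule inj_onI)
    fix A A' assume A: "A \<in> ?\<Phi>" and A': "A' \<in> ?\<Phi>" and eq: "A \<inter> B0 = A' \<inter> B0"
    \<comment> \<open>Sets agreeing on \<open>B0\<close> and on the unit rows can differ only inside
      the edges of \<open>A0\<close>, and \<open>C\<close> collects these differences.\<close>
    define C where "C = {r \<in> IE \<inter> A0. (r \<in> A) \<noteq> (r \<in> A')}"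
    have same: "r \<in> A \<longleftrightarrow> r \<in> A'" if "r \<notin> C" for r
      using that eq unit[OF A, of r] unit[OF A', of r] by (auto simp: C_def B0_def)
    have CI: "r \<in> IE" if "r \<in> C" for r using that by (simp add: C_def)
    have finC: "finite C" by simp
    let ?d = "\<lambda>A v. card {r \<in> C. r \<in> A \<and> v \<in> ed r}"
    have lk: "lookup (row_exponent (r \<in> A) (\<kappa> r)) (CY v) = (if r \<in> A \<and> v \<in> ed r then 1 else 0)"
      if r: "r \<in> C" for r v A
    proof -
      have "v \<in> ed r \<longleftrightarrow> v = Min (ed r) \<or> v = Max (ed r)" using mm(2)[OF CI[OF r]] by blast
      then show ?thesis using mm(1)[OF CI[OF r]]
        by (auto simp: row_exponent_def ed[OF CI[OF r]] lookup_add lookup_single when_def)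
    qed
    \<comment> \<open>The exponent of \<open>CY v\<close> counts the chosen edges at
      \<open>v\<close>. Outside \<open>C\<close> both sets contribute equally, so equal monomials
      give equal degrees inside \<open>C\<close>.\<close>
    have deg: "?d A v = ?d A' v" for v
    proof -
      let ?l = "\<lambda>A r. lookup (row_exponent (r \<in> A) (\<kappa> r)) (CY v)"
      have "(\<Sum>r\<in>UNIV. ?l A r) = (\<Sum>r\<in>UNIV. ?l A' r)"
        using A A' by (simp flip: lookup_sum)
      moreover have "(\<Sum>r\<in>UNIV. ?l A r) = (\<Sum>r\<in>C. ?l A r) + (\<Sum>r\<in>-C. ?l A r)" for A
        using sum.subset_diff[of C UNIV "?l A"] by (simp add: Compl_eq_Diff_UNIV)
      moreover have "(\<Sum>r\<in>-C. ?l A r) = (\<Sum>r\<in>-C. ?l A' r)" using same by (intro sum.cong) auto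
      ultimately have "(\<Sum>r\<in>C. ?l A r) = (\<Sum>r\<in>C. ?l A' r)" by simp
      moreover have "(\<Sum>r\<in>C. ?l A r) = ?d A v" for A
        using lk by (simp add: sum.If_cases Int_def)
      ultimately show ?thesis by simp
    qed
    define VC where "VC = (\<Union>r\<in>C. ed r)"
    have "C = {}"
    proof (rule ccontr)
      assume "C \<noteq> {}"
      \<comment> \<open>Each edge of \<open>C\<close> lies in exactly one of the two sets. A vertex
        met by an edge of one set is met by an edge of the other, since the degrees agree; hence it
        is no leaf and \<open>C\<close> has at least as many edges as vertices.\<close>
      have two: "2 \<le> card {r \<in> C. v \<in> ed r}" if v: "v \<in> VC" for v
      proof -
        obtain r where r: "r \<in> C" "v \<in> ed r" using v by (auto simp: VC_def)
        then have "r \<in> A \<or> r \<in> A'" by (auto simp: C_def)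
        then have "{r \<in> C. r \<in> A \<and> v \<in> ed r} \<noteq> {} \<or> {r \<in> C. r \<in> A' \<and> v \<in> ed r} \<noteq> {}" using r by blast
        then have "?d A v \<noteq> 0 \<or> ?d A' v \<noteq> 0" using finC by auto
        then have "?d A v \<ge> 1" "?d A' v \<ge> 1" using deg[of v] by linarith+
        moreover have "card {r \<in> C. v \<in> ed r} = ?d A v + ?d A' v"
          by (subst card_Un_disjoint[symmetric]) (auto simp: C_def intro!: arg_cong[where f = card])
        ultimately show ?thesis by simp
      qed
      have "2 * card VC \<le> (\<Sum>v\<in>VC. card {r \<in> C. v \<in> ed r})"
        using sum_bounded_below[of VC 2 "\<lambda>v. card {r \<in> C. v \<in> ed r}"] two by (simp add: mult.commute)
      also have "\<dots> = (\<Sum>v\<in>VC. \<Sum>r\<in>C. if v \<in> ed r then 1 else 0)"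
        by (simp add: sum.If_cases Int_def)
      also have "\<dots> = (\<Sum>r\<in>C. \<Sum>v\<in>VC. if v \<in> ed r then 1 else 0)" by (rule sum.swap)
      also have "\<dots> = (\<Sum>r\<in>C. 2)"
      proof (rule sum.cong[OF refl])
        fix r assume r: "r \<in> C"
        then have "VC \<inter> ed r = ed r" by (auto simp: VC_def)
        then show "(\<Sum>v\<in>VC. if v \<in> ed r then 1 else 0) = (2::nat)"
          using ed2[OF CI[OF r]] by (simp add: sum.If_cases)
      qed
      finally have VC_le: "card VC \<le> card C" by simp
      obtain r0 where r0: "r0 \<in> C" using \<open>C \<noteq> {}\<close> by blast
      define v0 where "v0 = Min (ed r0)"
      have v0: "v0 \<in> VC" using r0 mm(2)[OF CI[OF r0]] by (auto simp: VC_def v0_def)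
      \<comment> \<open>The rows of \<open>C\<close> have coordinate sum zero on the columns of
        \<open>VC\<close>; differences with one fixed vertex \<open>v0\<close> span this space with
        one generator fewer than there are vertices, the forest bound.\<close>
      let ?T = "(\<lambda>v. axis (CX v) (1::rat) - axis (CX v0) 1) ` (VC - {v0})"
      have sp: "axis (CX v) (1::rat) - axis (CX v0) 1 \<in> vec.span ?T" if "v \<in> VC" for v
      proof (cases "v = v0")
        case True
        then show ?thesis using vec.span_zero[of ?T] by simp
      next
        case False
        then show ?thesis using that by (intro vec.span_base) blast
      qed
      have "card C \<le> card ?T"
      proof (rule card_le_of_det_nonzero[where N = "\<chi> r c. incidence_row (r \<in> A0) (\<kappa> r) c"])
        show "det (\<chi> r c. incidence_row (r \<in> A0) (\<kappa> r) c) \<noteq> 0" using A0 by simp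
        fix r assume r: "r \<in> C"
        note rI = CI[OF r]
        have rA: "r \<in> A0" using r by (simp add: C_def)
        have V: "Min (ed r) \<in> VC" "Max (ed r) \<in> VC" using r mm(2)[OF rI] by (auto simp: VC_def)
        have "(\<chi> c. of_int ((\<chi> r c. incidence_row (r \<in> A0) (\<kappa> r) c) $ r $ c)) =
            (axis (CX (Min (ed r))) (1::rat) - axis (CX v0) 1) - (axis (CX (Max (ed r))) 1 - axis (CX v0) 1)"
          using rA mm(1)[OF rI] by (auto simp: vec_eq_iff axis_def incidence_row_def ed[OF rI])
        also have "\<dots> \<in> vec.span ?T" by (intro vec.span_diff sp V)
        finally show "(\<chi> c. of_int ((\<chi> r c. incidence_row (r \<in> A0) (\<kappa> r) c) $ r $ c)) \<in> vec.span ?T" .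
      qed simp
      also have "\<dots> \<le> card (VC - {v0})" by (rule card_image_le) simp
      also have "\<dots> < card VC" using v0 by (intro psubset_card_mono) auto
      finally show False using VC_le by simp
    qed
    then show "A = A'" using same by blast
  qed
  have "card ?\<Phi> \<le> card (Pow B0)"
    by (rule card_inj_on_le[OF inj]) auto
  also have "\<dots> \<le> 2 ^ CARD('n)" using B0 by (simp add: card_Pow)
  finally show ?thesis .
next
  case True
  show ?thesis unfolding True by simp
qed

section \<open>Survival of the minor under reduction\<close>

lemma reduce_coeffs_gradient_row:
  assumes "\<And>e. k = Inl e \<Longrightarrow> card e = 2"
  shows "reduce_coeffs (gradient_row k c :: ('n::linorder coord, int) mpoly) =
    (gradient_row k c :: ('n coord, 'f::comm_ring_1) mpoly)"
proof (cases k)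
  case (Inl e)
  have "Min e \<noteq> Max e" using Min_ne_Max(1) assms Inl by blast
  then show ?thesis
    by (cases c) (simp_all add: Inl gradient_row_def mderiv_binomial_form_CX mderiv_binomial_form_CY red.hom_uminus)
qed (simp add: gradient_row_def)

text \<open>Scaling the columns multiplies the minor by a nonzero product of variables. Each term of
  a coefficient is at most one in absolute value and at most \<open>2 ^ CARD('n)\<close> of them are
  nonzero, so a nonzero coefficient is not divisible by the characteristic.\<close>

theorem gradient_det_nonzero:
  fixes \<kappa> :: "'n::{finite,linorder} coord \<Rightarrow> 'n set + 'n coord"
  assumes card2: "\<And>r e. \<kappa> r = Inl e \<Longrightarrow> card e = 2"
    and char_F: "CHAR('f::field) = 0 \<or> CHAR('f) > 2 ^ CARD('n)"
    and det: "det (\<chi> r c. (gradient_row (\<kappa> r) c :: ('n coord, int) mpoly)) \<noteq> 0"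
  shows "det (\<chi> r c. (gradient_row (\<kappa> r) c :: ('n coord, 'f) mpoly)) \<noteq> 0"
proof -
  let ?D = "det (\<chi> r c. (gradient_row (\<kappa> r) c :: ('n coord, int) mpoly))"
  let ?d = "\<Prod>c\<in>UNIV. mvar (dual_coord c) :: ('n coord, int) mpoly"
  let ?N = "\<lambda>A. det (\<chi> r c. incidence_row (r \<in> A) (\<kappa> r) c)"
  let ?\<mu> = "\<lambda>A. \<Sum>r\<in>UNIV. row_exponent (r \<in> A) (\<kappa> r)"
  have "?d * ?D \<noteq> 0" using det by simp
  then obtain m where m: "lookup (?d * ?D) m \<noteq> 0"
    by (metis lookup_zero poly_mapping_eqI)
  let ?\<Phi> = "{A. ?\<mu> A = m \<and> ?N A \<noteq> 0}"
  have "lookup (?d * ?D) m = (\<Sum>A\<in>{A. ?\<mu> A = m}. ?N A)"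
    by (rule lookup_gradient_det) (use card2 Min_ne_Max(1) in blast)
  also have "\<dots> = (\<Sum>A\<in>?\<Phi>. ?N A)" by (rule sum.mono_neutral_right) auto
  also have "\<bar>\<dots>\<bar> \<le> (\<Sum>A\<in>?\<Phi>. \<bar>?N A\<bar>)" by (rule sum_abs)
  also have "\<dots> \<le> (\<Sum>A\<in>?\<Phi>. 1)"
  proof (rule sum_mono)
    fix A
    show "\<bar>?N A\<bar> \<le> 1"
    proof (rule abs_det_incidence)
      fix r
      let ?z = "(\<chi> r c. incidence_row (r \<in> A) (\<kappa> r) c) $ r"
      show "unit_like ?z \<or> (\<exists>a b. a \<noteq> b \<and> ?z = axis a 1 - axis b 1)"
      proof (cases "\<kappa> r")
        case (Inl e)
        have mm: "Min e \<noteq> Max e" using Min_ne_Max(1)[OF card2[OF Inl]] .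
        show ?thesis
        proof (cases "r \<in> A")
          case True
          have "?z = axis (CX (Min e)) 1 - axis (CX (Max e)) 1"
            using mm True by (auto simp: vec_eq_iff axis_def incidence_row_def Inl)
          then show ?thesis using mm by (metis coord.inject(1))
        next
          case False
          have "?z = axis (CY (Max e)) 1 - axis (CY (Min e)) 1"
            using mm False by (auto simp: vec_eq_iff axis_def incidence_row_def Inl)
          then show ?thesis using mm by (metis coord.inject(2))
        qed
      next
        case (Inr c)
        have "?z = (if r \<in> A then axis c 1 else 0)"
          by (auto simp: vec_eq_iff axis_def incidence_row_def Inr)
        then show ?thesis by (auto simp: unit_like_def)
      qed
    qed
  qed
  also have "\<dots> = int (card ?\<Phi>)" by simp
  also have "\<dots> \<le> 2 ^ CARD('n)"
  proof -
    have "card ?\<Phi> \<le> 2 ^ CARD('n)" by (rule card_fiber_le[OF card2])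
    then have "int (card ?\<Phi>) \<le> int (2 ^ CARD('n))" by (rule of_nat_mono)
    then show ?thesis by simp
  qed
  finally have le: "\<bar>lookup (?d * ?D) m\<bar> \<le> 2 ^ CARD('n)" .
  have "(of_int (lookup (?d * ?D) m) :: 'f) \<noteq> 0"
  proof
    assume "(of_int (lookup (?d * ?D) m) :: 'f) = 0"
    then have dvd: "int CHAR('f) dvd lookup (?d * ?D) m" by (simp add: of_int_eq_0_iff_char_dvd)
    then have "CHAR('f) \<noteq> 0" using m by auto
    then have "2 ^ CARD('n) < CHAR('f)" using char_F by simp
    then have "int (2 ^ CARD('n)) < int CHAR('f)" by (simp only: of_nat_less_iff)
    then have "(2::int) ^ CARD('n) < int CHAR('f)" by simp
    also have "\<dots> \<le> \<bar>lookup (?d * ?D) m\<bar>" using dvd_imp_le_int[OF m dvd] by simp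
    finally show False using le by simp
  qed
  then have "reduce_coeffs (?d * ?D) \<noteq> (0 :: ('n coord, 'f) mpoly)"
    by (metis lookup_reduce_coeffs lookup_zero)
  then have "reduce_coeffs ?D \<noteq> (0 :: ('n coord, 'f) mpoly)" by (auto simp: red.hom_mult)
  moreover have "reduce_coeffs ?D = det (\<chi> r c. (gradient_row (\<kappa> r) c :: ('n coord, 'f) mpoly))"
    by (subst red.det_hom) (simp add: reduce_coeffs_gradient_row card2)
  ultimately show ?thesis by simp
qed

text \<open>The gradients of \<open>S\<close> are among the rows of a square matrix whose
  determinant stays nonzero over the field, so they are linearly independent.\<close>

theorem algebraic_indep_imp_hyperconn_indep:
  fixes S :: "'n::{finite,linorder} set set"
  assumes S: "\<And>e. e \<in> S \<Longrightarrow> card e = 2"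
    and char_F: "CHAR('f::field) = 0 \<or> CHAR('f) > 2 ^ CARD('n)"
    and indep: "algebraic_indep TYPE('f) S"
  shows "hyperconn_indep TYPE('f) S"
proof -
  obtain \<kappa> :: "'n coord \<Rightarrow> 'n set + 'n coord" where \<kappa>: "\<And>e. e \<in> S \<Longrightarrow> Inl e \<in> range \<kappa>" "\<And>r e. \<kappa> r = Inl e \<Longrightarrow> e \<in> S"
    and detZ: "det (\<chi> r c. (gradient_row (\<kappa> r) c :: ('n coord, int) mpoly)) \<noteq> 0"
    using ex_nonzero_jacobian_det[OF algebraic_indep_imp_int[OF S indep] S] by blast
  let ?M = "\<chi> r c. (gradient_row (\<kappa> r) c :: ('n coord, 'f) mpoly)"
  have detF: "det ?M \<noteq> 0" by (rule gradient_det_nonzero[OF _ char_F detZ]) (use \<kappa>(2) S in blast)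
  define M where "M = (\<chi> r c. Fract (?M $ r $ c) 1)"
  have "det M = Fract (det ?M) 1" unfolding M_def by (rule Fract.det_hom[symmetric])
  then have detM: "det M \<noteq> 0" using detF by simp
  have "\<forall>e\<in>S. \<exists>r. \<kappa> r = Inl e" using \<kappa>(1) by (metis rangeE)
  from bchoice[OF this] obtain \<rho> where \<rho>: "\<And>e. e \<in> S \<Longrightarrow> \<kappa> (\<rho> e) = Inl e" by blast
  have inj: "inj_on \<rho> S" by (rule inj_onI) (metis \<rho> sum.inject(1))
  show ?thesis
  proof (rule hyperconn_indep_iff[OF S, THEN iffD2], assumption, intro allI impI ballI)
    fix u :: "'n set \<Rightarrow> ('n coord, 'f) mpoly" and e
    assume u: "\<forall>c. (\<Sum>e\<in>S. u e * mderiv c (binomial_form e)) = 0" and e: "e \<in> S"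
    define z where "z = (\<chi> r. if r \<in> \<rho> ` S then Fract (u (the_inv_into S \<rho> r)) 1 else 0)"
    have eq: "(\<Sum>r\<in>UNIV. z $ r *s row r M) = 0"
    proof (rule vec_eq_iff[THEN iffD2], rule allI)
      fix c
      have "(\<Sum>r\<in>UNIV. z $ r *s row r M) $ c = (\<Sum>r\<in>\<rho> ` S. Fract (u (the_inv_into S \<rho> r) * gradient_row (\<kappa> r) c) 1)"
        by (simp add: row_def, intro sum.mono_neutral_cong_right) (auto simp: z_def M_def)
      also have "\<dots> = (\<Sum>e\<in>S. Fract (u e * mderiv c (binomial_form e)) 1)"
        using inj by (subst sum.reindex) (auto simp: the_inv_into_f_f \<rho> gradient_row_def)
      also have "\<dots> = Fract (\<Sum>e\<in>S. u e * mderiv c (binomial_form e)) 1" by (simp add: Fract.hom_sum)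
      finally show "(\<Sum>r\<in>UNIV. z $ r *s row r M) $ c = 0 $ c" using u by simp
    qed
    \<comment> \<open>Cramer's rule for a vanishing combination of rows: the coefficient times the
      determinant is a determinant with a zero row.\<close>
    have "z $ \<rho> e * det M = det (\<chi> i. if i = \<rho> e then 0 else row i M)"
      using cramer_lemma_transpose[of "\<rho> e" z M] unfolding eq by (rule sym)
    then have "z $ \<rho> e = 0" using detM by (simp add: det_row_0)
    then show "u e = 0" using e inj by (simp add: z_def the_inv_into_f_f)
  qed
qed

section \<open>The rank of the hyperconnectivity matroid\<close>

lemma CARD_coord: "CARD('n::finite coord) = 2 * CARD('n)"
proof -
  have "(UNIV :: 'n coord set) = range CX \<union> range CY"
  proof (rule UNIV_eq_I)
    fix c :: "'n coord"
    show "c \<in> range CX \<union> range CY" by (cases c) auto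
  qed
  moreover have "card (range CX \<union> range CY :: 'n coord set) = card (range CX :: 'n coord set) + card (range CY :: 'n coord set)"
    by (rule card_Un_disjoint) auto
  moreover have "card (range CX :: 'n coord set) = CARD('n)" "card (range CY :: 'n coord set) = CARD('n)"
    by (simp_all add: card_image inj_def)
  ultimately show ?thesis by simp
qed

lemma sum_hyperconn_row:
  fixes e :: "'n::{finite,linorder} set" and a :: "'n coord \<Rightarrow> ('n coord, 'f::field) mpoly fract"
  assumes "card e = 2"
  shows "(\<Sum>c\<in>UNIV. hyperconn_row e $ c * a c) =
    generic_coord (CX (Max e)) * a (CX (Min e)) - generic_coord (CX (Min e)) * a (CX (Max e)) +
    generic_coord (CY (Max e)) * a (CY (Min e)) - generic_coord (CY (Min e)) * a (CY (Max e))"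
proof -
  let ?i = "Min e" and ?j = "Max e"
  have ne: "?i \<noteq> ?j" using Min_ne_Max(1)[OF assms] .
  have z: "hyperconn_row e $ c * a c = 0" if "c \<notin> {CX ?i, CX ?j, CY ?i, CY ?j}" for c
    using that by (cases c) (auto simp: hyperconn_row_def Let_def)
  have "(\<Sum>c\<in>UNIV. hyperconn_row e $ c * a c) = (\<Sum>c\<in>{CX ?i, CX ?j, CY ?i, CY ?j}. hyperconn_row e $ c * a c)"
    using z by (intro sum.mono_neutral_right) auto
  also have "\<dots> = hyperconn_row e $ CX ?i * a (CX ?i) + hyperconn_row e $ CX ?j * a (CX ?j) +
      hyperconn_row e $ CY ?i * a (CY ?i) + hyperconn_row e $ CY ?j * a (CY ?j)"
    using ne by simp
  finally show ?thesis using ne by (simp add: hyperconn_row_def Let_def)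
qed

text \<open>The kernel vectors are the infinitesimal action of the Lie algebra of \<open>SL\<^sub>2\<close>, which
  preserves all \<open>x\<^sub>iy\<^sub>j - x\<^sub>jy\<^sub>i\<close>.\<close>

lemma hyperconn_rank_le:
  fixes E :: "'n::{finite,linorder} set set"
  assumes n: "CARD('n) \<ge> 2" and E: "\<And>e. e \<in> E \<Longrightarrow> card e = 2"
  shows "hyperconn_rank TYPE('f::field) E \<le> 2 * CARD('n) - 3"
proof -
  let ?row = "hyperconn_row :: 'n set \<Rightarrow> ('n coord, 'f) mpoly fract ^ 'n coord"
  let ?g = "generic_coord :: 'n coord \<Rightarrow> ('n coord, 'f) mpoly fract"
  obtain v w :: 'n where vw: "v \<noteq> w"
    using n by (metis (full_types) One_nat_def card_1_singleton_iff card_le_Suc0_iff_eq finite not_less_eq_eq numeral_2_eq_2 UNIV_I)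
  \<comment> \<open>Read through the duality with gradients, \<open>a\<close> and \<open>b\<close>
    are, up to sign, the shears \<open>x d/dy\<close> and \<open>y d/dx\<close>, and
    \<open>d\<close> is the diagonal action \<open>x d/dx - y d/dy\<close>.\<close>
  define a b d where "a c = (case c of CX k \<Rightarrow> ?g (CX k) | CY k \<Rightarrow> 0)"
    and "b c = (case c of CX k \<Rightarrow> 0 | CY k \<Rightarrow> ?g (CY k))"
    and "d c = (case c of CX k \<Rightarrow> ?g (CY k) | CY k \<Rightarrow> ?g (CX k))" for c :: "'n coord"
  define Z where "Z = {z :: ('n coord, 'f) mpoly fract ^ 'n coord.
    (\<Sum>c\<in>UNIV. z $ c * a c) = 0 \<and> (\<Sum>c\<in>UNIV. z $ c * b c) = 0 \<and> (\<Sum>c\<in>UNIV. z $ c * d c) = 0}"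
  have lin: "(\<Sum>c\<in>UNIV. (s *s z) $ c * h c) = s * (\<Sum>c\<in>UNIV. z $ c * h c)"
    for s and z :: "('n coord, 'f) mpoly fract ^ 'n coord" and h
    by (simp add: sum_distrib_left mult.assoc)
  have subZ: "vec.subspace Z"
  proof (rule vec.subspaceI)
    show "0 \<in> Z" by (simp add: Z_def)
    show "x + y \<in> Z" if "x \<in> Z" "y \<in> Z" for x y
      using that by (simp add: Z_def distrib_right sum.distrib)
    show "s *s x \<in> Z" if "x \<in> Z" for s x using that unfolding Z_def mem_Collect_eq lin by simp
  qed
  have "?row e \<in> Z" if "e \<in> E" for e
    unfolding Z_def mem_Collect_eq sum_hyperconn_row[OF E[OF that]] by (simp add: a_def b_def d_def algebra_simps)
  then have "?row ` E \<subseteq> Z" by blast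
  then have span: "vec.span (?row ` E) \<subseteq> Z" by (rule vec.span_minimal[OF _ subZ])
  \<comment> \<open>On these three coordinates the vectors \<open>a\<close>, \<open>b\<close>,
    \<open>d\<close> have determinant \<open>y_v (x_v y_w - x_w y_v)\<close> up to sign. As it is
    nonzero, an element of \<open>Z\<close> is determined by its other coordinates, which number
    \<open>2n - 3\<close>.\<close>
  define K where "K = {CX v, CY v, CX w}"
  have cardK: "card (- K) = 2 * CARD('n) - 3"
    using vw by (simp add: Compl_eq_Diff_UNIV card_Diff_subset CARD_coord K_def)
  define P :: "('n coord, 'f) mpoly fract ^ 'n coord ^ 'n coord"
    where "P = (\<chi> i j. if i = j \<and> i \<notin> K then 1 else 0)"
  have P: "(P *v z) $ c = (if c \<in> K then 0 else z $ c)" for z c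
  proof -
    have "(P *v z) $ c = (\<Sum>j\<in>UNIV. (if c = j \<and> c \<notin> K then 1 else 0) * z $ j)"
      by (simp add: matrix_vector_mult_def P_def)
    also have "\<dots> = (\<Sum>j\<in>UNIV. if j = c then (if c \<in> K then 0 else z $ c) else 0)"
      by (intro sum.cong) auto
    finally show ?thesis by simp
  qed
  have ker: "z = 0" if "z \<in> Z" "P *v z = 0" for z
  proof -
    have off: "z $ c = 0" if "c \<notin> K" for c using P[of z c] that \<open>P *v z = 0\<close> by simp
    have s: "(\<Sum>c\<in>UNIV. z $ c * h c) = z $ CX v * h (CX v) + z $ CY v * h (CY v) + z $ CX w * h (CX w)" for h
    proof -
      have "(\<Sum>c\<in>UNIV. z $ c * h c) = (\<Sum>c\<in>K. z $ c * h c)"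
        using off by (intro sum.mono_neutral_right) auto
      then show ?thesis using vw by (simp add: K_def add.assoc)
    qed
    have e1: "z $ CX v * ?g (CX v) + z $ CX w * ?g (CX w) = 0" and e2: "z $ CY v * ?g (CY v) = 0"
      and e3: "z $ CX v * ?g (CY v) + z $ CY v * ?g (CX v) + z $ CX w * ?g (CY w) = 0"
      using \<open>z \<in> Z\<close> unfolding Z_def mem_Collect_eq s by (simp_all add: a_def b_def d_def)
    have g0: "?g c \<noteq> 0" for c by (simp add: generic_coord_def)
    have z2: "z $ CY v = 0" using e2 g0 by simp
    have "z $ CX v * (?g (CX v) * ?g (CY w) - ?g (CX w) * ?g (CY v)) =
        (z $ CX v * ?g (CX v) + z $ CX w * ?g (CX w)) * ?g (CY w) -
        (z $ CX v * ?g (CY v) + z $ CY v * ?g (CX v) + z $ CX w * ?g (CY w)) * ?g (CX w)"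
      by (simp add: z2 algebra_simps)
    also have "\<dots> = 0" unfolding e1 e3 by simp
    finally have prod: "z $ CX v * (?g (CX v) * ?g (CY w) - ?g (CX w) * ?g (CY v)) = 0" .
    \<comment> \<open>The derivative by \<open>x_v\<close> is the variable \<open>y_w\<close>, which
      certifies that the binomial of \<open>v\<close> and \<open>w\<close> is not zero.\<close>
    have "mderiv (CX v) (mvar (CX v) * mvar (CY w) - mvar (CX w) * mvar (CY v) :: ('n coord, 'f) mpoly) = mvar (CY w)"
      using vw by (simp add: mderiv_diff mderiv_mult mderiv_mvar)
    then have "mvar (CX v) * mvar (CY w) - mvar (CX w) * mvar (CY v) \<noteq> (0 :: ('n coord, 'f) mpoly)"
      by (metis mderiv_0 mvar_neq_0)
    then have "?g (CX v) * ?g (CY w) - ?g (CX w) * ?g (CY v) \<noteq> 0"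
      by (simp add: generic_coord_def)
    then have z1: "z $ CX v = 0" using prod by simp
    then have z3: "z $ CX w = 0" using e1 g0 by simp
    have "z $ c = 0" for c using off[of c] z1 z2 z3 by (auto simp: K_def)
    then show ?thesis by (simp add: vec_eq_iff)
  qed
  obtain B where B: "B \<subseteq> ?row ` E" "vec.independent B" "?row ` E \<subseteq> vec.span B" "card B = vec.dim (?row ` E)"
    using vec.basis_exists by blast
  have BZ: "vec.span B \<subseteq> Z" using vec.span_mono[OF B(1)] span by blast
  have inj: "inj_on ((*v) P) (vec.span B)"
  proof (rule inj_onI)
    fix x y assume xy: "x \<in> vec.span B" "y \<in> vec.span B" "P *v x = P *v y"
    then have "x - y \<in> Z" using BZ vec.span_diff by blast
    moreover have "P *v (x - y) = 0" using xy(3) by (simp add: matrix_vector_mult_diff_distrib)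
    ultimately show "x = y" using ker by fastforce
  qed
  have ind: "vec.independent ((*v) P ` B)"
    by (rule vec.linear_independent_injective_image[OF matrix_vector_mul_linear_gen B(2) inj])
  let ?T = "(\<lambda>c. axis c (1 :: ('n coord, 'f) mpoly fract)) ` (- K)"
  have "(*v) P ` B \<subseteq> vec.span ?T"
  proof
    fix x assume "x \<in> (*v) P ` B"
    then obtain z where x: "x = P *v z" by blast
    have "x = (\<Sum>c\<in>-K. z $ c *s axis c 1)"
    proof (rule vec_eq_iff[THEN iffD2], rule allI)
      fix i
      have "(\<Sum>c\<in>-K. z $ c *s axis c 1) $ i = (\<Sum>c\<in>-K. z $ c * axis c 1 $ i)" by simp
      also have "\<dots> = (\<Sum>c\<in>-K. if c = i then z $ c else 0)"
        by (intro sum.cong) (auto simp: axis_def)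
      finally show "x $ i = (\<Sum>c\<in>-K. z $ c *s axis c 1) $ i" by (simp add: x P)
    qed
    also have "\<dots> \<in> vec.span ?T" by (intro vec.span_sum vec.span_scale vec.span_base) auto
    finally show "x \<in> vec.span ?T" .
  qed
  then have "card ((*v) P ` B) \<le> card ?T" using vec.independent_span_bound[OF _ ind] by simp
  also have "\<dots> \<le> card (- K)" by (rule card_image_le) simp
  also have "card ((*v) P ` B) = card B"
    by (rule card_image) (rule inj_on_subset[OF inj vec.span_superset])
  finally show ?thesis by (simp add: hyperconn_rank_def B(4) cardK)
qed

section \<open>Matroid rank as analytic spread\<close>

lemma homog_edge_binomial: "homog 2 (edge_binomial e :: ('n::linorder coord, 'f::field) mpoly)"
proof -
  have "homog 2 (mvar a * mvar b :: ('n coord, 'f) mpoly)" for a b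
    using homog_mult[OF homog_mvar homog_mvar] by (simp add: numeral_2_eq_2)
  moreover have "homog d (p - q)" if "homog d p" "homog d q" for d and p q :: "('n coord, 'f) mpoly"
    using that by (auto simp: homog_def in_keys_iff lookup_minus)
  ultimately show ?thesis by (simp add: edge_binomial_def Let_def)
qed

theorem theorem1p1:
  fixes E :: "'n::{finite,linorder} set set"
  assumes n_ge_2: "CARD('n) \<ge> 2"
    and char_F: "CHAR('f::field) = 0 \<or> CHAR('f) > 2 ^ CARD('n)"
    and graph: "simple_graph_edges E"
    and no_isolated: "no_isolated_vertices E"
  shows "matroid_isomorphic E (algebraic_indep TYPE('f)) E (hyperconn_indep TYPE('f))
    \<and> analytic_spread (binomial_edge_ideal E :: ('n coord, 'f) mpoly set)
          = enat (hyperconn_rank TYPE('f) E)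
    \<and> hyperconn_rank TYPE('f) E \<le> 2 * CARD('n) - 3"
proof (intro conjI)
  have E: "card e = 2" if "e \<in> E" for e using graph that by (simp add: simple_graph_edges_def)
  have iff: "algebraic_indep TYPE('f) S \<longleftrightarrow> hyperconn_indep TYPE('f) S" if "S \<subseteq> E" for S
  proof
    have S: "card e = 2" if "e \<in> S" for e using E \<open>S \<subseteq> E\<close> that by blast
    show "hyperconn_indep TYPE('f) S" if "algebraic_indep TYPE('f) S"
      by (rule algebraic_indep_imp_hyperconn_indep[OF S char_F that])
    show "algebraic_indep TYPE('f) S" if "hyperconn_indep TYPE('f) S"
      by (rule hyperconn_indep_imp_algebraic_indep[OF S that])
  qed
  show "matroid_isomorphic E (algebraic_indep TYPE('f)) E (hyperconn_indep TYPE('f))"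
    unfolding matroid_isomorphic_def matroid_isomorphism_def using iff by (intro exI[of _ id]) auto
  show "hyperconn_rank TYPE('f) E \<le> 2 * CARD('n) - 3" by (rule hyperconn_rank_le[OF n_ge_2 E])
  let ?row = "hyperconn_row :: 'n set \<Rightarrow> ('n coord, 'f) mpoly fract ^ 'n coord"
  let ?f = "edge_binomial :: 'n set \<Rightarrow> ('n coord, 'f) mpoly"
  let ?ind = "algebraically_independent (mconst :: 'f \<Rightarrow> ('n coord, 'f) mpoly)"
  have alg: "algebraic_indep TYPE('f) S \<longleftrightarrow> ?ind (?f ` S)" for S :: "'n set set"
    by (simp add: algebraic_indep_def)
  obtain R where R: "R \<subseteq> ?row ` E" "vec.independent R" "?row ` E \<subseteq> vec.span R" "card R = vec.dim (?row ` E)"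
    using vec.basis_exists by blast
  \<comment> \<open>A basis of the row space is represented by a set of edges, one edge per row; the
    equivalence of independence will turn it into a maximal independent set of forms.\<close>
  obtain B where B: "B \<subseteq> E" "inj_on ?row B" "R = ?row ` B" using R(1) by (meson subset_image_inj)
  have "hyperconn_indep TYPE('f) B" using B R(2) by (simp add: hyperconn_indep_def)
  then have indB: "?ind (?f ` B)" using iff[OF B(1)] alg by blast
  have injf: "inj_on ?f E" using inj_on_binomial_form[OF E] by (simp add: edge_binomial_eq[abs_def])
  \<comment> \<open>If a further form kept the set independent, the row of its edge would lie
    outside the span of the row basis.\<close>
  have "\<not> ?ind (insert y (?f ` B))" if y: "y \<in> ?f ` E - ?f ` B" for y
  proof
    assume i: "?ind (insert y (?f ` B))"
    obtain e where e: "e \<in> E" "e \<notin> B" "y = ?f e" using y by blast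
    then have "algebraic_indep TYPE('f) (insert e B)" using i alg by simp
    then have "hyperconn_indep TYPE('f) (insert e B)" using iff[of "insert e B"] e B(1) by blast
    then have "inj_on ?row (insert e B)" "vec.independent (insert (?row e) (?row ` B))"
      by (simp_all add: hyperconn_indep_def)
    moreover from this(1) e(2) have "?row e \<notin> ?row ` B" by auto
    ultimately have "?row e \<notin> vec.span R" by (simp add: vec.independent_insert B(3))
    with R(3) e(1) show False by blast
  qed
  then have "krull_dim (mfield.adj_ring (?f ` E)) = enat (card (?f ` B))"
    by (intro mfield.krull_dim_adj_ring indB) (use B(1) in auto)
  also have "card (?f ` B) = hyperconn_rank TYPE('f) E"
    using card_image[OF inj_on_subset[OF injf B(1)]] card_image[OF B(2)] R(4)
    by (simp add: hyperconn_rank_def B(3))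
  also have "krull_dim (mfield.adj_ring (?f ` E)) = analytic_spread (binomial_edge_ideal E :: ('n coord, 'f) mpoly set)"
    unfolding analytic_spread_def binomial_edge_ideal_def
    by (rule krull_dim_special_fiber[where \<delta> = 2, symmetric]) (auto simp: homog_edge_binomial)
  finally show "analytic_spread (binomial_edge_ideal E :: ('n coord, 'f) mpoly set) = enat (hyperconn_rank TYPE('f) E)" .
qed

end
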